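(* Let $d\ge1$ be the dimension and suppose $\omega>0$. There is a unique $SO(d)$-invariant self-adjoint second order differential operator having principal symbol determined by the standard metric for the $d$-sphere and having the ground state $(1+r^2)^{-\omega}$, with vanishing ground state energy, namely $$\mathbf L_{\omega}=-\frac14(1+r^2)^2\left(\Big(\frac{d}{dr}\Big)^2+\frac1r\Big(1+(d-2)\frac{1-r^2}{1+r^2}\Big)\frac{d}{dr}+\frac{1}{r^2}\Delta_{S^{d-1}}\right)+\omega^2r^2-d\,\frac{((d-2)^2+16\omega^2)^{1/2}-(d-2)}{8},$$ that is, $\mathbf L_\omega=\Delta_{S^d}+\omega^2r^2-d\,\frac{((d-2)^2+16\omega^2)^{1/2}-(d-2)}{8}$.
   Context: Identify $S^d$ minus a point with $\mathbb R^d$ by stereographic projection $(x_1,\dots,x_d,y)\mapsto x=(x_1,\dots,x_d)/(1-y)$, and let $r=|x|$. The round metric becomes $\frac{4}{(1+r^2)^2}$ times the Euclidean metric, with volume form $dV_{S^d}=2^d(1+r^2)^{-d}dV_{\mathbb R^d}$. Let $\Delta_{S^d}$ be the nonnegative Laplace operator of the round metric; in the coordinates above it is $$\Delta_{S^d}=-\frac14(1+r^2)^2\left(\Big(\frac{d}{dr}\Big)^2+\frac1r\Big(1+(d-2)\frac{1-r^2}{1+r^2}\Big)\frac{d}{dr}+\frac{1}{r^2}\Delta_{S^{d-1}}\right),$$ where, inside this formula, $\Delta_{S^{d-1}}$ is the Laplacian of the unit sphere $S^{d-1}$ with the sign convention of $\frac{d^2}{d\theta^2}$ when $d=2$. The square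 root $((d-2)^2+16\omega^2)^{1/2}$ is the positive one. Operators act in the real Hilbert space $L^2(S^d,dV_{S^d};\mathbb R)$, and self-adjointness is with respect to $dV_{S^d}$. "Principal symbol determined by the standard metric" means the same second order part as $\Delta_{S^d}$. The ground state of an operator is its eigenfunction (up to a scalar) for the smallest eigenvalue, and that eigenvalue is the ground state energy.
   Formalization: For d≠2 the displayed L_ω does not annihilate (1+r²)^(-ω). Unique existence is kept for that ground state, with the name L_ω only for d=2; for all d, L_ω is the unique operator with ground state (1+r²)^(-k), k=(((d-2)²+16ω²)^(1/2)-(d-2))/4. *)

theory Defs
  imports "HOL-Analysis.Analysis"
begin

section \<open>Differential operators on Euclidean space\<close>

text \<open>
  The sphere minus a point is \<open>real^'n\<close>, with \<open>d = CARD('n)\<close>, by stereographic projection.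
  Functions on it that are smooth in the usual sense are those all of whose iterated partial
  derivatives are (Frechet) differentiable everywhere.
\<close>

definition pd :: "'n::finite \<Rightarrow> (real^'n \<Rightarrow> real) \<Rightarrow> real^'n \<Rightarrow> real" where
  "pd i u x = frechet_derivative u (at x) (axis i 1)"

definition smooth_functions :: "(real^'n::finite \<Rightarrow> real) set" where
  "smooth_functions = {u. \<forall>is. foldr pd is u differentiable_on UNIV}"

definition test_functions :: "(real^'n::finite \<Rightarrow> real) set" where
  "test_functions = {u \<in> smooth_functions. compact (closure {x. u x \<noteq> 0})}"

text \<open>
  Differential operators act on the smooth functions; they are made extensional there
  (via \<^const>\<open>restrict\<close>), so that equality of operators is equality on smooth functions.
\<close>

type_synonym 'n diffop = "(real^'n \<Rightarrow> real) \<Rightarrow> real^'n \<Rightarrow> real"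

definition diffop2 ::
  "(real^'n \<Rightarrow> real^'n^'n) \<Rightarrow> (real^'n \<Rightarrow> real^'n) \<Rightarrow> (real^'n \<Rightarrow> real) \<Rightarrow> 'n::finite diffop" where
  "diffop2 a b c = (\<lambda>u\<in>smooth_functions. \<lambda>x.
     (\<Sum>i\<in>UNIV. \<Sum>j\<in>UNIV. a x $ i $ j * pd i (pd j u) x) + (\<Sum>i\<in>UNIV. b x $ i * pd i u x) + c x * u x)"

definition second_order_part :: "'n::finite diffop \<Rightarrow> (real^'n \<Rightarrow> real^'n^'n) \<Rightarrow> bool" where
  "second_order_part P a \<longleftrightarrow>
     (\<forall>x. transpose (a x) = a x) \<and> (\<forall>i j. (\<lambda>x. a x $ i $ j) \<in> smooth_functions) \<and>
     (\<exists>b c. (\<forall>i. (\<lambda>x. b x $ i) \<in> smooth_functions) \<and> c \<in> smooth_functions \<and> P = diffop2 a b c)"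

definition same_second_order_part :: "'n::finite diffop \<Rightarrow> 'n diffop \<Rightarrow> bool" where
  "same_second_order_part P Q \<longleftrightarrow> (\<exists>a. second_order_part P a \<and> second_order_part Q a)"


section \<open>The round sphere in stereographic coordinates\<close>

text \<open>A Riemannian metric is given by its Gram matrix in the coordinates.\<close>

definition round_metric :: "real^'n::finite \<Rightarrow> real^'n^'n" where
  "round_metric x = (4 / (1 + (norm x)\<^sup>2)\<^sup>2) *\<^sub>R mat 1"

definition riemannian_volume :: "(real^'n::finite \<Rightarrow> real^'n^'n) \<Rightarrow> (real^'n) measure" where
  "riemannian_volume g = density lborel (\<lambda>x. ennreal (sqrt (det (g x))))"

abbreviation sphere_volume :: "(real^'n::finite) measure" where
  "sphere_volume \<equiv> riemannian_volume round_metric"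

text \<open>The sign is chosen so that the operator is nonnegative.\<close>

definition laplace_beltrami :: "(real^'n \<Rightarrow> real^'n^'n) \<Rightarrow> 'n::finite diffop" where
  "laplace_beltrami g = (\<lambda>u\<in>smooth_functions. \<lambda>x.
     - (1 / sqrt (det (g x))) *
       (\<Sum>i\<in>UNIV. pd i (\<lambda>y. sqrt (det (g y)) * (\<Sum>j\<in>UNIV. matrix_inv (g y) $ i $ j * pd j u y)) x))"

abbreviation sphere_laplacian :: "'n::finite diffop" where
  "sphere_laplacian \<equiv> laplace_beltrami round_metric"

definition L_op :: "real \<Rightarrow> 'n::finite diffop" where
  "L_op \<omega> = (\<lambda>u\<in>smooth_functions. \<lambda>x.
     sphere_laplacian u x + \<omega>\<^sup>2 * (norm x)\<^sup>2 * u x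
     - real CARD('n) * (sqrt ((real CARD('n) - 2)\<^sup>2 + 16 * \<omega>\<^sup>2) - (real CARD('n) - 2)) / 8 * u x)"

text \<open>
  Polar coordinates, at points \<open>x \<noteq> 0\<close>: the radial derivatives are taken along the ray through
  \<open>x\<close> (here \<open>sgn x\<close> is the unit vector \<open>x/|x|\<close>), and the Laplacian of the unit sphere, of the
  function that \<open>u\<close> induces there through the sphere of radius \<open>|x|\<close>, is the Euclidean Laplacian
  of the extension that is homogeneous of degree 0. For \<open>d = 1\<close> it vanishes, and for
  \<open>d = 2\<close> it is the second derivative in the angle.
\<close>

definition radial_deriv :: "nat \<Rightarrow> 'n::finite diffop" where
  "radial_deriv k u x = (deriv ^^ k) (\<lambda>r. u (r *\<^sub>R sgn x)) (norm x)"

definition angular_laplacian :: "'n::finite diffop" where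
  "angular_laplacian u x = (\<Sum>i\<in>UNIV. pd i (pd i (\<lambda>y. u (norm x *\<^sub>R sgn y))) (sgn x))"

definition L_polar :: "real \<Rightarrow> 'n::finite diffop" where
  "L_polar \<omega> u x = (let d = real CARD('n); r = norm x in
     - (1/4) * (1 + r\<^sup>2)\<^sup>2 *
       (radial_deriv 2 u x
        + 1 / r * (1 + (d - 2) * ((1 - r\<^sup>2) / (1 + r\<^sup>2))) * radial_deriv 1 u x
        + 1 / r\<^sup>2 * angular_laplacian u x)
     + \<omega>\<^sup>2 * r\<^sup>2 * u x
     - d * (sqrt ((d - 2)\<^sup>2 + 16 * \<omega>\<^sup>2) - (d - 2)) / 8 * u x)"


section \<open>Self-adjoint operators in the real Hilbert space of square integrable functions\<close>

text \<open>
  Elements of the Hilbert space are represented by functions, equality being equality almost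
  everywhere, and an unbounded operator by its graph. A graph that equals its adjoint is a
  linear relation saturated under almost everywhere equality, and it is the graph of an
  operator (single-valued almost everywhere) because the domain is dense.
\<close>

definition L2 :: "'a measure \<Rightarrow> ('a \<Rightarrow> real) set" where
  "L2 M = {u \<in> borel_measurable M. integrable M (\<lambda>x. (u x)\<^sup>2)}"

type_synonym 'a op_graph = "(('a \<Rightarrow> real) \<times> ('a \<Rightarrow> real)) set"

definition adjoint_graph :: "'a measure \<Rightarrow> 'a op_graph \<Rightarrow> 'a op_graph" where
  "adjoint_graph M G = {(w, z). w \<in> L2 M \<and> z \<in> L2 M \<and>
     (\<forall>(u, v) \<in> G. (\<integral>x. v x * w x \<partial>M) = (\<integral>x. u x * z x \<partial>M))}"

definition dense_domain :: "'a measure \<Rightarrow> 'a op_graph \<Rightarrow> bool" where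
  "dense_domain M G \<longleftrightarrow>
     (\<forall>w \<in> L2 M. \<forall>e>0. \<exists>u \<in> Domain G. u \<in> L2 M \<and> (\<integral>x. (w x - u x)\<^sup>2 \<partial>M) < e)"

definition self_adjoint :: "'a measure \<Rightarrow> 'a op_graph \<Rightarrow> bool" where
  "self_adjoint M G \<longleftrightarrow> dense_domain M G \<and> adjoint_graph M G = G"

definition eigenfunction :: "'a measure \<Rightarrow> 'a op_graph \<Rightarrow> real \<Rightarrow> ('a \<Rightarrow> real) \<Rightarrow> bool" where
  "eigenfunction M G l u \<longleftrightarrow> (u, \<lambda>x. l * u x) \<in> G \<and> \<not> (AE x in M. u x = 0)"

text \<open>
  \<open>f\<close> is the ground state, with energy \<open>E\<close>: \<open>E\<close> is the smallest eigenvalue, and \<open>f\<close> is its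
  eigenfunction, unique up to a scalar.
\<close>

definition ground_state :: "'a measure \<Rightarrow> 'a op_graph \<Rightarrow> ('a \<Rightarrow> real) \<Rightarrow> real \<Rightarrow> bool" where
  "ground_state M G f E \<longleftrightarrow>
     eigenfunction M G E f \<and>
     (\<forall>l u. eigenfunction M G l u \<longrightarrow> E \<le> l) \<and>
     (\<forall>u. eigenfunction M G E u \<longrightarrow> (\<exists>s. AE x in M. u x = s * f x))"

definition SO_invariant :: "(real^'n::finite) op_graph \<Rightarrow> bool" where
  "SO_invariant G \<longleftrightarrow>
     (\<forall>R. rotation_matrix R \<longrightarrow> (\<forall>(u, v) \<in> G. (\<lambda>x. u (R *v x), \<lambda>x. v (R *v x)) \<in> G))"

text \<open>
  A differential operator is self-adjoint through a self-adjoint operator \<open>G\<close> in the Hilbert space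
  that extends its restriction to the test functions; being contained in the adjoint of that
  restriction, \<open>G\<close> acts as \<open>P\<close> (in the sense of distributions) on all of its domain. Such a
  \<open>G\<close> need not be unique, since the operators may be singular at the omitted point.
  Invariance of \<open>G\<close> implies that \<open>P\<close> commutes with rotations.
\<close>

definition realization :: "'n::finite diffop \<Rightarrow> (real^'n) op_graph \<Rightarrow> bool" where
  "realization P G \<longleftrightarrow> self_adjoint sphere_volume G \<and> (\<forall>u \<in> test_functions. (u, P u) \<in> G)"

definition invariant_operator_with_ground_state ::
  "(real^'n \<Rightarrow> real) \<Rightarrow> 'n::finite diffop \<Rightarrow> bool" where
  "invariant_operator_with_ground_state f P \<longleftrightarrow>
     same_second_order_part P sphere_laplacian \<and>
     (\<exists>G. realization P G \<and> SO_invariant G \<and> ground_state sphere_volume G f 0)"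

text \<open>
  The function \<open>(1 + r^2)^(-k)\<close> is annihilated by
  \<open>sphere_laplacian + k (k + (d-2)/2) r^2 - d k / 2\<close>. Hence the potential \<open>\<omega>^2 r^2\<close> belongs
  to the positive root \<open>k\<close> of \<open>k (k + (d-2)/2) = \<omega>^2\<close>, which is \<open>\<omega>\<close> only for \<open>d = 2\<close>.
\<close>

definition power_state :: "real \<Rightarrow> real^'n::finite \<Rightarrow> real" where
  "power_state k x = (1 + (norm x)\<^sup>2) powr (- k)"

definition ground_exponent :: "nat \<Rightarrow> real \<Rightarrow> real" where
  "ground_exponent d \<omega> = (sqrt ((real d - 2)\<^sup>2 + 16 * \<omega>\<^sup>2) - (real d - 2)) / 4"

end

theory Submission
  imports Defs
begin

text \<open>
  Write \<open>f\<close> for the prescribed ground state, \<open>\<Delta>\<close> for the Laplacian of the sphere. An operator with the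
  second order part of \<open>\<Delta>\<close> is \<open>\<Delta> + b \<cdot> \<nabla> + c\<close>. Its symmetry, tested on \<open>\<phi>\<close> and \<open>x\<^sub>i \<phi>\<close>, forces
  \<open>\<integral> b\<^sub>i \<phi>\<^sup>2 = 0\<close> for every test function \<open>\<phi>\<close>, hence \<open>b = 0\<close>; pairing with \<open>f\<close>, which has eigenvalue 0,
  then gives \<open>c = - \<Delta> f / f\<close>.

  Conversely \<open>\<Delta> - \<Delta> f / f\<close> is formally \<open>T\<^sup>*T\<close> with \<open>T u = \<nabla> (u / f)\<close>, from a weighted space to another.
  With the weak gradient as \<open>T\<close>, von Neumann's theorem makes \<open>T\<^sup>*T\<close> self-adjoint; it is nonnegative, and
  its kernel is that of \<open>T\<close>, the multiples of \<open>f\<close>. Taking the largest domain for \<open>T\<close> matters: for \<open>d = 1\<close>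
  and small exponents the closure from the test functions would not have \<open>f\<close> in its domain.
\<close>

subsection \<open>Smooth functions\<close>

text \<open>The potential may blow up at the omitted point, and then the test functions need not
  determine a self-adjoint operator; a realization has to be built by hand. The factorization
  replaces spectral theory and elliptic regularity: sign and kernel are read off from the identity
  between the energy of \<open>u\<close> and the squared norm of \<open>T u\<close>. The weight of
  the target space of \<open>T\<close> is \<open>a f^2\<close> because, for u = f h, the quadratic
  form of the operator becomes the integral of a f^2 |grad h|^2. The operator \<open>T\<close> is
  given by duality: the weak gradient identity says that the pair (u, T u) is orthogonal to explicit
  compactly supported families, the probes. So the graph of \<open>T\<close> is an orthogonal
  complement and closed from the outset, and von Neumann's theorem comes down to one projection onto
  it. In the uniqueness part, multiplication by a coordinate isolates one first order coefficient
  without differentiating it. The resulting identity concerns squares of test functions only, which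
  is enough since the bump functions used are themselves squares.\<close>

lemma pd_eqI: "(u has_derivative D) (at x) \<Longrightarrow> pd i u x = D (axis i 1)"
  unfolding pd_def by (metis frechet_derivative_at)

text \<open>\<open>foldr\<close> applies the last letter of the word first, so an index appended at
  the end, not at the front, is the one that differentiates \<open>u\<close> itself.\<close>

lemma smooth_iff:
  "u \<in> smooth_functions \<longleftrightarrow> u differentiable_on UNIV \<and> (\<forall>i. pd i u \<in> smooth_functions)"
proof
  assume u: "u \<in> smooth_functions"
  have "foldr pd is (pd i u) differentiable_on UNIV" for i "is"
    using u[unfolded smooth_functions_def mem_Collect_eq, rule_format, of "is @ [i]"] by simp
  moreover have "u differentiable_on UNIV"
    using u unfolding smooth_functions_def mem_Collect_eq by (metis foldr.simps(1) id_apply)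
  ultimately show "u differentiable_on UNIV \<and> (\<forall>i. pd i u \<in> smooth_functions)"
    by (auto simp: smooth_functions_def)
next
  assume u: "u differentiable_on UNIV \<and> (\<forall>i. pd i u \<in> smooth_functions)"
  have "foldr pd is u differentiable_on UNIV" for "is"
  proof (cases "is" rule: rev_cases)
    case (snoc js i)
    then show ?thesis using u by (auto simp: smooth_functions_def)
  qed (use u in auto)
  then show "u \<in> smooth_functions" by (simp add: smooth_functions_def)
qed

lemma smooth_pd [simp, intro]: "u \<in> smooth_functions \<Longrightarrow> pd i u \<in> smooth_functions"
  using smooth_iff by blast

lemma smooth_has_derivative:
  assumes "u \<in> smooth_functions"
  shows "(u has_derivative (\<lambda>h. \<Sum>i\<in>UNIV. h $ i * pd i u x)) (at x)"
proof -
  have D: "(u has_derivative frechet_derivative u (at x)) (at x)"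
    using assms smooth_iff[of u] by (simp add: differentiable_on_def frechet_derivative_works)
  interpret linear "frechet_derivative u (at x)"
    using D has_derivative_linear by blast
  have "frechet_derivative u (at x) h = (\<Sum>i\<in>UNIV. h $ i * pd i u x)" for h
  proof -
    have "h = (\<Sum>i\<in>UNIV. (h $ i) *\<^sub>R axis i 1)"
      using basis_expansion[of h] by (simp add: scalar_mult_eq_scaleR)
    then have "frechet_derivative u (at x) h = frechet_derivative u (at x) (\<Sum>i\<in>UNIV. (h $ i) *\<^sub>R axis i 1)"
      by (rule arg_cong)
    then show ?thesis by (simp add: sum scale pd_def)
  qed
  then have "frechet_derivative u (at x) = (\<lambda>h. \<Sum>i\<in>UNIV. h $ i * pd i u x)"
    by (rule ext)
  from D[unfolded this] show ?thesis .
qed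

lemma smooth_continuous: "u \<in> smooth_functions \<Longrightarrow> continuous_on S u"
  by (meson continuous_at_imp_continuous_on has_derivative_continuous smooth_has_derivative)

lemma smooth_measurable: "u \<in> smooth_functions \<Longrightarrow> u \<in> borel_measurable borel"
  using smooth_continuous borel_measurable_continuous_onI by blast

text \<open>Only one derivative is assumed, because the coinduction below uses the rule before
  smoothness of the summands is known.\<close>

lemma pd_add_differentiable:
  assumes "u differentiable_on UNIV" "v differentiable_on UNIV"
  shows "pd i (\<lambda>x. u x + v x) = (\<lambda>x. pd i u x + pd i v x)"
proof
  fix x
  have "u differentiable at x" "v differentiable at x"
    using assms by (auto simp: differentiable_on_def)
  then show "pd i (\<lambda>x. u x + v x) x = pd i u x + pd i v x"
    using pd_eqI[OF has_derivative_add[of u "frechet_derivative u (at x)" "at x" v "frechet_derivative v (at x)"]]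
    by (simp add: pd_def frechet_derivative_works)
qed

text \<open>Coinduction up to finite sums: the partial derivatives given by the product and chain rules
  are sums of members of the class.\<close>

inductive_set add_closure :: "('a \<Rightarrow> real) set \<Rightarrow> ('a \<Rightarrow> real) set" for B where
  base: "b \<in> B \<Longrightarrow> b \<in> add_closure B"
| add: "b \<in> add_closure B \<Longrightarrow> c \<in> add_closure B \<Longrightarrow> (\<lambda>x. b x + c x) \<in> add_closure B"

lemma smooth_coinduct_add:
  assumes u: "u \<in> add_closure B"
    and D: "\<And>b i. b \<in> B \<Longrightarrow> b differentiable_on UNIV \<and> pd i b \<in> add_closure B"
  shows "u \<in> smooth_functions"
proof -
  have step: "b differentiable_on UNIV \<and> pd i b \<in> add_closure B" if "b \<in> add_closure B" for b i
    using that
  proof induction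
    case (base b)
    show ?case by (rule D[OF base])
  next
    case (add b c)
    have "(\<lambda>x. b x + c x) differentiable_on UNIV"
      using add.IH by (intro differentiable_on_add) (rule conjunct1, assumption)+
    moreover have "pd i (\<lambda>x. b x + c x) \<in> add_closure B"
      using add.IH add_closure.add[of "pd i b" B "pd i c"] pd_add_differentiable[of b c i] by presburger
    ultimately show ?case by (rule conjI)
  qed
  have "foldr pd is u \<in> add_closure B" for "is"
  proof (induction "is")
    case Nil
    show ?case using u by simp
  next
    case (Cons i "is")
    show ?case using conjunct2[OF step[OF Cons]] by simp
  qed
  then have "foldr pd is u differentiable_on UNIV" for "is"
    by (rule conjunct1[OF step])
  then show ?thesis unfolding smooth_functions_def by blast
qed

lemmas smooth_coinduct = smooth_coinduct_add[OF add_closure.base]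

lemma pd_add:
  "u \<in> smooth_functions \<Longrightarrow> v \<in> smooth_functions \<Longrightarrow> pd i (\<lambda>x. u x + v x) = (\<lambda>x. pd i u x + pd i v x)"
  using smooth_iff pd_add_differentiable by blast

lemma pd_const [simp]: "pd i (\<lambda>x. c) = (\<lambda>x. 0)"
  by (simp add: pd_def frechet_derivative_const fun_eq_iff)

lemma smooth_const [simp, intro]: "(\<lambda>x. c) \<in> smooth_functions"
proof -
  have "foldr pd is (\<lambda>x. c) \<in> range (\<lambda>c x. c)" for "is" :: "'a list"
    by (induction "is") auto
  then have "foldr pd is (\<lambda>x. c) differentiable_on UNIV" for "is" :: "'a list"
    using differentiable_on_const by (metis rangeE)
  then show ?thesis unfolding smooth_functions_def by simp
qed

lemma pd_nth: "pd i (\<lambda>x. x $ j) = (\<lambda>x. if i = j then 1 else 0)"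
proof
  fix x :: "real^'a"
  have "((\<lambda>x. x $ j) has_derivative (\<lambda>h. h $ j)) (at x)"
    by (rule bounded_linear.has_derivative[OF bounded_linear_vec_nth has_derivative_ident])
  from pd_eqI[OF this, of i] show "pd i (\<lambda>x. x $ j) x = (if i = j then 1 else 0)"
    by (auto simp: axis_def)
qed

lemma smooth_nth [simp, intro]: "(\<lambda>x. x $ j) \<in> smooth_functions"
  by (subst smooth_iff)
    (simp add: pd_nth differentiable_on_def bounded_linear_imp_differentiable bounded_linear_vec_nth)

lemma has_derivative_times:
  fixes u v :: "real^'n::finite \<Rightarrow> real"
  assumes "u \<in> smooth_functions" "v \<in> smooth_functions"
  shows "((\<lambda>x. u x * v x) has_derivative
    (\<lambda>h. u x * (\<Sum>i\<in>UNIV. h $ i * pd i v x) + (\<Sum>i\<in>UNIV. h $ i * pd i u x) * v x)) (at x)"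
  by (rule has_derivative_mult[OF smooth_has_derivative[OF assms(1)] smooth_has_derivative[OF assms(2)]])

lemma axis_sum [simp]: "(\<Sum>j\<in>UNIV. axis i (1::real) $ j * g j) = (g i :: real)"
  by (simp add: axis_def if_distrib[of "\<lambda>c. c * _"] cong: if_cong)

lemma pd_mult:
  "u \<in> smooth_functions \<Longrightarrow> v \<in> smooth_functions \<Longrightarrow>
   pd i (\<lambda>x. u x * v x) = (\<lambda>x. pd i u x * v x + u x * pd i v x)"
  by (rule ext, subst pd_eqI[OF has_derivative_times]) auto

lemma smooth_mult [simp, intro]:
  assumes "u \<in> smooth_functions" "v \<in> smooth_functions"
  shows "(\<lambda>x. u x * v x) \<in> smooth_functions"
proof -
  define B :: "(real^'a \<Rightarrow> real) set"
    where "B = {(\<lambda>x. u x * v x) | u v. u \<in> smooth_functions \<and> v \<in> smooth_functions}"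
  have B: "(\<lambda>x. u x * v x) \<in> B" if "u \<in> smooth_functions" "v \<in> smooth_functions" for u v
    using that unfolding B_def by blast
  show ?thesis
  proof (rule smooth_coinduct)
    show "(\<lambda>x. u x * v x) \<in> B" by (rule B[OF assms])
    fix b i assume "b \<in> B"
    then obtain u v where b: "b = (\<lambda>x. u x * v x)" and uv: "u \<in> smooth_functions" "v \<in> smooth_functions"
      unfolding B_def by blast
    have "b differentiable_on UNIV"
      using has_derivative_times[OF uv] b by (auto simp: differentiable_on_def differentiable_def)
    moreover have "pd i b \<in> add_closure B"
      unfolding b pd_mult[OF uv]
      by (rule add_closure.add[OF add_closure.base[OF B[OF smooth_pd[OF uv(1)] uv(2)]]
            add_closure.base[OF B[OF uv(1) smooth_pd[OF uv(2)]]]])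
    ultimately show "b differentiable_on UNIV \<and> pd i b \<in> add_closure B" ..
  qed
qed

lemma smooth_add [simp, intro]:
  assumes "u \<in> smooth_functions" "v \<in> smooth_functions"
  shows "(\<lambda>x. u x + v x) \<in> smooth_functions"
proof (rule smooth_coinduct_add)
  show "(\<lambda>x. u x + v x) \<in> add_closure smooth_functions"
    by (rule add_closure.add; rule add_closure.base; fact)
  fix b :: "real^'a \<Rightarrow> real" and i
  assume b: "b \<in> smooth_functions"
  then show "b differentiable_on UNIV \<and> pd i b \<in> add_closure smooth_functions"
    using smooth_iff add_closure.base by metis
qed

lemma smooth_cmult [simp, intro]: "u \<in> smooth_functions \<Longrightarrow> (\<lambda>x. c * u x) \<in> smooth_functions"
  by simp

lemma pd_cmult: "u \<in> smooth_functions \<Longrightarrow> pd i (\<lambda>x. c * u x) = (\<lambda>x. c * pd i u x)"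
  by (simp add: pd_mult)

lemma smooth_minus [simp, intro]: "u \<in> smooth_functions \<Longrightarrow> (\<lambda>x. - u x) \<in> smooth_functions"
  using smooth_cmult[of u "-1"] by simp

lemma smooth_diff [simp, intro]:
  "u \<in> smooth_functions \<Longrightarrow> v \<in> smooth_functions \<Longrightarrow> (\<lambda>x. u x - v x) \<in> smooth_functions"
  using smooth_add[of u "\<lambda>x. - v x"] by simp

lemma pd_diff:
  assumes "u \<in> smooth_functions" "v \<in> smooth_functions"
  shows "pd i (\<lambda>x. u x - v x) = (\<lambda>x. pd i u x - pd i v x)"
  using assms pd_add[of u "\<lambda>x. -1 * v x"] pd_cmult[of v i "-1"] by simp

lemma smooth_sum [intro]:
  "(\<And>j. j \<in> J \<Longrightarrow> u j \<in> smooth_functions) \<Longrightarrow> (\<lambda>x. \<Sum>j\<in>J. u j x) \<in> smooth_functions"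
  by (induction J rule: infinite_finite_induct) auto

lemma smooth_prod [intro]:
  "(\<And>j. j \<in> J \<Longrightarrow> u j \<in> smooth_functions) \<Longrightarrow> (\<lambda>x. \<Prod>j\<in>J. u j x) \<in> smooth_functions"
  by (induction J rule: infinite_finite_induct) auto

lemma has_derivative_compose_smooth:
  assumes "V \<in> smooth_functions" "(g has_real_derivative g') (at (V x))"
  shows "((\<lambda>x. g (V x)) has_derivative (\<lambda>h. (\<Sum>i\<in>UNIV. h $ i * pd i V x) * g')) (at x)"
  using has_derivative_compose[OF smooth_has_derivative[OF assms(1)], of g "(*) g'"] assms(2)
  by (simp add: has_field_derivative_def mult.commute)

lemma pd_compose:
  assumes "V \<in> smooth_functions" "(g has_real_derivative g') (at (V x))"
  shows "pd i (\<lambda>x. g (V x)) x = g' * pd i V x"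
  using pd_eqI[OF has_derivative_compose_smooth[OF assms]] by simp

text \<open>The class \<open>C\<close> of outer functions has to be closed under differentiation
  only at values of \<open>V\<close>. This admits functions such as powers on positive arguments,
  whose behaviour elsewhere is irrelevant.\<close>

lemma smooth_compose:
  assumes V: "V \<in> smooth_functions" and g: "g \<in> C"
    and C: "\<And>g. g \<in> C \<Longrightarrow> \<exists>g'\<in>C. \<forall>x. (g has_real_derivative g' (V x)) (at (V x))"
  shows "(\<lambda>x. g (V x)) \<in> smooth_functions"
proof -
  \<comment> \<open>The smooth factor \<open>u\<close> absorbs the derivatives of \<open>V\<close>
    that the chain rule produces.\<close>
  define B where "B = {(\<lambda>x. u x * g (V x)) | u g. u \<in> smooth_functions \<and> g \<in> C}"
  have B: "(\<lambda>x. u x * g (V x)) \<in> B" if "u \<in> smooth_functions" "g \<in> C" for u g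
    using that unfolding B_def by blast
  have "(\<lambda>x. 1 * g (V x)) \<in> smooth_functions"
  proof (rule smooth_coinduct)
    show "(\<lambda>x. 1 * g (V x)) \<in> B" by (rule B) (use g in auto)
    fix b i assume "b \<in> B"
    then obtain u g where b: "b = (\<lambda>x. u x * g (V x))" and u: "u \<in> smooth_functions" and g: "g \<in> C"
      unfolding B_def by blast
    obtain g' where g': "g' \<in> C" "\<And>x. (g has_real_derivative g' (V x)) (at (V x))"
      using C[OF g] by blast
    have D: "(b has_derivative (\<lambda>h. u x * ((\<Sum>i\<in>UNIV. h $ i * pd i V x) * g' (V x))
        + (\<Sum>i\<in>UNIV. h $ i * pd i u x) * g (V x))) (at x)" for x
      unfolding b
      by (rule has_derivative_mult[OF smooth_has_derivative[OF u] has_derivative_compose_smooth[OF V g'(2)]])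
    have "b differentiable_on UNIV"
      using D by (auto simp: differentiable_on_def differentiable_def)
    moreover have eq: "pd i b = (\<lambda>x. pd i u x * g (V x) + u x * pd i V x * g' (V x))"
      by (rule ext, subst pd_eqI[OF D]) simp
    have "pd i b \<in> add_closure B"
      unfolding eq
      by (rule add_closure.add[OF add_closure.base[OF B[OF smooth_pd[OF u] g]]
            add_closure.base[OF B[OF smooth_mult[OF u smooth_pd[OF V]] g'(1)]]])
    ultimately show "b differentiable_on UNIV \<and> pd i b \<in> add_closure B" ..
  qed
  then show ?thesis by simp
qed

lemma smooth_powr:
  assumes "V \<in> smooth_functions" "\<And>x. V x > 0"
  shows "(\<lambda>x. V x powr a) \<in> smooth_functions"
proof (rule smooth_compose[OF assms(1), where C = "{(\<lambda>t. c * t powr b) | c b. True}"])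
  show "(\<lambda>t. t powr a) \<in> {(\<lambda>t. c * t powr b) | c b. True}" by (force intro: exI[of _ 1])
  fix g :: "real \<Rightarrow> real" assume "g \<in> {(\<lambda>t. c * t powr b) | c b. True}"
  then obtain c b where g: "g = (\<lambda>t. c * t powr b)" by auto
  show "\<exists>g'\<in>{\<lambda>t. c * t powr b |c b. True}. \<forall>x. (g has_real_derivative g' (V x)) (at (V x))"
    by (rule bexI[of _ "\<lambda>t. (c * b) * t powr (b - 1)"])
      (use assms(2) g in \<open>auto intro!: derivative_eq_intros\<close>)
qed

lemma smooth_inverse:
  assumes "V \<in> smooth_functions" "\<And>x. V x > 0"
  shows "(\<lambda>x. 1 / V x) \<in> smooth_functions"
proof -
  have "(\<lambda>x. V x powr (-1)) = (\<lambda>x. 1 / V x)"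
    using assms(2) by (simp add: powr_minus fun_eq_iff less_imp_le inverse_eq_divide)
  then show ?thesis using smooth_powr[OF assms, of "-1"] by simp
qed

lemma smooth_norm_sq [simp, intro]: "(\<lambda>x. (norm x)\<^sup>2) \<in> smooth_functions"
proof -
  have "(\<lambda>x::real^'a. (norm x)\<^sup>2) = (\<lambda>x. \<Sum>i\<in>UNIV. x $ i * x $ i)"
    by (simp add: power2_norm_eq_inner inner_vec_def)
  then show ?thesis by (auto intro!: smooth_sum)
qed

lemma pd_norm_sq: "pd i (\<lambda>x. (norm x)\<^sup>2) = (\<lambda>x. 2 * x $ i)"
proof
  fix x :: "real^'a"
  have "((\<lambda>x. (norm x)\<^sup>2) has_derivative (\<lambda>h. 2 * inner x h)) (at x)"
    unfolding power2_norm_eq_inner by (auto intro!: derivative_eq_intros simp: inner_commute)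
  from pd_eqI[OF this] show "pd i (\<lambda>x. (norm x)\<^sup>2) x = 2 * x $ i"
    by (simp add: inner_axis)
qed

lemma add_closure_sum:
  assumes "(\<lambda>x. 0) \<in> B" "\<And>j. f j \<in> B"
  shows "(\<lambda>x. \<Sum>j\<in>J. f j x) \<in> add_closure B"
proof (induction J rule: infinite_finite_induct)
  case (insert j J)
  then show ?case using add_closure.add[OF add_closure.base[OF assms(2)] insert.IH] by simp
qed (simp_all add: assms add_closure.base)

lemma has_derivative_affine:
  fixes A :: "real^'n::finite^'n"
  assumes "u \<in> smooth_functions"
  shows "((\<lambda>x. u (A *v x + c)) has_derivative (\<lambda>h. \<Sum>j\<in>UNIV. (A *v h) $ j * pd j u (A *v x + c))) (at x)"
proof -
  have "((\<lambda>x. A *v x + c) has_derivative (\<lambda>h. A *v h)) (at x)"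
    by (intro has_derivative_add_const bounded_linear.has_derivative[OF _ has_derivative_ident]
        matrix_vector_mul_bounded_linear)
  from has_derivative_compose[OF this smooth_has_derivative[OF assms]] show ?thesis by simp
qed

lemma pd_affine:
  fixes A :: "real^'n::finite^'n"
  assumes "u \<in> smooth_functions"
  shows "pd i (\<lambda>x. u (A *v x + c)) = (\<lambda>x. \<Sum>j\<in>UNIV. A $ j $ i * pd j u (A *v x + c))"
proof
  fix x
  have "(A *v axis i 1) $ j = A $ j $ i" for j
    by (simp add: matrix_vector_mul_component inner_axis)
  then show "pd i (\<lambda>x. u (A *v x + c)) x = (\<Sum>j\<in>UNIV. A $ j $ i * pd j u (A *v x + c))"
    by (subst pd_eqI[OF has_derivative_affine[OF assms]]) simp
qed

lemma smooth_affine: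
  fixes A :: "real^'n::finite^'n"
  assumes "u \<in> smooth_functions"
  shows "(\<lambda>x. u (A *v x + c)) \<in> smooth_functions"
proof -
  define B where "B = {(\<lambda>x. a * u (A *v x + c)) | a u. u \<in> smooth_functions}"
  have B: "(\<lambda>x. a * u (A *v x + c)) \<in> B" if "u \<in> smooth_functions" for a u
    using that unfolding B_def by blast
  have B0: "(\<lambda>x. 0) \<in> B" using B[OF smooth_const[of 0]] by simp
  have "(\<lambda>x. 1 * u (A *v x + c)) \<in> smooth_functions"
  proof (rule smooth_coinduct)
    show "(\<lambda>x. 1 * u (A *v x + c)) \<in> B" by (rule B[OF assms])
    fix b i assume "b \<in> B"
    then obtain a u where b: "b = (\<lambda>x. a * u (A *v x + c))" and u: "u \<in> smooth_functions"
      unfolding B_def by blast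
    have D: "(b has_derivative (\<lambda>h. a * (\<Sum>j\<in>UNIV. (A *v h) $ j * pd j u (A *v x + c)))) (at x)" for x
      unfolding b by (rule has_derivative_mult_right[OF has_derivative_affine[OF u]])
    have "b differentiable_on UNIV"
      using D by (auto simp: differentiable_on_def differentiable_def)
    moreover have eq: "pd i b = (\<lambda>x. \<Sum>j\<in>UNIV. (a * A $ j $ i) * pd j u (A *v x + c))"
      by (rule ext, subst pd_eqI[OF D])
        (simp add: matrix_vector_mul_component inner_axis sum_distrib_left mult.assoc)
    have "pd i b \<in> add_closure B"
      unfolding eq by (rule add_closure_sum[OF B0]) (rule B[OF smooth_pd[OF u]])
    ultimately show "b differentiable_on UNIV \<and> pd i b \<in> add_closure B" ..
  qed
  then show ?thesis by simp
qed

lemma smooth_translate: "u \<in> smooth_functions \<Longrightarrow> (\<lambda>x. u (x + c)) \<in> smooth_functions"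
  using smooth_affine[of u "mat 1" c] by simp

lemma pd_translate:
  fixes u :: "real^'n::finite \<Rightarrow> real"
  assumes "u \<in> smooth_functions"
  shows "pd i (\<lambda>x. u (x + c)) = (\<lambda>x. pd i u (x + c))"
proof -
  have "pd i (\<lambda>x. u (x + c)) = (\<lambda>x. \<Sum>j\<in>UNIV. mat 1 $ j $ i * pd j u (x + c))"
    using pd_affine[OF assms, of i "mat 1" c] by simp
  also have "\<dots> = (\<lambda>x. pd i u (x + c))"
    by (simp add: mat_def if_distrib[of "\<lambda>c. c * _"] cong: if_cong)
  finally show ?thesis .
qed

subsection \<open>Test functions\<close>

lemma test_smooth: "u \<in> test_functions \<Longrightarrow> u \<in> smooth_functions"
  by (simp add: test_functions_def)

lemma test_functions_iff:
  "u \<in> test_functions \<longleftrightarrow> u \<in> smooth_functions \<and> (\<exists>r. \<forall>x. norm x > r \<longrightarrow> u x = 0)"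
proof -
  have "compact (closure {x. u x \<noteq> 0}) \<longleftrightarrow> (\<exists>r. \<forall>x. norm x > r \<longrightarrow> u x = 0)"
    unfolding compact_closure bounded_iff by (auto simp: not_le[symmetric])
  then show ?thesis by (simp add: test_functions_def)
qed

lemma test_vanish:
  assumes "u \<in> test_functions"
  obtains r where "r > 0" "\<And>x. norm x > r \<Longrightarrow> u x = 0"
proof -
  obtain r where "\<forall>x. norm x > r \<longrightarrow> u x = 0" using assms test_functions_iff by blast
  then have "\<And>x. norm x > max r 1 \<Longrightarrow> u x = 0" by simp
  then show ?thesis using that[of "max r 1"] by simp
qed

lemma test_mult_smooth [intro]:
  "u \<in> test_functions \<Longrightarrow> v \<in> smooth_functions \<Longrightarrow> (\<lambda>x. u x * v x) \<in> test_functions"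
  "u \<in> test_functions \<Longrightarrow> v \<in> smooth_functions \<Longrightarrow> (\<lambda>x. v x * u x) \<in> test_functions"
  unfolding test_functions_iff by auto

lemma test_add [intro]:
  assumes "u \<in> test_functions" "v \<in> test_functions"
  shows "(\<lambda>x. u x + v x) \<in> test_functions"
proof -
  obtain r s where "\<And>x. norm x > r \<Longrightarrow> u x = 0" "\<And>x. norm x > s \<Longrightarrow> v x = 0"
    using assms test_vanish by metis
  then have "\<forall>x. norm x > max r s \<longrightarrow> u x + v x = 0" by simp
  then show ?thesis using assms unfolding test_functions_iff by blast
qed

lemma test_pd [intro]:
  assumes "u \<in> test_functions" shows "pd i u \<in> test_functions"
proof -
  obtain r where r: "\<And>x. norm x > r \<Longrightarrow> u x = 0" using assms test_vanish by metis
  have "pd i u x = 0" if x: "norm x > r" for x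
  proof -
    have "open {x. r < norm (x::real^'a)}" by (intro open_Collect_less continuous_intros)
    then have "(u has_derivative (\<lambda>h. 0)) (at x)"
      by (rule has_derivative_transform_within_open[OF has_derivative_const[of 0]]) (use x r in auto)
    from pd_eqI[OF this] show ?thesis .
  qed
  then show ?thesis using assms unfolding test_functions_iff by blast
qed

lemma test_sum [intro]:
  "(\<And>j. j \<in> J \<Longrightarrow> u j \<in> test_functions) \<Longrightarrow> (\<lambda>x. \<Sum>j\<in>J. u j x) \<in> test_functions"
  by (induction J rule: infinite_finite_induct) (auto simp: test_functions_iff[of "\<lambda>x. 0"])

lemma test_translate:
  assumes "u \<in> test_functions" shows "(\<lambda>x. u (x + c)) \<in> test_functions"
proof -
  obtain r where r: "\<And>x. norm x > r \<Longrightarrow> u x = 0" using assms test_vanish by metis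
  have "\<forall>x. norm x > r + norm c \<longrightarrow> u (x + c) = 0"
  proof (intro allI impI r)
    fix x :: "real^'a" assume "norm x > r + norm c"
    then show "norm (x + c) > r" using norm_diff_ineq[of x c] by linarith
  qed
  then show ?thesis using assms smooth_translate unfolding test_functions_iff by blast
qed

lemma norm_orthogonal_matrix:
  "orthogonal_matrix R \<Longrightarrow> norm (R *v x) = norm (x :: real^'n::finite)"
  using orthogonal_transformation_matrix[of "(*v) R"] orthogonal_transformation_norm by auto

lemma test_orthogonal:
  fixes R :: "real^'n::finite^'n"
  assumes "u \<in> test_functions" "orthogonal_matrix R"
  shows "(\<lambda>x. u (R *v x)) \<in> test_functions"
proof -
  obtain r where "\<And>x. norm x > r \<Longrightarrow> u x = 0" using assms(1) test_vanish by metis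
  then have "\<forall>x. norm x > r \<longrightarrow> u (R *v x) = 0" by (simp add: norm_orthogonal_matrix[OF assms(2)])
  then show ?thesis using assms smooth_affine[of u R 0] unfolding test_functions_iff by auto
qed

lemma smooth_bounded_on_cball:
  assumes "u \<in> smooth_functions"
  obtains b where "b > 0" "\<And>x. norm x \<le> r \<Longrightarrow> \<bar>u x\<bar> \<le> b"
proof -
  have "compact (u ` cball 0 r)"
    by (rule compact_continuous_image[OF smooth_continuous[OF assms]]) auto
  then obtain b where "b > 0" "\<forall>y\<in>u ` cball 0 r. norm y \<le> b"
    using compact_imp_bounded bounded_pos by blast
  then show ?thesis using that by (auto simp: dist_norm)
qed

lemma test_bounded:
  assumes "u \<in> test_functions"
  obtains b where "b > 0" "\<And>x. \<bar>u x\<bar> \<le> b"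
proof -
  obtain r where r: "\<And>x. norm x > r \<Longrightarrow> u x = 0" using assms test_vanish by metis
  obtain b where "b > 0" "\<And>x. norm x \<le> r \<Longrightarrow> \<bar>u x\<bar> \<le> b"
    using smooth_bounded_on_cball[OF test_smooth[OF assms]] by metis
  then show ?thesis using that r by (metis abs_zero less_imp_le not_le)
qed

subsection \<open>Bump functions\<close>

text \<open>The function exp(-1/t), flat at 0, with a polynomial factor in 1/t: unlike the single
  function, this family is closed under differentiation.\<close>

definition flat_exp :: "real poly \<Rightarrow> real \<Rightarrow> real" where
  "flat_exp p t = (if t > 0 then poly p (1 / t) * exp (- (1 / t)) else 0)"

lemma poly_times_exp_tendsto_0: "((\<lambda>s. poly p s * exp (- s :: real)) \<longlongrightarrow> 0) at_top"
proof (induction p)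
  case 0
  then show ?case by simp
next
  case (pCons a p)
  have e: "((\<lambda>s::real. s ^ k * exp (- s)) \<longlongrightarrow> 0) at_top" for k
    using tendsto_power_div_exp_0[of k] by (simp add: exp_minus field_simps)
  have "((\<lambda>s. poly q s * exp (- s :: real)) \<longlongrightarrow> 0) at_top" for q
    unfolding poly_altdef sum_distrib_right
    by (rule tendsto_null_sum) (use tendsto_mult_right_zero[OF e] in \<open>simp add: mult.assoc\<close>)
  then show ?case .
qed

text \<open>With s = 1/t one has ds/dt = - s^2, so p(s) exp(-s) has the t-derivative s^2 (p - p')(s)
  exp(-s); the factor s^2 is the polynomial \<open>[:0, 0, 1:]\<close>.\<close>

lemma has_derivative_flat_exp:
  "(flat_exp p has_real_derivative flat_exp ([:0, 0, 1:] * (p - pderiv p)) t) (at t)"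
proof -
  let ?q = "[:0, 0, 1:] * (p - pderiv p)"
  consider "t > 0" | "t < 0" | "t = 0" by linarith
  then show ?thesis
  proof cases
    case 1
    have "((\<lambda>t. poly p (1 / t) * exp (- (1 / t))) has_real_derivative flat_exp ?q t) (at t)"
      using 1 by (auto intro!: derivative_eq_intros poly_DERIV[THEN DERIV_chain2]
          simp: flat_exp_def field_simps power2_eq_square)
    then show ?thesis
      by (rule has_field_derivative_transform_within_open[of _ _ _ "{0<..}"]) (use 1 in \<open>auto simp: flat_exp_def\<close>)
  next
    case 2
    have "((\<lambda>t. 0) has_real_derivative flat_exp ?q t) (at t)"
      using 2 by (simp add: flat_exp_def)
    then show ?thesis
      by (rule has_field_derivative_transform_within_open[of _ _ _ "{..<0}"]) (use 2 in \<open>auto simp: flat_exp_def\<close>)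
  next
    case 3
    \<comment> \<open>For h > 0 and s = 1/h the difference quotient is s p(s) exp(-s), hence the
      polynomial \<open>pCons 0 p\<close> below.\<close>
    have R: "((\<lambda>h. (flat_exp p (0 + h) - flat_exp p 0) / h) \<longlongrightarrow> 0) (at_right 0)"
    proof -
      have "((\<lambda>s. poly (pCons 0 p) s * exp (- s)) \<longlongrightarrow> 0) at_top" by (rule poly_times_exp_tendsto_0)
      then have "((\<lambda>h. poly (pCons 0 p) (inverse h) * exp (- inverse h)) \<longlongrightarrow> 0) (at_right (0::real))"
        by (rule filterlim_compose) (rule filterlim_inverse_at_top_right)
      then show ?thesis
        by (rule filterlim_mono_eventually)
          (auto simp: flat_exp_def eventually_at_filter field_simps)
    qed
    have L: "((\<lambda>h. (flat_exp p (0 + h) - flat_exp p 0) / h) \<longlongrightarrow> 0) (at_left 0)"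
      by (rule tendsto_eventually) (auto simp: flat_exp_def eventually_at_filter)
    have "flat_exp ?q 0 = 0" by (simp add: flat_exp_def)
    then show ?thesis
      using filterlim_split_at[OF L R] 3 unfolding DERIV_def by simp
  qed
qed

text \<open>The parameter \<open>s\<close> controls the steepness: as it grows, the values on the
  open box tend to 1, while the support stays the same.\<close>

definition bump :: "real \<Rightarrow> real^'n::finite \<Rightarrow> real^'n \<Rightarrow> real^'n \<Rightarrow> real" where
  "bump s a b x = (\<Prod>i\<in>UNIV. flat_exp 1 (s * (x $ i - a $ i)) * flat_exp 1 (s * (b $ i - x $ i)))"

lemma bump_smooth: "bump s a b \<in> smooth_functions"
proof -
  have *: "(\<lambda>x. flat_exp p (V x)) \<in> smooth_functions" if "V \<in> smooth_functions" for p V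
    by (rule smooth_compose[OF that, where C = "range flat_exp"]) (use has_derivative_flat_exp in blast)+
  have "(\<lambda>x. \<Prod>i\<in>UNIV. flat_exp 1 (s * (x $ i - a $ i)) * flat_exp 1 (s * (b $ i - x $ i)))
      \<in> smooth_functions"
    by (intro smooth_prod smooth_mult * smooth_cmult smooth_diff smooth_nth smooth_const)
  then show ?thesis unfolding bump_def[abs_def] .
qed

lemma bump_eq_0: "s > 0 \<Longrightarrow> x \<notin> box a b \<Longrightarrow> bump s a b x = 0"
  by (auto simp: bump_def mem_box_cart flat_exp_def zero_less_mult_iff)

lemma flat_exp_1_range: "0 \<le> flat_exp 1 t" "flat_exp 1 t \<le> 1"
  by (auto simp: flat_exp_def)

lemma bump_range: "0 \<le> bump s a b x" "bump s a b x \<le> 1"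
  unfolding bump_def
  by (intro prod_nonneg prod_le_1 conjI mult_nonneg_nonneg mult_le_one flat_exp_1_range ballI)+

lemma bump_test: "s > 0 \<Longrightarrow> bump s a b \<in> test_functions"
proof -
  assume s: "s > 0"
  have "bounded {x. bump s a b x \<noteq> 0}"
    by (rule bounded_subset[OF bounded_box[of a b]]) (use bump_eq_0[OF s] in blast)
  then show ?thesis using bump_smooth by (simp add: test_functions_def compact_closure)
qed

lemma flat_exp_1_power: "(flat_exp 1 (s * t))\<^sup>2 = flat_exp 1 (s / 2 * t)" if "s > 0"
  using that by (auto simp: flat_exp_def zero_less_mult_iff power2_eq_square simp flip: exp_add)

text \<open>The square of exp(-1/t) is exp(-1/(t/2)), so every bump is the square of another bump.
  Identities known only for squares of test functions can therefore be tested on bumps.\<close>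

lemma bump_square: "s > 0 \<Longrightarrow> (bump s a b x)\<^sup>2 = bump (s / 2) a b x"
  unfolding bump_def prod_power_distrib power_mult_distrib by (simp only: flat_exp_1_power)

lemma bump_tendsto: "(\<lambda>n. bump (real (Suc n)) a b x) \<longlonglongrightarrow> indicator (box a b) x"
proof (cases "x \<in> box a b")
  case True
  have *: "(\<lambda>n. flat_exp 1 (real (Suc n) * t)) \<longlonglongrightarrow> 1" if "t > 0" for t
  proof -
    have "(\<lambda>n. exp (- (1 / t) * inverse (real (Suc n)))) \<longlonglongrightarrow> exp (- (1 / t) * 0)"
      by (intro tendsto_intros LIMSEQ_inverse_real_of_nat)
    moreover have "flat_exp 1 (real (Suc n) * t) = exp (- (1 / t) * inverse (real (Suc n)))" for n
      using that zero_less_mult_iff[of "real (Suc n)" t]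
      by (simp add: flat_exp_def divide_inverse del: of_nat_Suc)
    ultimately show ?thesis by simp
  qed
  have "(\<lambda>n. bump (real (Suc n)) a b x) \<longlonglongrightarrow> (\<Prod>i\<in>(UNIV::'a set). 1 * 1)"
    unfolding bump_def by (intro tendsto_prod tendsto_mult *) (use True in \<open>auto simp: mem_box_cart\<close>)
  then show ?thesis using True by simp
next
  case False
  then show ?thesis by (simp add: bump_eq_0)
qed

subsection \<open>Square integrable functions\<close>

lemma L2_D:
  assumes "u \<in> L2 M"
  shows "u \<in> borel_measurable M" "integrable M (\<lambda>x. (u x)\<^sup>2)" "integrable M (\<lambda>x. u x * u x)"
  using assms by (auto simp: L2_def power2_eq_square)

lemma L2_zero: "(\<lambda>x. 0) \<in> L2 M"
  by (simp add: L2_def)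

lemma L2_mult_integrable:
  assumes "u \<in> L2 M" "v \<in> L2 M"
  shows "integrable M (\<lambda>x. u x * v x)"
proof (rule Bochner_Integration.integrable_bound)
  show "integrable M (\<lambda>x. (u x)\<^sup>2 + (v x)\<^sup>2)"
    using assms by (intro Bochner_Integration.integrable_add L2_D)
  show "(\<lambda>x. u x * v x) \<in> borel_measurable M"
    using assms by (intro borel_measurable_times L2_D)
  have "\<bar>a * b\<bar> \<le> a\<^sup>2 + b\<^sup>2" for a b :: real
    using sum_squares_bound[of "\<bar>a\<bar>" "\<bar>b\<bar>"] abs_ge_zero[of "a * b"]
    unfolding power2_abs abs_mult by linarith
  then show "AE x in M. norm (u x * v x) \<le> norm ((u x)\<^sup>2 + (v x)\<^sup>2)"
    by (intro AE_I2) (metis real_norm_def abs_of_nonneg add_nonneg_nonneg zero_le_power2)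
qed

lemma L2_lin:
  assumes "u \<in> L2 M" "v \<in> L2 M"
  shows "(\<lambda>x. u x + c * v x) \<in> L2 M"
proof -
  have "integrable M (\<lambda>x. (u x)\<^sup>2 + 2 * c * (u x * v x) + c\<^sup>2 * (v x)\<^sup>2)"
    using assms by (intro Bochner_Integration.integrable_add integrable_mult_right L2_mult_integrable L2_D)
  moreover have "(\<lambda>x. (u x)\<^sup>2 + 2 * c * (u x * v x) + c\<^sup>2 * (v x)\<^sup>2) = (\<lambda>x. (u x + c * v x)\<^sup>2)"
    by (simp add: fun_eq_iff power2_eq_square algebra_simps)
  ultimately show ?thesis
    using assms by (auto simp: L2_def)
qed

lemma L2_add: "u \<in> L2 M \<Longrightarrow> v \<in> L2 M \<Longrightarrow> (\<lambda>x. u x + v x) \<in> L2 M"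
  using L2_lin[of u M v 1] by simp

lemma L2_diff: "u \<in> L2 M \<Longrightarrow> v \<in> L2 M \<Longrightarrow> (\<lambda>x. u x - v x) \<in> L2 M"
  using L2_lin[of u M v "-1"] by simp

lemma L2_cmult: "u \<in> L2 M \<Longrightarrow> (\<lambda>x. c * u x) \<in> L2 M"
  using L2_lin[OF L2_zero, of u M c] by simp

lemma L2_square_zero_AE:
  assumes "u \<in> L2 M" "(\<integral>x. (u x)\<^sup>2 \<partial>M) = 0"
  shows "AE x in M. u x = 0"
  using integral_nonneg_eq_0_iff_AE[OF L2_D(2)[OF assms(1)]] assms(2) by simp

text \<open>The rate 8^(-n) for squared distances leaves room for a weight 4^n with a summable
  remainder 2^(-n). Almost everywhere the increments are then at most a constant times 2^(-n), so
  the sequence converges pointwise without passing to a subsequence.\<close>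

lemma Riesz_Fischer_geometric:
  fixes f :: "nat \<Rightarrow> 'a \<Rightarrow> real"
  assumes f: "\<And>n. f n \<in> L2 M"
    and cauchy: "\<And>n m. n \<le> m \<Longrightarrow> (\<integral>x. (f n x - f m x)\<^sup>2 \<partial>M) \<le> C * (1/8) ^ n"
  obtains w where "w \<in> L2 M" "\<And>n. (\<integral>x. (w x - f n x)\<^sup>2 \<partial>M) \<le> C * (1/8) ^ n"
proof -
  have C: "C \<ge> 0" using cauchy[of 0 0] by simp
  note [measurable] = L2_D(1)[OF f]
  have nn: "(\<integral>\<^sup>+x. ennreal ((f n x - f m x)\<^sup>2) \<partial>M) \<le> ennreal (C * (1/8) ^ n)" if "n \<le> m" for n m
    using cauchy[OF that] L2_D(2)[OF L2_diff[OF f f]]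
    by (subst nn_integral_eq_integral) (auto intro: ennreal_leI)
  have "(\<integral>\<^sup>+x. (\<Sum>n. ennreal (4 ^ n * (f n x - f (Suc n) x)\<^sup>2)) \<partial>M)
      = (\<Sum>n. \<integral>\<^sup>+x. ennreal (4 ^ n * (f n x - f (Suc n) x)\<^sup>2) \<partial>M)"
    by (rule nn_integral_suminf) measurable
  also have "\<dots> \<le> (\<Sum>n. ennreal (C * (1/2) ^ n))"
  proof (intro suminf_le summableI)
    fix n
    have "(\<integral>\<^sup>+x. ennreal (4 ^ n * (f n x - f (Suc n) x)\<^sup>2) \<partial>M)
        = ennreal (4 ^ n) * (\<integral>\<^sup>+x. ennreal ((f n x - f (Suc n) x)\<^sup>2) \<partial>M)"
      by (subst nn_integral_cmult[symmetric]) (auto simp: ennreal_mult')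
    also have "\<dots> \<le> ennreal (4 ^ n) * ennreal (C * (1/8) ^ n)"
      by (intro mult_left_mono nn) auto
    also have "\<dots> = ennreal (C * (1/2) ^ n)"
      using C by (simp add: ennreal_mult'[symmetric] power_mult_distrib[symmetric] algebra_simps)
    finally show "(\<integral>\<^sup>+x. ennreal (4 ^ n * (f n x - f (Suc n) x)\<^sup>2) \<partial>M) \<le> ennreal (C * (1/2) ^ n)" .
  qed
  also have "\<dots> < \<infinity>"
    using C by (subst suminf_ennreal2) (auto intro!: summable_mult summable_geometric simp: ennreal_less_top)
  finally have "AE x in M. (\<Sum>n. ennreal (4 ^ n * (f n x - f (Suc n) x)\<^sup>2)) \<noteq> \<infinity>"
    by (intro nn_integral_PInf_AE) auto
  then have conv: "AE x in M. convergent (\<lambda>n. f n x)"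
  proof (rule AE_mp, intro AE_I2 impI)
    fix x assume fin: "(\<Sum>n. ennreal (4 ^ n * (f n x - f (Suc n) x)\<^sup>2)) \<noteq> \<infinity>"
    define K where "K = enn2real (\<Sum>n. ennreal (4 ^ n * (f n x - f (Suc n) x)\<^sup>2))"
    have K: "4 ^ n * (f n x - f (Suc n) x)\<^sup>2 \<le> K" for n
    proof -
      have "ennreal (4 ^ n * (f n x - f (Suc n) x)\<^sup>2) \<le> (\<Sum>n. ennreal (4 ^ n * (f n x - f (Suc n) x)\<^sup>2))"
        using sum_le_suminf[OF summableI, of "{n}"] by simp
      also have "\<dots> = ennreal K" unfolding K_def using fin by (simp add: less_top)
      finally show ?thesis by (simp add: K_def ennreal_le_iff)
    qed
    have "norm (f (Suc n) x - f n x) \<le> sqrt K * (1/2) ^ n" for n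
    proof -
      have p: "((2::real) ^ n)\<^sup>2 = 4 ^ n"
        by (simp add: power2_eq_square flip: power_mult_distrib)
      have "(2 ^ n * \<bar>f n x - f (Suc n) x\<bar>)\<^sup>2 \<le> K"
        using K[of n] p by (simp add: power_mult_distrib)
      then have "2 ^ n * \<bar>f n x - f (Suc n) x\<bar> \<le> sqrt K" by (simp add: real_le_rsqrt)
      then show ?thesis by (simp add: field_simps power_divide abs_minus_commute)
    qed
    then have "summable (\<lambda>n. f (Suc n) x - f n x)"
      by (rule summable_comparison_test'[OF summable_mult[OF summable_geometric], rotated]) simp
    then have "convergent (\<lambda>n. \<Sum>k<n. f (Suc k) x - f k x)"
      by (simp add: summable_iff_convergent)
    then have "convergent (\<lambda>n. f n x - f 0 x)"
      using sum_lessThan_telescope[of "\<lambda>k. f k x"] by simp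
    then show "convergent (\<lambda>n. f n x)"
      using convergent_add[OF _ convergent_const[of "f 0 x"]] by fastforce
  qed
  define w where "w x = lim (\<lambda>n. f n x)" for x
  have [measurable]: "w \<in> borel_measurable M"
    unfolding w_def by measurable
  \<comment> \<open>Fatou's lemma carries the bound for the distance of \<open>f n\<close> and
    \<open>f m\<close> over to the limit in \<open>m\<close>.\<close>
  have le: "(\<integral>\<^sup>+x. ennreal ((w x - f n x)\<^sup>2) \<partial>M) \<le> ennreal (C * (1/8) ^ n)" for n
  proof -
    have "(\<integral>\<^sup>+x. ennreal ((w x - f n x)\<^sup>2) \<partial>M)
        = (\<integral>\<^sup>+x. liminf (\<lambda>m. ennreal ((f m x - f n x)\<^sup>2)) \<partial>M)"
    proof (rule nn_integral_cong_AE, use conv in \<open>eventually_elim\<close>)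
      fix x assume "convergent (\<lambda>n. f n x)"
      then have "(\<lambda>m. f m x) \<longlonglongrightarrow> w x" unfolding w_def by (simp add: convergent_LIMSEQ_iff)
      then have "(\<lambda>m. ennreal ((f m x - f n x)\<^sup>2)) \<longlonglongrightarrow> ennreal ((w x - f n x)\<^sup>2)"
        by (intro tendsto_intros)
      then show "ennreal ((w x - f n x)\<^sup>2) = liminf (\<lambda>m. ennreal ((f m x - f n x)\<^sup>2))"
        using lim_imp_Liminf[OF trivial_limit_sequentially] by metis
    qed
    also have "\<dots> \<le> liminf (\<lambda>m. \<integral>\<^sup>+x. ennreal ((f m x - f n x)\<^sup>2) \<partial>M)"
      by (rule nn_integral_liminf) measurable
    also have "\<dots> \<le> ennreal (C * (1/8) ^ n)"
    proof (rule Liminf_le[OF trivial_limit_sequentially])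
      show "\<forall>\<^sub>F m in sequentially. (\<integral>\<^sup>+x. ennreal ((f m x - f n x)\<^sup>2) \<partial>M) \<le> ennreal (C * (1/8) ^ n)"
        using eventually_ge_at_top[of n]
      proof eventually_elim
        case (elim m)
        then show ?case using nn[OF elim] by (simp add: power2_commute[of "f m _"])
      qed
    qed
    finally show ?thesis .
  qed
  have int: "integrable M (\<lambda>x. (w x - f n x)\<^sup>2)" for n
    by (rule integrableI_nonneg) (use le_less_trans[OF le[of n] ennreal_less_top] in auto)
  have "(\<lambda>x. (w x - f 0 x) + f 0 x) \<in> L2 M"
    by (intro L2_add f) (use int[of 0] in \<open>auto simp: L2_def\<close>)
  moreover have "(\<integral>x. (w x - f n x)\<^sup>2 \<partial>M) \<le> C * (1/8) ^ n" for n
    using le[of n] C nn_integral_eq_integral[OF int[of n]] by (simp add: ennreal_le_iff)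
  ultimately show ?thesis using that by simp
qed

section \<open>Finite direct sums of Hilbert spaces and orthogonal projection\<close>

definition L2_family :: "('i \<Rightarrow> 'a measure) \<Rightarrow> ('i \<Rightarrow> 'a \<Rightarrow> real) set" where
  "L2_family \<mu> = {U. \<forall>i. U i \<in> L2 (\<mu> i)}"

text \<open>The inner product of the direct sum. The summands may carry different measures, since
  the operator \<open>T\<close> maps between differently weighted spaces.\<close>

definition ip :: "('i::finite \<Rightarrow> 'a measure) \<Rightarrow> ('i \<Rightarrow> 'a \<Rightarrow> real) \<Rightarrow> ('i \<Rightarrow> 'a \<Rightarrow> real) \<Rightarrow> real" where
  "ip \<mu> U V = (\<Sum>i\<in>UNIV. \<integral>x. U i x * V i x \<partial>\<mu> i)"

abbreviation sqdist :: "('i::finite \<Rightarrow> 'a measure) \<Rightarrow> ('i \<Rightarrow> 'a \<Rightarrow> real) \<Rightarrow> ('i \<Rightarrow> 'a \<Rightarrow> real) \<Rightarrow> real" where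
  "sqdist \<mu> U V \<equiv> ip \<mu> (\<lambda>i x. U i x - V i x) (\<lambda>i x. U i x - V i x)"

lemma L2_family_lin:
  "U \<in> L2_family \<mu> \<Longrightarrow> V \<in> L2_family \<mu> \<Longrightarrow> (\<lambda>i x. U i x + c * V i x) \<in> L2_family \<mu>"
  by (auto simp: L2_family_def intro: L2_lin)

lemma L2_family_diff:
  "U \<in> L2_family \<mu> \<Longrightarrow> V \<in> L2_family \<mu> \<Longrightarrow> (\<lambda>i x. U i x - V i x) \<in> L2_family \<mu>"
  by (auto simp: L2_family_def intro: L2_diff)

lemma ip_commute: "ip \<mu> U V = ip \<mu> V U"
  by (simp add: ip_def mult.commute)

lemma ip_nonneg: "ip \<mu> U U \<ge> 0"
  by (auto simp: ip_def intro!: sum_nonneg)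

lemma ip_lin_left:
  assumes "U \<in> L2_family \<mu>" "V \<in> L2_family \<mu>" "W \<in> L2_family \<mu>"
  shows "ip \<mu> (\<lambda>i x. U i x + c * V i x) W = ip \<mu> U W + c * ip \<mu> V W"
proof -
  have "(\<integral>x. (U i x + c * V i x) * W i x \<partial>\<mu> i)
      = (\<integral>x. U i x * W i x \<partial>\<mu> i) + c * (\<integral>x. V i x * W i x \<partial>\<mu> i)" for i
    using assms by (simp add: L2_family_def L2_mult_integrable distrib_right mult.assoc)
  then show ?thesis by (simp add: ip_def sum.distrib sum_distrib_left)
qed

lemma ip_diff_left:
  assumes "U \<in> L2_family \<mu>" "V \<in> L2_family \<mu>" "W \<in> L2_family \<mu>"
  shows "ip \<mu> (\<lambda>i x. U i x - V i x) W = ip \<mu> U W - ip \<mu> V W"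
  using ip_lin_left[OF assms, of "-1"] by simp

lemma ip_square_lin:
  assumes "U \<in> L2_family \<mu>" "V \<in> L2_family \<mu>"
  shows "ip \<mu> (\<lambda>i x. U i x + c * V i x) (\<lambda>i x. U i x + c * V i x)
    = ip \<mu> U U + 2 * c * ip \<mu> U V + c\<^sup>2 * ip \<mu> V V"
proof -
  note UV = L2_family_lin[OF assms, of c]
  have "ip \<mu> (\<lambda>i x. U i x + c * V i x) (\<lambda>i x. U i x + c * V i x)
      = ip \<mu> U (\<lambda>i x. U i x + c * V i x) + c * ip \<mu> V (\<lambda>i x. U i x + c * V i x)"
    by (rule ip_lin_left[OF assms UV])
  also have "ip \<mu> U (\<lambda>i x. U i x + c * V i x) = ip \<mu> U U + c * ip \<mu> V U"
    by (subst ip_commute) (rule ip_lin_left[OF assms assms(1)])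
  also have "ip \<mu> V (\<lambda>i x. U i x + c * V i x) = ip \<mu> U V + c * ip \<mu> V V"
    by (subst ip_commute) (rule ip_lin_left[OF assms assms(2)])
  also have "ip \<mu> V U = ip \<mu> U V" by (rule ip_commute)
  finally show ?thesis by (simp add: algebra_simps power2_eq_square)
qed

text \<open>The squared norms of U + d V and U - d V are nonnegative. This stands in for the
  Cauchy-Schwarz inequality and avoids square roots.\<close>

lemma ip_weighted_bound:
  assumes "U \<in> L2_family \<mu>" "V \<in> L2_family \<mu>" "d > 0"
  shows "2 * \<bar>ip \<mu> U V\<bar> \<le> ip \<mu> U U / d + d * ip \<mu> V V"
proof -
  have "0 \<le> ip \<mu> U U + 2 * c * ip \<mu> U V + c\<^sup>2 * ip \<mu> V V" for c
    unfolding ip_square_lin[OF assms(1,2), of c, symmetric] by (rule ip_nonneg)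
  from this[of d] this[of "-d"] have "d * (2 * \<bar>ip \<mu> U V\<bar>) \<le> ip \<mu> U U + d\<^sup>2 * ip \<mu> V V"
    by (simp add: abs_if)
  then show ?thesis using assms(3) by (simp add: field_simps power2_eq_square)
qed

text \<open>Continuity of the inner product, in a form where the approximants themselves need only
  be nearly orthogonal to \<open>X\<close>.\<close>

lemma orthogonal_if_approximable:
  assumes W: "W \<in> L2_family \<mu>" and X: "X \<in> L2_family \<mu>"
    and approx: "\<And>e. e > 0 \<Longrightarrow> \<exists>V\<in>L2_family \<mu>. \<bar>ip \<mu> V X\<bar> \<le> e \<and>
      sqdist \<mu> W V \<le> e"
  shows "ip \<mu> W X = 0"
proof (rule ccontr)
  assume nz: "ip \<mu> W X \<noteq> 0"
  define a where "a = \<bar>ip \<mu> W X\<bar>"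
  define N where "N = 1 + ip \<mu> X X"
  have a: "a > 0" and N: "N > 0" using nz ip_nonneg[of \<mu> X] by (auto simp: a_def N_def)
  \<comment> \<open>These choices give \<open>d * ip \<mu> X X\<close> at most a/2 and e/d at most
    a/4. Hence the error of the approximation is at most 3a/8, and together with a/4 it stays below
    \<open>a\<close>, a contradiction.\<close>
  define d where "d = a / (2 * N)"
  define e where "e = min (a / 4) (d * a / 4)"
  have d: "d > 0" using a N by (simp add: d_def)
  have e: "e > 0" using a d by (simp add: e_def)
  obtain V where V: "V \<in> L2_family \<mu>" "\<bar>ip \<mu> V X\<bar> \<le> e"
      "sqdist \<mu> W V \<le> e"
    using approx[OF e] by blast
  have "2 * \<bar>ip \<mu> (\<lambda>i x. W i x - V i x) X\<bar> \<le> e / d + d * ip \<mu> X X"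
    using ip_weighted_bound[OF L2_family_diff[OF W V(1)] X d] V(3) d
    by (meson add_mono divide_right_mono less_imp_le order_refl order_trans)
  also have "e / d \<le> a / 4" using d by (simp add: e_def field_simps)
  also have "d * ip \<mu> X X \<le> a / 2"
  proof -
    have "d * ip \<mu> X X \<le> d * N" using d by (simp add: N_def)
    also have "\<dots> = a / 2" using N by (simp add: d_def)
    finally show ?thesis .
  qed
  finally have 1: "2 * \<bar>ip \<mu> W X - ip \<mu> V X\<bar> \<le> a / 4 + a / 2"
    using ip_diff_left[OF W V(1) X] by simp
  have 2: "\<bar>ip \<mu> V X\<bar> \<le> a / 4" using V(2) by (simp add: e_def)
  have 3: "a \<le> \<bar>ip \<mu> W X - ip \<mu> V X\<bar> + \<bar>ip \<mu> V X\<bar>"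
    using abs_triangle_ineq[of "ip \<mu> W X - ip \<mu> V X" "ip \<mu> V X"] by (simp add: a_def)
  have "False" if "2 * y \<le> a / 4 + a / 2" "z \<le> a / 4" "a \<le> y + z" for y z :: real
    using that a by argo
  then show False using 1 2 3 by blast
qed

text \<open>A minimizing sequence is Cauchy by the parallelogram law. The subspace \<open>S\<close>
  is not assumed closed, so \<open>W\<close> is obtained as a point of its closure only.\<close>

lemma L2_projection:
  fixes S :: "('i::finite \<Rightarrow> 'a \<Rightarrow> real) set"
  assumes S: "S \<subseteq> L2_family \<mu>" "S \<noteq> {}"
    and lin: "\<And>U V c. U \<in> S \<Longrightarrow> V \<in> S \<Longrightarrow> (\<lambda>i x. U i x + c * V i x) \<in> S"
    and U: "U \<in> L2_family \<mu>"
  obtains W where "W \<in> L2_family \<mu>"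
    "\<And>V. V \<in> S \<Longrightarrow> ip \<mu> (\<lambda>i x. U i x - W i x) V = 0"
    "\<And>e. e > 0 \<Longrightarrow> \<exists>V\<in>S. sqdist \<mu> W V < e"
proof -
  define q where "q V = sqdist \<mu> U V" for V
  define D where "D = Inf (q ` S)"
  have bdd: "bdd_below (q ` S)"
    by (rule bdd_belowI[of _ 0]) (auto simp: q_def ip_nonneg)
  have D: "D \<le> q V" if "V \<in> S" for V
    unfolding D_def using that bdd by (intro cInf_lower) auto
  have SL: "V \<in> L2_family \<mu>" if "V \<in> S" for V using that S by blast
  note [simp] = SL
  have "\<exists>V\<in>S. q V < D + (1/8) ^ n" for n :: nat
  proof -
    have "Inf (q ` S) < D + (1/8) ^ n" by (simp add: D_def)
    then show ?thesis using cInf_lessD[of "q ` S"] S(2) by blast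
  qed
  \<comment> \<open>The defects (1/8)^n are chosen to produce the rate that the completeness lemma
    asks for.\<close>
  then obtain s where s: "\<And>n::nat. s n \<in> S" "\<And>n. q (s n) < D + (1/8) ^ n" by metis
  have scale: "(\<lambda>i x. c * V i x) \<in> S" if "V \<in> S" for V c
    using lin[OF that that, of "c - 1"] by (simp add: algebra_simps)
  have perturb: "q (s n) + 2 * c * ip \<mu> (\<lambda>i x. U i x - s n i x) V + c\<^sup>2 * ip \<mu> V V \<ge> D"
    if V: "V \<in> S" for V c n
  proof -
    have "q (\<lambda>i x. s n i x + (- c) * V i x)
        = q (s n) + 2 * c * ip \<mu> (\<lambda>i x. U i x - s n i x) V + c\<^sup>2 * ip \<mu> V V"
      unfolding q_def using ip_square_lin[OF L2_family_diff[OF U SL[OF s(1)]] SL[OF V], of n c]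
      by (simp add: algebra_simps)
    then show ?thesis using D[OF lin[OF s(1)[of n] V, of "- c"]] by simp
  qed
  have cauchy: "sqdist \<mu> (s n) (s m) \<le> 4 * (1/8) ^ n"
    if "n \<le> m" for n m
  proof -
    define A where "A = (\<lambda>i x. U i x - s n i x)"
    define B where "B = (\<lambda>i x. s n i x - s m i x)"
    have A: "A \<in> L2_family \<mu>" unfolding A_def using U s(1) by (intro L2_family_diff) auto
    have BS: "B \<in> S" unfolding B_def using lin[OF s(1) s(1), of n "-1" m] by simp
    have "q (s m) = q (s n) + 2 * 1 * ip \<mu> A B + 1\<^sup>2 * ip \<mu> B B"
      unfolding q_def using ip_square_lin[OF A SL[OF BS], of 1] by (simp add: A_def B_def)
    \<comment> \<open>The value 1/2 of the parameter is the midpoint of \<open>s n\<close> and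
      \<open>s m\<close>, which also lies in \<open>S\<close> and so cannot beat the infimum
      \<open>D\<close>; the value 1 above is \<open>s m\<close> itself.\<close>
    moreover have "q (s n) + 2 * (1/2) * ip \<mu> A B + (1/2)\<^sup>2 * ip \<mu> B B \<ge> D"
      using perturb[OF BS, of n "1/2"] by (simp add: A_def)
    ultimately have "ip \<mu> B B / 2 \<le> q (s m) + q (s n) - 2 * D"
      by (simp add: power2_eq_square)
    moreover have "(1/8::real) ^ m \<le> (1/8) ^ n"
      using that by (intro power_decreasing) auto
    ultimately show ?thesis using s(2)[of n] s(2)[of m] unfolding B_def by linarith
  qed
  have "\<exists>w. w \<in> L2 (\<mu> i) \<and> (\<forall>n. (\<integral>x. (w x - s n i x)\<^sup>2 \<partial>\<mu> i) \<le> 4 * (1/8) ^ n)" for i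
  proof -
    have 1: "s n i \<in> L2 (\<mu> i)" for n using SL[OF s(1)] by (simp add: L2_family_def)
    have 2: "(\<integral>x. (s n i x - s m i x)\<^sup>2 \<partial>\<mu> i) \<le> 4 * (1/8) ^ n" if "n \<le> m" for n m
    proof -
      have "(\<integral>x. (s n i x - s m i x)\<^sup>2 \<partial>\<mu> i) \<le> sqdist \<mu> (s n) (s m)"
        unfolding ip_def power2_eq_square by (rule member_le_sum) auto
      then show ?thesis using cauchy[OF that] by simp
    qed
    obtain w where w: "w \<in> L2 (\<mu> i)" "\<And>n. (\<integral>x. (w x - s n i x)\<^sup>2 \<partial>\<mu> i) \<le> 4 * (1/8) ^ n"
      by (rule Riesz_Fischer_geometric[where M = "\<mu> i" and f = "\<lambda>n. s n i" and C = 4]) (use 1 2 in auto)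
    then show ?thesis by blast
  qed
  then have "\<forall>i. \<exists>w. w \<in> L2 (\<mu> i) \<and> (\<forall>n. (\<integral>x. (w x - s n i x)\<^sup>2 \<partial>\<mu> i) \<le> 4 * (1/8) ^ n)" ..
  from choice[OF this] obtain W where W: "\<And>i. W i \<in> L2 (\<mu> i)"
      "\<And>i n. (\<integral>x. (W i x - s n i x)\<^sup>2 \<partial>\<mu> i) \<le> 4 * (1/8) ^ n"
    by blast
  have WL: "W \<in> L2_family \<mu>" using W(1) by (simp add: L2_family_def)
  have close: "sqdist \<mu> W (s n) \<le> real CARD('i) * 4 * (1/8) ^ n" for n
    using sum_mono[of UNIV "\<lambda>i. \<integral>x. (W i x - s n i x)\<^sup>2 \<partial>\<mu> i" "\<lambda>i. 4 * (1/8) ^ n"] W(2)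
    by (simp add: ip_def power2_eq_square mult.assoc)
  have zero: "(\<lambda>n. c * (1/8::real) ^ n) \<longlonglongrightarrow> 0" for c
    using tendsto_mult_right_zero[OF LIMSEQ_power_zero[of "1/8::real"]] by simp
  have small: "\<exists>n. c * (1/8::real) ^ n < e \<and> c' * (1/8) ^ n < e" if "e > 0" for c c' e
    using eventually_conj[OF order_tendstoD(2)[OF zero that] order_tendstoD(2)[OF zero that]]
      eventually_happens' trivial_limit_sequentially by blast
  show ?thesis
  proof (rule that[OF WL])
    fix e :: real assume "e > 0"
    then show "\<exists>V\<in>S. sqdist \<mu> W V < e"
      using small[of e "real CARD('i) * 4" 0] close s(1) by (meson le_less_trans)
  next
    fix V assume V: "V \<in> S"
    show "ip \<mu> (\<lambda>i x. U i x - W i x) V = 0"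
    proof (rule orthogonal_if_approximable[OF L2_family_diff[OF U WL] SL[OF V]])
      fix e :: real assume e: "e > 0"
      define N where "N = ip \<mu> V V + 1"
      have N: "N > 0" using ip_nonneg[of \<mu> V] by (simp add: N_def)
      \<comment> \<open>Moving the near-minimizer by c V in both directions gives 2 c |a| <= (1/8)^n
        + c^2 N. With c = e/N and \<open>n\<close> large, both terms on the right are at most c
        e.\<close>
      define c where "c = e / N"
      have c: "c > 0" using e N by (simp add: c_def)
      obtain n where n: "real CARD('i) * 4 * (1/8) ^ n < min e (c * e)" "1 * (1/8) ^ n < min e (c * e)"
        using small[of "min e (c * e)"] e c by fastforce
      define a where "a = ip \<mu> (\<lambda>i x. U i x - s n i x) V"
      have "0 \<le> (1/8) ^ n + 2 * c * a + c\<^sup>2 * ip \<mu> V V" "0 \<le> (1/8) ^ n - 2 * c * a + c\<^sup>2 * ip \<mu> V V"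
        using perturb[OF V, of n c] perturb[OF V, of n "-c"] s(2)[of n] by (simp_all add: a_def)
      then have "2 * c * \<bar>a\<bar> \<le> (1/8) ^ n + c\<^sup>2 * ip \<mu> V V" by (simp add: abs_if)
      also have "\<dots> \<le> c * e + c\<^sup>2 * N"
        using n by (intro add_mono mult_left_mono) (auto simp: N_def)
      also have "c\<^sup>2 * N = c * e" using N by (simp add: c_def power2_eq_square)
      finally have a: "\<bar>a\<bar> \<le> e" using c by simp
      have "ip \<mu> (\<lambda>i x. U i x - W i x - (U i x - s n i x)) (\<lambda>i x. U i x - W i x - (U i x - s n i x))
          = sqdist \<mu> W (s n)"
        unfolding ip_def by (intro sum.cong Bochner_Integration.integral_cong) (auto simp: algebra_simps)
      then have "ip \<mu> (\<lambda>i x. U i x - W i x - (U i x - s n i x)) (\<lambda>i x. U i x - W i x - (U i x - s n i x)) \<le> e"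
        using close[of n] n by simp
      then show "\<exists>Va\<in>L2_family \<mu>. \<bar>ip \<mu> Va V\<bar> \<le> e \<and>
          ip \<mu> (\<lambda>i x. U i x - W i x - Va i x) (\<lambda>i x. U i x - W i x - Va i x) \<le> e"
        using a L2_family_diff[OF U SL[OF s(1)[of n]]] unfolding a_def by blast
    qed
  qed
qed

text \<open>The difference of \<open>w\<close> and its projection is orthogonal to \<open>X\<close>,
  hence zero almost everywhere, and the projection is approximable from \<open>X\<close>. The
  one-element index type presents a single space as a family.\<close>

lemma L2_dense:
  fixes X :: "('a \<Rightarrow> real) set"
  assumes X: "X \<subseteq> L2 M" "X \<noteq> {}"
    and lin: "\<And>u v c. u \<in> X \<Longrightarrow> v \<in> X \<Longrightarrow> (\<lambda>x. u x + c * v x) \<in> X"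
    and orth: "\<And>w. w \<in> L2 M \<Longrightarrow> (\<And>u. u \<in> X \<Longrightarrow> (\<integral>x. w x * u x \<partial>M) = 0) \<Longrightarrow> AE x in M. w x = 0"
    and w: "w \<in> L2 M" and e: "e > 0"
  obtains u where "u \<in> X" "(\<integral>x. (w x - u x)\<^sup>2 \<partial>M) < e"
proof -
  define S :: "(unit \<Rightarrow> 'a \<Rightarrow> real) set" where "S = {U. U () \<in> X}"
  obtain W where W: "W \<in> L2_family (\<lambda>_::unit. M)"
    "\<And>V. V \<in> S \<Longrightarrow> ip (\<lambda>_. M) (\<lambda>i x. w x - W i x) V = 0"
    "\<And>e. e > 0 \<Longrightarrow> \<exists>V\<in>S. ip (\<lambda>_. M) (\<lambda>i x. W i x - V i x) (\<lambda>i x. W i x - V i x) < e"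
  proof (rule L2_projection[where \<mu> = "\<lambda>_::unit. M" and S = S and U = "\<lambda>_. w"])
    show "S \<noteq> {}" using X(2) by (auto simp: S_def)
  qed (use X lin w in \<open>auto simp: S_def L2_family_def\<close>)
  have W1: "W () \<in> L2 M" using W(1) by (simp add: L2_family_def)
  have AE: "AE x in M. w x - W () x = 0"
  proof (rule orth[OF L2_diff[OF w W1]])
    fix u assume "u \<in> X"
    then show "(\<integral>x. (w x - W () x) * u x \<partial>M) = 0"
      using W(2)[of "\<lambda>_. u"] by (simp add: S_def ip_def UNIV_unit)
  qed
  obtain V where V: "V () \<in> X" "(\<integral>x. (W () x - V () x)\<^sup>2 \<partial>M) < e"
    using W(3)[OF e] by (auto simp: S_def ip_def UNIV_unit power2_eq_square)
  have "(\<integral>x. (w x - V () x)\<^sup>2 \<partial>M) = (\<integral>x. (W () x - V () x)\<^sup>2 \<partial>M)"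
  proof (rule Bochner_Integration.integral_cong_AE)
    have [measurable]: "w \<in> borel_measurable M" "W () \<in> borel_measurable M" "V () \<in> borel_measurable M"
      using w W1 V(1) X(1) L2_D(1) by blast+
    show "(\<lambda>x. (w x - V () x)\<^sup>2) \<in> borel_measurable M" "(\<lambda>x. (W () x - V () x)\<^sup>2) \<in> borel_measurable M"
      by measurable
    show "AE x in M. (w x - V () x)\<^sup>2 = (W () x - V () x)\<^sup>2"
      using AE by eventually_elim simp
  qed
  then show ?thesis using that[of "V ()"] V by simp
qed

subsection \<open>Von Neumann's theorem\<close>

text \<open>The orthogonal complement of \<open>X\<close> is read as the graph of a closed operator from the component
  with index \<open>k\<close> to the others, and \<open>von_Neumann_graph\<close> is the operator \<open>T\<^sup>*T\<close> for this \<open>T\<close>: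
  the pairing of \<open>T u\<close> with \<open>T w\<close> is \<open>ip \<mu> U W\<close> minus the product of the components at \<open>k\<close>.\<close>

definition orth_compl :: "('i::finite \<Rightarrow> 'a measure) \<Rightarrow> ('i \<Rightarrow> 'a \<Rightarrow> real) set \<Rightarrow> ('i \<Rightarrow> 'a \<Rightarrow> real) set" where
  "orth_compl \<mu> X = {U \<in> L2_family \<mu>. \<forall>V\<in>X. ip \<mu> U V = 0}"

definition von_Neumann_graph :: "('i::finite \<Rightarrow> 'a measure) \<Rightarrow> ('i \<Rightarrow> 'a \<Rightarrow> real) set \<Rightarrow> 'i \<Rightarrow> 'a op_graph" where
  "von_Neumann_graph \<mu> X k = {(u, v). v \<in> L2 (\<mu> k) \<and> (\<exists>U\<in>orth_compl \<mu> X. U k = u \<and>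
     (\<forall>W\<in>orth_compl \<mu> X. ip \<mu> U W = (\<integral>x. (u x + v x) * W k x \<partial>\<mu> k)))}"

lemma orth_compl_lin:
  assumes "X \<subseteq> L2_family \<mu>" "U \<in> orth_compl \<mu> X" "V \<in> orth_compl \<mu> X"
  shows "(\<lambda>i x. U i x + c * V i x) \<in> orth_compl \<mu> X"
  using assms L2_family_lin[of U \<mu> V c] ip_lin_left[of U \<mu> V _ c] unfolding orth_compl_def by auto

text \<open>This is surjectivity of 1 + T^* T. Projecting (g, 0) onto the graph of \<open>T\<close>
  gives some (u, T u), and orthogonality of the residual (g - u, - T u) to the graph says exactly
  that T^* T u = g - u.\<close>

lemma von_Neumann_graph_surj:
  fixes X :: "('i::finite \<Rightarrow> 'a \<Rightarrow> real) set"
  assumes X: "X \<subseteq> L2_family \<mu>" and g: "g \<in> L2 (\<mu> k)"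
  obtains u v where "(u, v) \<in> von_Neumann_graph \<mu> X k" "\<And>x. u x + v x = g x"
proof -
  define E where "E = (\<lambda>i x. if i = k then g x else 0)"
  have "E i \<in> L2 (\<mu> i)" for i
    by (cases "i = k") (use g in \<open>auto simp: E_def L2_zero\<close>)
  then have E: "E \<in> L2_family \<mu>" by (simp add: L2_family_def)
  have ipE: "ip \<mu> E W = (\<integral>x. g x * W k x \<partial>\<mu> k)" for W
  proof -
    have "(\<integral>x. E i x * W i x \<partial>\<mu> i) = (if i = k then \<integral>x. g x * W k x \<partial>\<mu> k else 0)" for i
      by (simp add: E_def)
    then show ?thesis by (simp add: ip_def)
  qed
  have O: "orth_compl \<mu> X \<subseteq> L2_family \<mu>" by (auto simp: orth_compl_def)
  have "(\<lambda>i x. 0) \<in> orth_compl \<mu> X" by (simp add: orth_compl_def L2_family_def L2_zero ip_def)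
  then have ne: "orth_compl \<mu> X \<noteq> {}" by blast
  have "\<exists>U\<in>L2_family \<mu>. (\<forall>V\<in>orth_compl \<mu> X. ip \<mu> (\<lambda>i x. E i x - U i x) V = 0) \<and>
      (\<forall>e>0. \<exists>V\<in>orth_compl \<mu> X. sqdist \<mu> U V < e)"
  proof (rule L2_projection[OF O ne _ E])
    show "(\<lambda>i x. U i x + c * V i x) \<in> orth_compl \<mu> X"
      if "U \<in> orth_compl \<mu> X" "V \<in> orth_compl \<mu> X" for U V c
      using orth_compl_lin[OF X that] .
  next
    fix U assume U: "U \<in> L2_family \<mu>"
      and 1: "\<And>V. V \<in> orth_compl \<mu> X \<Longrightarrow> ip \<mu> (\<lambda>i x. E i x - U i x) V = 0"
      and 2: "\<And>e. e > 0 \<Longrightarrow> \<exists>V\<in>orth_compl \<mu> X. sqdist \<mu> U V < e"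
    show "\<exists>U\<in>L2_family \<mu>. (\<forall>V\<in>orth_compl \<mu> X. ip \<mu> (\<lambda>i x. E i x - U i x) V = 0) \<and>
      (\<forall>e>0. \<exists>V\<in>orth_compl \<mu> X. sqdist \<mu> U V < e)"
      by (rule bexI[OF _ U]) (blast intro: 1 2)
  qed
  then obtain U where U: "U \<in> L2_family \<mu>"
    "\<And>V. V \<in> orth_compl \<mu> X \<Longrightarrow> ip \<mu> (\<lambda>i x. E i x - U i x) V = 0"
    "\<And>e. e > 0 \<Longrightarrow> \<exists>V\<in>orth_compl \<mu> X. sqdist \<mu> U V < e"
    by blast
  \<comment> \<open>The projection is only known to lie in the closure of the graph; being an
    orthogonal complement, the graph is closed.\<close>
  have "ip \<mu> U V = 0" if "V \<in> X" for V
  proof (rule orthogonal_if_approximable[OF U(1)])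
    fix e :: real assume e: "e > 0"
    obtain W where W: "W \<in> orth_compl \<mu> X" "sqdist \<mu> U W < e"
      using U(3)[OF e] by blast
    have "W \<in> L2_family \<mu>" "ip \<mu> W V = 0" using W(1) that by (auto simp: orth_compl_def)
    then show "\<exists>W\<in>L2_family \<mu>. \<bar>ip \<mu> W V\<bar> \<le> e \<and>
        sqdist \<mu> U W \<le> e"
      using W(2) e by (intro bexI[of _ W]) auto
  qed (use X that in auto)
  then have US: "U \<in> orth_compl \<mu> X" using U(1) by (simp add: orth_compl_def)
  have Uk: "U k \<in> L2 (\<mu> k)" using U(1) by (simp add: L2_family_def)
  have "ip \<mu> U W = (\<integral>x. (U k x + (g x - U k x)) * W k x \<partial>\<mu> k)" if W: "W \<in> orth_compl \<mu> X" for W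
    using U(2)[OF W] ip_diff_left[OF E U(1), of W] W ipE[of W] O by auto
  then have "(U k, \<lambda>x. g x - U k x) \<in> von_Neumann_graph \<mu> X k"
    unfolding von_Neumann_graph_def using US L2_diff[OF g Uk] by blast
  then show ?thesis using that by simp
qed

lemma von_Neumann_graph_L2:
  "(u, v) \<in> von_Neumann_graph \<mu> X k \<Longrightarrow> u \<in> L2 (\<mu> k) \<and> v \<in> L2 (\<mu> k)"
  by (auto simp: von_Neumann_graph_def orth_compl_def L2_family_def)

text \<open>The pairing \<open>ip \<mu> U W\<close> can be evaluated by the defining property of
  either pair; the integral of u w is common to both results and cancels.\<close>

lemma von_Neumann_graph_symmetric:
  assumes "(u, v) \<in> von_Neumann_graph \<mu> X k" "(w, z) \<in> von_Neumann_graph \<mu> X k"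
  shows "(\<integral>x. v x * w x \<partial>\<mu> k) = (\<integral>x. u x * z x \<partial>\<mu> k)"
proof -
  obtain U where U: "U \<in> orth_compl \<mu> X" "U k = u"
    "\<And>W. W \<in> orth_compl \<mu> X \<Longrightarrow> ip \<mu> U W = (\<integral>x. (u x + v x) * W k x \<partial>\<mu> k)"
    using assms(1) unfolding von_Neumann_graph_def by blast
  obtain W where W: "W \<in> orth_compl \<mu> X" "W k = w"
    "\<And>V. V \<in> orth_compl \<mu> X \<Longrightarrow> ip \<mu> W V = (\<integral>x. (w x + z x) * V k x \<partial>\<mu> k)"
    using assms(2) unfolding von_Neumann_graph_def by blast
  have "(\<integral>x. (u x + v x) * w x \<partial>\<mu> k) = (\<integral>x. (w x + z x) * u x \<partial>\<mu> k)"
    using U(3)[OF W(1)] W(3)[OF U(1)] U(2) W(2) ip_commute[of \<mu> U W] by simp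
  moreover have "u \<in> L2 (\<mu> k)" "v \<in> L2 (\<mu> k)" "w \<in> L2 (\<mu> k)" "z \<in> L2 (\<mu> k)"
    using von_Neumann_graph_L2[OF assms(1)] von_Neumann_graph_L2[OF assms(2)] by auto
  ultimately show ?thesis
    by (simp add: distrib_right L2_mult_integrable mult.commute[of "w _" "u _"] mult.commute[of "z _" "u _"])
qed

text \<open>The adjoint of a graph contains every representative of its elements, so a graph equal
  to its adjoint has to be saturated in this sense.\<close>

lemma von_Neumann_graph_AE:
  assumes X: "X \<subseteq> L2_family \<mu>" and uv: "(u, v) \<in> von_Neumann_graph \<mu> X k"
    and w: "w \<in> L2 (\<mu> k)" "AE x in \<mu> k. w x = u x" and z: "z \<in> L2 (\<mu> k)" "AE x in \<mu> k. z x = v x"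
  shows "(w, z) \<in> von_Neumann_graph \<mu> X k"
proof -
  obtain U where U: "U \<in> orth_compl \<mu> X" "U k = u"
    "\<And>W. W \<in> orth_compl \<mu> X \<Longrightarrow> ip \<mu> U W = (\<integral>x. (u x + v x) * W k x \<partial>\<mu> k)"
    using uv unfolding von_Neumann_graph_def by blast
  have UL: "U \<in> L2_family \<mu>" using U(1) by (simp add: orth_compl_def)
  have cong: "(\<integral>x. a x * V x \<partial>\<mu> k) = (\<integral>x. b x * V x \<partial>\<mu> k)"
    if "a \<in> L2 (\<mu> k)" "b \<in> L2 (\<mu> k)" "V \<in> L2 (\<mu> k)" "AE x in \<mu> k. a x = b x" for a b V
    using that by (intro Bochner_Integration.integral_cong_AE borel_measurable_times) (auto dest: L2_D(1))
  have ipeq: "ip \<mu> (U(k := w)) V = ip \<mu> U V" if "V \<in> L2_family \<mu>" for V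
    unfolding ip_def
  proof (rule sum.cong[OF refl])
    fix i
    show "(\<integral>x. (U(k := w)) i x * V i x \<partial>\<mu> i) = (\<integral>x. U i x * V i x \<partial>\<mu> i)"
      using cong[of w u "V k"] w U(2) UL that by (cases "i = k") (auto simp: L2_family_def)
  qed
  have "v \<in> L2 (\<mu> k)" "u \<in> L2 (\<mu> k)" using von_Neumann_graph_L2[OF uv] by auto
  then have "(\<integral>x. (u x + v x) * W k x \<partial>\<mu> k) = (\<integral>x. (w x + z x) * W k x \<partial>\<mu> k)"
    if "W \<in> L2_family \<mu>" for W
  proof (intro cong L2_add)
    show "AE x in \<mu> k. u x + v x = w x + z x" using w(2) z(2) by eventually_elim simp
  qed (use w z that in \<open>auto simp: L2_family_def\<close>)
  then have eq: "ip \<mu> (U(k := w)) W = (\<integral>x. (w x + z x) * W k x \<partial>\<mu> k)" if "W \<in> orth_compl \<mu> X" for W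
    using U(3)[OF that] that ipeq[of W] by (simp add: orth_compl_def)
  have "U(k := w) \<in> orth_compl \<mu> X"
    using U(1) ipeq X w(1) unfolding orth_compl_def by (auto simp: L2_family_def)
  moreover have "(U(k := w)) k = w" by simp
  ultimately show ?thesis unfolding von_Neumann_graph_def using eq z(1) by blast
qed

text \<open>A symmetric operator A with 1 + A onto is self-adjoint. For (w, z) in the adjoint solve
  (1 + A) u = w + z, then (1 + A) u' = w - u. Moving 1 + A off u' turns the squared norm of w - u
  into the pairing of u' with (w + z) - (u + v), where v = A u, and this is 0.\<close>

theorem von_Neumann_self_adjoint:
  assumes X: "X \<subseteq> L2_family \<mu>" and dense: "dense_domain (\<mu> k) (von_Neumann_graph \<mu> X k)"
  shows "self_adjoint (\<mu> k) (von_Neumann_graph \<mu> X k)"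
proof -
  have "(w, z) \<in> von_Neumann_graph \<mu> X k" if adj: "(w, z) \<in> adjoint_graph (\<mu> k) (von_Neumann_graph \<mu> X k)" for w z
  proof -
    have w: "w \<in> L2 (\<mu> k)" and z: "z \<in> L2 (\<mu> k)"
      and wz: "\<And>u v. (u, v) \<in> von_Neumann_graph \<mu> X k \<Longrightarrow> (\<integral>x. v x * w x \<partial>\<mu> k) = (\<integral>x. u x * z x \<partial>\<mu> k)"
      using adj by (auto simp: adjoint_graph_def)
    obtain u v where uv: "(u, v) \<in> von_Neumann_graph \<mu> X k" "\<And>x. u x + v x = w x + z x"
      using von_Neumann_graph_surj[OF X L2_add[OF w z]] by metis
    have u: "u \<in> L2 (\<mu> k)" and v: "v \<in> L2 (\<mu> k)" using von_Neumann_graph_L2[OF uv(1)] by auto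
    obtain u' v' where u'v': "(u', v') \<in> von_Neumann_graph \<mu> X k" "\<And>x. u' x + v' x = w x - u x"
      using von_Neumann_graph_surj[OF X L2_diff[OF w u]] by metis
    have u': "u' \<in> L2 (\<mu> k)" and v': "v' \<in> L2 (\<mu> k)" using von_Neumann_graph_L2[OF u'v'(1)] by auto
    have "(\<integral>x. (w x - u x)\<^sup>2 \<partial>\<mu> k) = (\<integral>x. u' x * w x + v' x * w x - u' x * u x - v' x * u x \<partial>\<mu> k)"
    proof (intro Bochner_Integration.integral_cong refl)
      fix x
      have "(w x - u x)\<^sup>2 = (u' x + v' x) * (w x - u x)" by (simp add: u'v'(2) power2_eq_square)
      then show "(w x - u x)\<^sup>2 = u' x * w x + v' x * w x - u' x * u x - v' x * u x"
        by (simp add: algebra_simps)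
    qed
    also have "\<dots> = (\<integral>x. u' x * w x \<partial>\<mu> k) + (\<integral>x. v' x * w x \<partial>\<mu> k) - (\<integral>x. u' x * u x \<partial>\<mu> k) - (\<integral>x. v' x * u x \<partial>\<mu> k)"
      using w u u' v' by (simp add: L2_mult_integrable)
    also have "(\<integral>x. v' x * w x \<partial>\<mu> k) = (\<integral>x. u' x * z x \<partial>\<mu> k)" by (rule wz[OF u'v'(1)])
    also have "(\<integral>x. v' x * u x \<partial>\<mu> k) = (\<integral>x. u' x * v x \<partial>\<mu> k)" by (rule von_Neumann_graph_symmetric[OF u'v'(1) uv(1)])
    also have "(\<integral>x. u' x * w x \<partial>\<mu> k) + (\<integral>x. u' x * z x \<partial>\<mu> k) - (\<integral>x. u' x * u x \<partial>\<mu> k) - (\<integral>x. u' x * v x \<partial>\<mu> k)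
        = (\<integral>x. u' x * w x + u' x * z x - u' x * u x - u' x * v x \<partial>\<mu> k)"
      using w z u v u' by (simp add: L2_mult_integrable)
    also have "\<dots> = (\<integral>x. 0 \<partial>\<mu> k)"
    proof (intro Bochner_Integration.integral_cong refl)
      fix x
      have "u' x * w x + u' x * z x - u' x * u x - u' x * v x = u' x * ((w x + z x) - (u x + v x))"
        by (simp add: algebra_simps)
      then show "u' x * w x + u' x * z x - u' x * u x - u' x * v x = 0" using uv(2)[of x] by simp
    qed
    finally have "AE x in \<mu> k. w x - u x = 0"
      using L2_square_zero_AE[OF L2_diff[OF w u]] by simp
    then have AE: "AE x in \<mu> k. w x = u x" by simp
    then have "AE x in \<mu> k. z x = v x"
    proof eventually_elim
      fix x assume "w x = u x" then show "z x = v x" using uv(2)[of x] by simp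
    qed
    then show ?thesis by (rule von_Neumann_graph_AE[OF X uv(1) w AE z])
  qed
  moreover have "von_Neumann_graph \<mu> X k \<subseteq> adjoint_graph (\<mu> k) (von_Neumann_graph \<mu> X k)"
    unfolding adjoint_graph_def using von_Neumann_graph_L2 von_Neumann_graph_symmetric by blast
  ultimately show ?thesis
    unfolding self_adjoint_def using dense by auto
qed

subsection \<open>Local integrability and translations\<close>

definition local_integrable :: "(real^'n::finite \<Rightarrow> real) \<Rightarrow> bool" where
  "local_integrable h \<longleftrightarrow> h \<in> borel_measurable borel \<and>
     (\<forall>r. integrable lborel (\<lambda>x. indicator (cball 0 r) x * h x))"

lemma local_integrable_smooth:
  assumes "u \<in> smooth_functions" shows "local_integrable u"
  using borel_integrable_compact[OF compact_cball smooth_continuous[OF assms]] smooth_measurable[OF assms]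
  by (simp add: local_integrable_def)

lemma local_integrable_times_bounded:
  assumes h: "local_integrable h" and [measurable]: "g \<in> borel_measurable borel"
    and b: "\<And>x. \<bar>g x\<bar> \<le> b" and r: "\<And>x. norm x > r \<Longrightarrow> g x = 0"
  shows "integrable lborel (\<lambda>x. h x * g x)"
proof (rule Bochner_Integration.integrable_bound)
  have [measurable]: "h \<in> borel_measurable borel" using h by (simp add: local_integrable_def)
  show "integrable lborel (\<lambda>x. b * (indicator (cball 0 r) x * h x))"
    using h by (simp add: local_integrable_def)
  show "(\<lambda>x. h x * g x) \<in> borel_measurable lborel" by measurable
  have "norm (h x * g x) \<le> norm (b * (indicator (cball 0 r) x * h x))" for x
  proof (cases "norm x \<le> r")
    case True
    have "\<bar>h x\<bar> * \<bar>g x\<bar> \<le> \<bar>h x\<bar> * \<bar>b\<bar>"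
      using b[of x] by (intro mult_left_mono) auto
    then show ?thesis using True by (simp add: abs_mult mult.commute)
  qed (use r in auto)
  then show "AE x in lborel. norm (h x * g x) \<le> norm (b * (indicator (cball 0 r) x * h x))" by simp
qed

lemma local_integrable_times_test:
  assumes "local_integrable h" "g \<in> test_functions"
  shows "integrable lborel (\<lambda>x. h x * g x)"
proof -
  obtain b where "\<And>x. \<bar>g x\<bar> \<le> b" using test_bounded[OF assms(2)] by metis
  moreover obtain r where "\<And>x. norm x > r \<Longrightarrow> g x = 0" using test_vanish[OF assms(2)] by metis
  ultimately show ?thesis
    using local_integrable_times_bounded[OF assms(1) smooth_measurable[OF test_smooth[OF assms(2)]]] by blast
qed

lemma test_integrable:
  assumes "g \<in> test_functions" shows "integrable lborel g"
  using local_integrable_times_test[OF local_integrable_smooth[OF smooth_const[of 1]] assms] by simp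

lemma local_integrable_times_smooth:
  assumes h: "local_integrable h" and g: "g \<in> smooth_functions"
  shows "local_integrable (\<lambda>x. h x * g x)"
proof -
  have [measurable]: "h \<in> borel_measurable borel" "g \<in> borel_measurable borel"
    using h smooth_measurable[OF g] by (auto simp: local_integrable_def)
  have "integrable lborel (\<lambda>x. indicator (cball 0 r) x * (h x * g x))" for r
  proof -
    obtain b where b: "b > 0" "\<And>x. norm x \<le> r \<Longrightarrow> \<bar>g x\<bar> \<le> b"
      using smooth_bounded_on_cball[OF g] by metis
    have "integrable lborel (\<lambda>x. h x * (indicator (cball 0 r) x * g x))"
      by (rule local_integrable_times_bounded[OF h, of _ b r]) (use b in \<open>auto simp: indicator_def\<close>)
    then show ?thesis by (simp add: mult.left_commute)
  qed
  then show ?thesis by (simp add: local_integrable_def)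
qed

abbreviation weighted :: "(real^'n::finite \<Rightarrow> real) \<Rightarrow> (real^'n) measure" where
  "weighted s \<equiv> density lborel (\<lambda>x. ennreal (s x))"

text \<open>Pointwise 2 |u| <= s u^2 + 1/s, where the first term is integrable and 1/s is bounded on
  balls because \<open>s\<close> is continuous and positive.\<close>

lemma L2_density_local_integrable:
  assumes u: "u \<in> L2 (weighted s)"
    and s: "s \<in> smooth_functions" "\<And>x. s x > 0"
  shows "local_integrable u"
proof -
  have [measurable]: "u \<in> borel_measurable borel" "s \<in> borel_measurable borel"
    using u smooth_measurable[OF s(1)] by (auto simp: L2_def)
  have int: "integrable lborel (\<lambda>x. s x * (u x)\<^sup>2)"
    using L2_D(2)[OF u] s(2) by (subst (asm) integrable_density) (auto intro: less_imp_le)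
  have "integrable lborel (\<lambda>x. indicator (cball 0 r) x * u x)" for r
  proof (rule Bochner_Integration.integrable_bound)
    show "integrable lborel (\<lambda>x. s x * (u x)\<^sup>2 + indicator (cball 0 r) x * (1 / s x))"
      using int local_integrable_smooth[OF smooth_inverse[OF s]]
      by (intro Bochner_Integration.integrable_add) (auto simp: local_integrable_def)
    have "\<bar>u x\<bar> \<le> s x * (u x)\<^sup>2 + 1 / s x" for x
    proof -
      have "0 \<le> (s x * \<bar>u x\<bar> - 1)\<^sup>2" by simp
      then have "2 * (s x * \<bar>u x\<bar>) \<le> (s x)\<^sup>2 * (u x)\<^sup>2 + 1"
        by (simp add: power2_diff power_mult_distrib)
      moreover have "0 \<le> s x * \<bar>u x\<bar>" using s(2)[of x] by simp
      ultimately have "s x * \<bar>u x\<bar> \<le> (s x)\<^sup>2 * (u x)\<^sup>2 + 1" by linarith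
      then have "s x * \<bar>u x\<bar> \<le> s x * (s x * (u x)\<^sup>2 + 1 / s x)"
        using s(2)[of x] by (simp add: algebra_simps power2_eq_square)
      then show ?thesis using s(2)[of x] by simp
    qed
    then have "norm (indicator (cball 0 r) x * u x) \<le> norm (s x * (u x)\<^sup>2 + indicator (cball 0 r) x * (1 / s x))" for x
      using s(2)[of x] by (cases "x \<in> cball 0 r") (auto simp: order_trans[OF _ abs_ge_self])
    then show "AE x in lborel. norm (indicator (cball 0 r) x * u x) \<le> norm (s x * (u x)\<^sup>2 + indicator (cball 0 r) x * (1 / s x))"
      by simp
  qed (auto intro!: borel_measurable_times borel_measurable_indicator)
  then show ?thesis by (simp add: local_integrable_def)
qed

lemma lborel_integral_translate:
  fixes f :: "real^'n::finite \<Rightarrow> real"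
  assumes [measurable]: "f \<in> borel_measurable borel"
  shows "(LBINT x. f (x + c)) = (LBINT x. f x)"
proof -
  have "(LBINT x. f x) = (\<integral>x. f x \<partial>distr lborel borel ((+) c))"
    by (simp add: lborel_distr_plus)
  also have "\<dots> = (LBINT x. f (c + x))"
    by (subst integral_distr) auto
  finally show ?thesis by (simp add: add.commute)
qed

lemma lborel_integrable_translate:
  fixes f :: "real^'n::finite \<Rightarrow> real"
  assumes f: "integrable lborel f"
  shows "integrable lborel (\<lambda>x. f (x + c))"
proof -
  have "integrable (distr lborel borel ((+) c)) f" using f by (simp add: lborel_distr_plus)
  then have "integrable lborel (\<lambda>x. f (c + x))"
    by (subst (asm) integrable_distr_eq) (use f in auto)
  then show ?thesis by (simp add: add.commute)
qed

lemma local_integrable_translate: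
  assumes h: "local_integrable h" shows "local_integrable (\<lambda>x. h (x + c))"
proof -
  have [measurable]: "h \<in> borel_measurable borel" using h by (simp add: local_integrable_def)
  have "integrable lborel (\<lambda>x. indicator (cball 0 r) x * h (x + c))" for r
  proof -
    have "integrable lborel (\<lambda>x. h x * indicator (cball 0 r) (x - c))"
    proof (rule local_integrable_times_bounded[OF h, of _ 1 "r + norm c"])
      fix x :: "real^'a" assume "norm x > r + norm c"
      then have "norm (x - c) > r" using norm_triangle_ineq2[of x c] by simp
      then show "indicator (cball 0 r) (x - c) = (0::real)" by simp
    qed (auto simp: indicator_def)
    from lborel_integrable_translate[OF this, of c] show ?thesis by (simp add: mult.commute)
  qed
  then show ?thesis by (simp add: local_integrable_def)
qed

section \<open>Differentiation along translations and integration by parts\<close>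

text \<open>The translation acts on the test function, so \<open>h\<close> is never differentiated.
  The difference quotients are bounded and supported in a common ball, and dominated convergence
  applies.\<close>

lemma translation_derivative:
  fixes a :: "real^'n::finite"
  assumes h: "local_integrable h" and \<phi>: "\<phi> \<in> test_functions"
  shows "((\<lambda>t. LBINT x. h x * \<phi> (x + t *\<^sub>R a)) has_real_derivative
    (LBINT x. h x * (\<Sum>i\<in>UNIV. a $ i * pd i \<phi> (x + t *\<^sub>R a)))) (at t)"
proof -
  \<comment> \<open>The time 0 suffices: any other time is reached by replacing the test function by
    a translate of it.\<close>
  have main: "((\<lambda>t. LBINT x. h x * \<phi> (x + t *\<^sub>R a)) has_real_derivative
    (LBINT x. h x * (\<Sum>i\<in>UNIV. a $ i * pd i \<phi> x))) (at 0)"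
    if \<phi>: "\<phi> \<in> test_functions" for \<phi>
  proof -
    have \<phi>s: "\<phi> \<in> smooth_functions" using \<phi> by (rule test_smooth)
    define g where "g x = (\<Sum>i\<in>UNIV. a $ i * pd i \<phi> x)" for x
    have g: "g \<in> test_functions"
      unfolding g_def[abs_def] using \<phi> by (intro test_sum test_mult_smooth test_pd smooth_const)
    have [measurable]: "h \<in> borel_measurable borel" "\<phi> \<in> borel_measurable borel" "g \<in> borel_measurable borel"
      using h smooth_measurable[OF \<phi>s] smooth_measurable[OF test_smooth[OF g]]
      by (auto simp: local_integrable_def)
    obtain B where B: "\<And>x. \<bar>g x\<bar> \<le> B" using test_bounded[OF g] by metis
    obtain r where r: "r > 0" "\<And>x. norm x > r \<Longrightarrow> \<phi> x = 0" using test_vanish[OF \<phi>] by metis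
    have D: "((\<lambda>t. \<phi> (x + t *\<^sub>R a)) has_real_derivative g (x + t *\<^sub>R a)) (at t)" for x t
    proof -
      have "((\<lambda>t. x + t *\<^sub>R a) has_derivative (\<lambda>s. s *\<^sub>R a)) (at t)"
        by (auto intro!: derivative_eq_intros)
      from has_derivative_compose[OF this smooth_has_derivative[OF \<phi>s]]
      have "((\<lambda>t. \<phi> (x + t *\<^sub>R a)) has_derivative (\<lambda>s. s * g (x + t *\<^sub>R a))) (at t)"
        by (simp add: g_def sum_distrib_left mult.assoc)
      then show ?thesis by (simp add: has_field_derivative_def mult_commute_abs)
    qed
    have lip: "\<bar>\<phi> (x + t *\<^sub>R a) - \<phi> x\<bar> \<le> B * \<bar>t\<bar>" for x t
    proof -
      have "norm (\<phi> (x + t *\<^sub>R a) - \<phi> (x + 0 *\<^sub>R a)) \<le> B * norm (t - 0)"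
        by (rule field_differentiable_bound[of UNIV "\<lambda>t. \<phi> (x + t *\<^sub>R a)" "\<lambda>t. g (x + t *\<^sub>R a)"])
          (use D B in auto)
      then show ?thesis by simp
    qed
    let ?q = "\<lambda>t x. h x * ((\<phi> (x + t *\<^sub>R a) - \<phi> x) / t)"
    \<comment> \<open>Times in [-1, 1] keep the supports of all translates in the ball of radius r +
      |a|, which yields one majorant for every sequence of times.\<close>
    have "((\<lambda>t. LBINT x. ?q t x) \<longlongrightarrow> (LBINT x. h x * g x)) (at 0 within {-1..1})"
      unfolding tendsto_at_iff_sequentially
    proof (intro allI impI)
      fix X :: "nat \<Rightarrow> real"
      assume X: "\<forall>i. X i \<in> {-1..1} - {0}" and X0: "X \<longlonglongrightarrow> 0"
      have "(\<lambda>n. \<integral>x. ?q (X n) x \<partial>lborel) \<longlonglongrightarrow> (LBINT x. h x * g x)"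
      proof (rule integral_dominated_convergence)
        show "integrable lborel (\<lambda>x. \<bar>h x * (B * indicator (cball 0 (r + norm a)) x)\<bar>)"
          using h by (intro integrable_abs local_integrable_times_bounded[where b = "\<bar>B\<bar>" and r = "r + norm a"])
            (auto simp: indicator_def)
        show "AE x in lborel. (\<lambda>n. ?q (X n) x) \<longlonglongrightarrow> h x * g x"
        proof (intro AE_I2 tendsto_mult tendsto_const)
          fix x
          have "((\<lambda>t. (\<phi> (x + t *\<^sub>R a) - \<phi> x) / t) \<longlongrightarrow> g x) (at 0)"
            using D[of x 0] unfolding DERIV_def by simp
          then show "(\<lambda>n. (\<phi> (x + X n *\<^sub>R a) - \<phi> x) / X n) \<longlonglongrightarrow> g x"
            unfolding tendsto_at_iff_sequentially comp_def using X X0 by blast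
        qed
        show "AE x in lborel. norm (?q (X n) x) \<le> \<bar>h x * (B * indicator (cball 0 (r + norm a)) x)\<bar>" for n
        proof (intro AE_I2)
          fix x
          have Xn: "X n \<noteq> 0" "\<bar>X n\<bar> \<le> 1" using X[rule_format, of n] by (auto simp: abs_le_iff)
          show "norm (?q (X n) x) \<le> \<bar>h x * (B * indicator (cball 0 (r + norm a)) x)\<bar>"
          proof (cases "norm x \<le> r + norm a")
            case True
            have "\<bar>(\<phi> (x + X n *\<^sub>R a) - \<phi> x) / X n\<bar> \<le> \<bar>B\<bar>"
              using lip[of x "X n"] Xn B[of 0] by (simp add: divide_le_eq)
            then have "\<bar>h x\<bar> * \<bar>(\<phi> (x + X n *\<^sub>R a) - \<phi> x) / X n\<bar> \<le> \<bar>h x\<bar> * (\<bar>B\<bar> * \<bar>indicator (cball 0 (r + norm a)) x\<bar>)"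
              using True by (intro mult_left_mono) auto
            then show ?thesis unfolding real_norm_def abs_mult .
          next
            case False
            have "norm (X n *\<^sub>R a) \<le> norm a" using Xn by (simp add: mult_left_le_one_le)
            then have "norm (x + X n *\<^sub>R a) > r" using False norm_diff_ineq[of x "X n *\<^sub>R a"] by linarith
            moreover have "norm x > r" using False norm_ge_zero[of a] by linarith
            ultimately show ?thesis using r(2) by simp
          qed
        qed
      qed measurable
      then show "((\<lambda>t. LBINT x. ?q t x) \<circ> X) \<longlonglongrightarrow> (LBINT x. h x * g x)"
        by (simp add: comp_def)
    qed
    moreover have "at 0 within {-1..1} = at (0::real)"
      by (rule at_within_interior) simp
    moreover have "(LBINT x. ?q t x) = ((LBINT x. h x * \<phi> (x + (0 + t) *\<^sub>R a)) - (LBINT x. h x * \<phi> (x + 0 *\<^sub>R a))) / t" for t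
    proof -
      have "(LBINT x. ?q t x) = (LBINT x. (h x * \<phi> (x + t *\<^sub>R a) - h x * \<phi> x) / t)"
        by (intro Bochner_Integration.integral_cong refl) (simp add: right_diff_distrib)
      also have "\<dots> = (LBINT x. h x * \<phi> (x + t *\<^sub>R a) - h x * \<phi> x) / t"
        by (rule integral_divide_zero)
      also have "\<dots> = ((LBINT x. h x * \<phi> (x + t *\<^sub>R a)) - (LBINT x. h x * \<phi> x)) / t"
        using local_integrable_times_test[OF h test_translate[OF \<phi>]] local_integrable_times_test[OF h \<phi>]
        by (subst Bochner_Integration.integral_diff) auto
      finally show ?thesis by simp
    qed
    ultimately show ?thesis unfolding DERIV_def g_def[symmetric] by (simp only:)
  qed
  have "((\<lambda>s. \<integral>x. h x * \<phi> (x + s *\<^sub>R a + t *\<^sub>R a) \<partial>lborel) has_real_derivative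
      (LBINT x. h x * (\<Sum>i\<in>UNIV. a $ i * pd i \<phi> (x + t *\<^sub>R a)))) (at 0)"
    using main[OF test_translate[OF \<phi>, of "t *\<^sub>R a"]] pd_translate[OF test_smooth[OF \<phi>]] by simp
  then have "((\<lambda>s. \<integral>x. h x * \<phi> (x + (s + t) *\<^sub>R a) \<partial>lborel) has_real_derivative
      (LBINT x. h x * (\<Sum>i\<in>UNIV. a $ i * pd i \<phi> (x + t *\<^sub>R a)))) (at 0)"
    by (simp add: scaleR_add_left add.assoc)
  then show ?thesis using DERIV_shift[of "\<lambda>t. \<integral>x. h x * \<phi> (x + t *\<^sub>R a) \<partial>lborel" _ 0 t] by (simp add: add.commute)
qed

text \<open>The integral of a translate is constant in the time by invariance of Lebesgue measure;
  its derivative at 0 is the integral in question.\<close>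

lemma integral_pd_test:
  assumes "\<phi> \<in> test_functions"
  shows "(LBINT x. pd i \<phi> x) = 0"
proof -
  have eq: "(LBINT x. \<phi> (x + t *\<^sub>R axis i 1)) = (LBINT x. \<phi> x)" for t
    by (rule lborel_integral_translate) (rule smooth_measurable[OF test_smooth[OF assms]])
  have "((\<lambda>t. LBINT x. \<phi> (x + t *\<^sub>R axis i 1)) has_real_derivative (LBINT x. pd i \<phi> x)) (at 0)"
    using translation_derivative[OF local_integrable_smooth[OF smooth_const[of 1]] assms, of "axis i 1" 0]
    by simp
  then show ?thesis
    unfolding eq using DERIV_unique DERIV_const by blast
qed

lemma integration_by_parts:
  assumes "u \<in> smooth_functions" "v \<in> smooth_functions" "(\<lambda>x. u x * v x) \<in> test_functions"
    and "(\<lambda>x. pd i u x * v x) \<in> test_functions" "(\<lambda>x. u x * pd i v x) \<in> test_functions"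
  shows "(LBINT x. pd i u x * v x) = - (LBINT x. u x * pd i v x)"
  using integral_pd_test[OF assms(3), of i] test_integrable[OF assms(4)] test_integrable[OF assms(5)]
  by (simp add: pd_mult[OF assms(1,2)])

lemma integration_by_parts_test:
  assumes "u \<in> smooth_functions" "v \<in> test_functions"
  shows "(LBINT x. pd i u x * v x) = - (LBINT x. u x * pd i v x)"
  by (rule integration_by_parts) (use assms test_smooth in auto)

section \<open>Functions determined by their integrals against test functions\<close>

text \<open>\<open>ennreal\<close> truncates at 0, so \<open>ennreal (h x)\<close> and
  \<open>ennreal (- h x)\<close> are the positive and negative parts. The measures with these
  densities agree on the boxes, an intersection-stable generator, hence everywhere; and equal parts
  are both 0.\<close>

lemma AE_zero_if_box_integrals_zero:
  assumes h: "local_integrable h"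
    and zero: "\<And>a b. (LBINT x. h x * indicator (box a b) x) = 0"
  shows "AE x in lborel. h x = 0"
proof -
  have [measurable]: "h \<in> borel_measurable borel" using h by (simp add: local_integrable_def)
  have int: "integrable lborel (\<lambda>x. h x * indicator (box a b) x)" for a b :: "real^'a"
  proof -
    obtain r where r: "box a b \<subseteq> cball 0 r"
      using bounded_box[of a b] unfolding bounded_iff by (auto simp: subset_iff)
    show ?thesis
      by (rule local_integrable_times_bounded[OF h, of _ 1 r]) (use r in \<open>auto simp: indicator_def\<close>)
  qed
  have fin: "(\<integral>\<^sup>+x. ennreal (h x * indicator (box a b) x) \<partial>lborel) \<noteq> \<infinity>"
     "(\<integral>\<^sup>+x. ennreal (- (h x * indicator (box a b) x)) \<partial>lborel) \<noteq> \<infinity>" for a b :: "real^'a"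
    using int[of a b] unfolding real_integrable_def by auto
  have eq: "(\<integral>\<^sup>+x. ennreal (h x * indicator (box a b) x) \<partial>lborel)
      = (\<integral>\<^sup>+x. ennreal (- (h x * indicator (box a b) x)) \<partial>lborel)" for a b :: "real^'a"
  proof -
    have "enn2real (\<integral>\<^sup>+x. ennreal (h x * indicator (box a b) x) \<partial>lborel)
        = enn2real (\<integral>\<^sup>+x. ennreal (- (h x * indicator (box a b) x)) \<partial>lborel)"
      using real_lebesgue_integral_def[OF int[of a b]] zero[of a b] by simp
    moreover have "c = d" if "enn2real c = enn2real d" "c \<noteq> \<infinity>" "d \<noteq> \<infinity>" for c d
    proof -
      have "c = ennreal (enn2real c)" using that(2) by (simp add: less_top)
      also have "\<dots> = ennreal (enn2real d)" using that(1) by simp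
      also have "\<dots> = d" using that(3) by (simp add: less_top)
      finally show ?thesis .
    qed
    ultimately show ?thesis using fin[of a b] by blast
  qed
  have ind: "ennreal (c * indicator (box a b) x) = ennreal c * indicator (box a b) x" for c and a b x :: "real^'a"
    by (simp add: indicator_def)
  have em: "emeasure (density lborel (\<lambda>x. ennreal (h x))) (box a b) = (\<integral>\<^sup>+x. ennreal (h x * indicator (box a b) x) \<partial>lborel)"
    "emeasure (density lborel (\<lambda>x. ennreal (- h x))) (box a b) = (\<integral>\<^sup>+x. ennreal (- (h x * indicator (box a b) x)) \<partial>lborel)" for a b :: "real^'a"
    using ind[of "- h _" a b] by (simp_all add: emeasure_density ind)
  have "density lborel (\<lambda>x. ennreal (h x)) = density lborel (\<lambda>x. ennreal (- h x))"
  proof (rule measure_eqI_generator_eq)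
    let ?E = "range (\<lambda>(a, b). box a b :: (real^'a) set)"
    show "Int_stable ?E" by (auto simp: Int_stable_def box_Int_box)
    show "?E \<subseteq> Pow UNIV" "sets (density lborel (\<lambda>x. ennreal (h x))) = sigma_sets UNIV ?E"
      "sets (density lborel (\<lambda>x. ennreal (- h x))) = sigma_sets UNIV ?E"
      by (simp_all add: borel_eq_box)
    let ?A = "\<lambda>n::nat. box (- (real n *\<^sub>R One)) (real n *\<^sub>R One) :: (real^'a) set"
    show "range ?A \<subseteq> ?E" "(\<Union>i. ?A i) = UNIV" unfolding UN_box_eq_UNIV by auto
    show "emeasure (density lborel (\<lambda>x. ennreal (h x))) (?A i) \<noteq> \<infinity>" for i
      using fin(1) by (simp add: em)
    show "emeasure (density lborel (\<lambda>x. ennreal (h x))) X = emeasure (density lborel (\<lambda>x. ennreal (- h x))) X"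
      if "X \<in> ?E" for X
      using that eq by (auto simp: em)
  qed
  then have "AE x in lborel. ennreal (h x) = ennreal (- h x)"
    by (intro sigma_finite_measure.density_unique[OF sigma_finite_lborel]) auto
  then show ?thesis
  proof eventually_elim
    fix x assume "ennreal (h x) = ennreal (- h x)"
    then show "h x = 0"
      by (cases "h x \<ge> 0") (auto simp: ennreal_neg ennreal_eq_0_iff)
  qed
qed

text \<open>Dominated convergence passes from bumps to indicators of boxes. Restricting the
  hypothesis to bumps makes the lemma applicable when only squares of test functions are under
  control.\<close>

lemma AE_zero_if_bump_integrals_zero:
  assumes h: "local_integrable h"
    and zero: "\<And>a b n. (LBINT x. h x * bump (real (Suc n)) a b x) = 0"
  shows "AE x in lborel. h x = 0"
proof (rule AE_zero_if_box_integrals_zero[OF h])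
  fix a b :: "real^'a"
  have [measurable]: "h \<in> borel_measurable borel" "\<And>s. bump s a b \<in> borel_measurable borel"
    using h smooth_measurable[OF bump_smooth] by (auto simp: local_integrable_def)
  obtain r where r: "box a b \<subseteq> cball 0 r"
    using bounded_box[of a b] unfolding bounded_iff by (auto simp: subset_iff)
  have int: "integrable lborel (\<lambda>x. h x * indicator (box a b) x)"
    by (rule local_integrable_times_bounded[OF h, of _ 1 r]) (use r in \<open>auto simp: indicator_def\<close>)
  have "(\<lambda>n. \<integral>x. h x * bump (real (Suc n)) a b x \<partial>lborel) \<longlonglongrightarrow> (LBINT x. h x * indicator (box a b) x)"
  proof (rule integral_dominated_convergence)
    show "integrable lborel (\<lambda>x. \<bar>h x * indicator (box a b) x\<bar>)" using int by (rule integrable_abs)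
    show "AE x in lborel. (\<lambda>n. h x * bump (real (Suc n)) a b x) \<longlonglongrightarrow> h x * indicator (box a b) x"
      by (intro AE_I2 tendsto_mult tendsto_const bump_tendsto)
    show "AE x in lborel. norm (h x * bump (real (Suc n)) a b x) \<le> \<bar>h x * indicator (box a b) x\<bar>" for n
    proof (intro AE_I2)
      fix x
      show "norm (h x * bump (real (Suc n)) a b x) \<le> \<bar>h x * indicator (box a b) x\<bar>"
        using bump_range[of "real (Suc n)" a b x] bump_eq_0[of "real (Suc n)" x a b]
        by (cases "x \<in> box a b") (auto simp: abs_mult mult_left_le simp del: of_nat_Suc)
    qed
  qed measurable
  then show "(LBINT x. h x * indicator (box a b) x) = 0"
    unfolding zero using LIMSEQ_unique tendsto_const by blast
qed

lemma AE_zero_if_test_integrals_zero: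
  assumes "local_integrable h" "\<And>\<phi>. \<phi> \<in> test_functions \<Longrightarrow> (LBINT x. h x * \<phi> x) = 0"
  shows "AE x in lborel. h x = 0"
  using assms(1) by (rule AE_zero_if_bump_integrals_zero) (intro assms(2) bump_test; simp)

lemma continuous_AE_zero:
  fixes h :: "real^'n::finite \<Rightarrow> real"
  assumes "continuous_on UNIV h" "AE x in lborel. h x = 0"
  shows "h x = 0"
proof (rule ccontr)
  assume "h x \<noteq> 0"
  have op: "open {x. h x \<noteq> 0}"
    using open_Collect_neq[OF assms(1) continuous_on_const[of UNIV 0]] .
  have "{x. h x \<noteq> 0} \<in> null_sets lborel"
    using assms(2) op by (subst AE_iff_null_sets) auto
  then have "negligible {x. h x \<noteq> 0}"
    using negligible_iff_null_sets null_sets_completionI by blast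
  then show False using open_not_negligible[OF op] \<open>h x \<noteq> 0\<close> by blast
qed

lemma lborel_distr_reflect:
  "distr lborel borel (\<lambda>x. c - x) = (lborel :: (real^'n::finite) measure)"
  using lborel_affine[of "-1" c] by (simp add: density_1)

text \<open>A locally integrable function with vanishing weak gradient is invariant under translations up
  to null sets, and Fubini's theorem then produces a base point.\<close>

lemma weak_gradient_zero_const:
  fixes h :: "real^'n::finite \<Rightarrow> real"
  assumes h: "local_integrable h"
    and weak: "\<And>i \<eta>. \<eta> \<in> test_functions \<Longrightarrow> (LBINT x. h x * pd i \<eta> x) = 0"
  obtains c where "AE x in lborel. h x = c"
proof -
  have [measurable]: "h \<in> borel_measurable borel" using h by (simp add: local_integrable_def)
  have trans: "AE x in lborel. h (x - a) = h x" for a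
  proof -
    have h': "local_integrable (\<lambda>x. h (x - a))" using local_integrable_translate[OF h, of "- a"] by simp
    have hh: "local_integrable (\<lambda>x. h (x - a) - h x)"
      using h h' by (auto simp: local_integrable_def right_diff_distrib)
    have "AE x in lborel. h (x - a) - h x = 0"
    proof (rule AE_zero_if_test_integrals_zero[OF hh])
      fix \<phi> :: "real^'n \<Rightarrow> real" assume \<phi>: "\<phi> \<in> test_functions"
      have [measurable]: "\<phi> \<in> borel_measurable borel" using smooth_measurable[OF test_smooth[OF \<phi>]] .
      let ?A = "\<lambda>t. \<integral>x. h x * \<phi> (x + t *\<^sub>R a) \<partial>lborel"
      have "(LBINT x. h x * (\<Sum>i\<in>UNIV. a $ i * pd i \<phi> (x + t *\<^sub>R a))) = 0" for t
      proof -
        have 0: "(LBINT x. h x * pd i \<phi> (x + t *\<^sub>R a)) = 0" for i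
          using weak[OF test_translate[OF \<phi>, of "t *\<^sub>R a"], of i] pd_translate[OF test_smooth[OF \<phi>]] by simp
        have int: "integrable lborel (\<lambda>x. h x * pd i \<phi> (x + t *\<^sub>R a))" for i
          by (intro local_integrable_times_test[OF h] test_translate test_pd \<phi>)
        have "(LBINT x. h x * (\<Sum>i\<in>UNIV. a $ i * pd i \<phi> (x + t *\<^sub>R a)))
            = (LBINT x. (\<Sum>i\<in>UNIV. a $ i * (h x * pd i \<phi> (x + t *\<^sub>R a))))"
          by (simp add: sum_distrib_left mult.left_commute)
        also have "\<dots> = (\<Sum>i\<in>UNIV. a $ i * (LBINT x. h x * pd i \<phi> (x + t *\<^sub>R a)))"
          using int by (subst Bochner_Integration.integral_sum) auto
        finally show ?thesis by (simp add: 0)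
      qed
      then have "(?A has_real_derivative 0) (at t)" for t
        using translation_derivative[OF h \<phi>, of a t] by simp
      then have "?A 1 = ?A 0" by (rule DERIV_isconst_all[OF allI])
      moreover have "(LBINT x. h (x - a) * \<phi> x) = ?A 1"
        using lborel_integral_translate[of "\<lambda>x. h (x - a) * \<phi> x" a] by simp
      ultimately show "(LBINT x. (h (x - a) - h x) * \<phi> x) = 0"
        using local_integrable_times_test[OF h \<phi>] local_integrable_times_test[OF h' \<phi>]
        by (simp add: left_diff_distrib)
    qed
    then show ?thesis by simp
  qed
  then have "AE a in lborel. AE x in lborel. h (x - a) = h x" by simp
  then have "AE x in lborel. AE a in lborel. h (x - a) = h x"
  proof (subst (asm) lborel_pair.AE_commute)
    show "{z \<in> space (lborel \<Otimes>\<^sub>M lborel). h (snd z - fst z) = h (snd z)} \<in> sets (lborel \<Otimes>\<^sub>M lborel)"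
      by (rule borel_measurable_eq) measurable
  qed
  moreover have "ae_filter (lborel :: (real^'n) measure) \<noteq> bot"
    by (simp add: ae_filter_eq_bot_iff)
  ultimately obtain x0 where x0: "AE a in lborel. h (x0 - a) = h x0"
    using eventually_happens' by blast
  \<comment> \<open>The reflection of \<open>a\<close> in the base point preserves null sets, so the
    statement about almost all shifts becomes one about almost all points.\<close>
  have "AE x in distr lborel borel (\<lambda>a. x0 - a). h x = h x0"
    using x0 by (subst AE_distr_iff) auto
  then have "AE x in lborel. h x = h x0"
    unfolding lborel_distr_reflect[of x0] .
  then show ?thesis using that by blast
qed

subsection \<open>Rotations\<close>

lemma lborel_nn_integral_translate:
  fixes f :: "real^'n::finite \<Rightarrow> ennreal"
  assumes [measurable]: "f \<in> borel_measurable borel"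
  shows "(\<integral>\<^sup>+x. f (x + c) \<partial>lborel) = (\<integral>\<^sup>+x. f x \<partial>lborel)"
proof -
  have "(\<integral>\<^sup>+x. f x \<partial>lborel) = (\<integral>\<^sup>+x. f x \<partial>distr lborel borel ((+) c))"
    by (simp add: lborel_distr_plus)
  also have "\<dots> = (\<integral>\<^sup>+x. f (c + x) \<partial>lborel)"
    by (subst nn_integral_distr) auto
  finally show ?thesis by (simp add: add.commute)
qed

lemma lborel_nn_integral_reflect:
  fixes f :: "real^'n::finite \<Rightarrow> ennreal"
  assumes [measurable]: "f \<in> borel_measurable borel"
  shows "(\<integral>\<^sup>+x. f (c - x) \<partial>lborel) = (\<integral>\<^sup>+x. f x \<partial>lborel)"
proof -
  have "(\<integral>\<^sup>+x. f x \<partial>lborel) = (\<integral>\<^sup>+x. f x \<partial>distr lborel borel (\<lambda>x. c - x))"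
    by (simp add: lborel_distr_reflect)
  also have "\<dots> = (\<integral>\<^sup>+x. f (c - x) \<partial>lborel)"
    by (subst nn_integral_distr) auto
  finally show ?thesis by simp
qed

text \<open>The library has this for well-ordered index types only. Fubini's theorem compares the two
  measures through their values on the unit ball.\<close>

lemma lborel_nn_integral_orthogonal:
  fixes R :: "real^'n::finite^'n" and f :: "real^'n \<Rightarrow> ennreal"
  assumes R: "orthogonal_matrix R" and [measurable]: "f \<in> borel_measurable borel"
  shows "(\<integral>\<^sup>+x. f (R *v x) \<partial>lborel) = (\<integral>\<^sup>+x. f x \<partial>lborel)"
proof -
  have [measurable]: "(\<lambda>x. R *v x) \<in> borel_measurable borel"
    by (intro borel_measurable_continuous_onI matrix_vector_mult_linear_continuous_on)
  define g :: "real^'n \<Rightarrow> ennreal" where "g = indicator (ball 0 1)"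
  have [measurable]: "g \<in> borel_measurable borel" unfolding g_def by (intro borel_measurable_indicator) simp
  have gR: "g (R *v x) = g x" for x by (simp add: g_def indicator_def norm_orthogonal_matrix[OF R])
  obtain R' where "R ** R' = mat 1" using R unfolding orthogonal_matrix_def by blast
  then have RR: "R *v (R' *v y) = y" for y by (simp add: matrix_vector_mul_assoc)
  define G where "G = (\<integral>\<^sup>+x. g x \<partial>lborel)"
  have "(\<integral>\<^sup>+x. f (R *v x) \<partial>lborel) * G = (\<integral>\<^sup>+x. (\<integral>\<^sup>+y. f (R *v x) * g y \<partial>lborel) \<partial>lborel)"
    unfolding G_def by (simp add: nn_integral_cmult nn_integral_multc)
  also have "\<dots> = (\<integral>\<^sup>+x. (\<integral>\<^sup>+y. f (R *v x) * g (y + R *v x) \<partial>lborel) \<partial>lborel)"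
    by (subst lborel_nn_integral_translate[of "\<lambda>y. f (R *v _) * g y"]) auto
  also have "\<dots> = (\<integral>\<^sup>+y. (\<integral>\<^sup>+x. f (R *v x) * g (y + R *v x) \<partial>lborel) \<partial>lborel)"
    by (rule lborel_pair.Fubini') measurable
  \<comment> \<open>Shifting \<open>x\<close> by the preimage of \<open>y\<close> under
    \<open>R\<close> turns the arguments into R x - y and R x, and \<open>g\<close>, the indicator
    of the unit ball, does not see the rotation.\<close>
  also have "\<dots> = (\<integral>\<^sup>+y. (\<integral>\<^sup>+x. f (R *v x - y) * g x \<partial>lborel) \<partial>lborel)"
  proof (rule nn_integral_cong)
    fix y
    have "(\<integral>\<^sup>+x. f (R *v x) * g (y + R *v x) \<partial>lborel)
        = (\<integral>\<^sup>+x. f (R *v (x + - (R' *v y))) * g (y + R *v (x + - (R' *v y))) \<partial>lborel)"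
      by (rule lborel_nn_integral_translate[symmetric]) measurable
    then show "(\<integral>\<^sup>+x. f (R *v x) * g (y + R *v x) \<partial>lborel) = (\<integral>\<^sup>+x. f (R *v x - y) * g x \<partial>lborel)"
      by (simp add: matrix_vector_mult_diff_distrib RR gR)
  qed
  also have "\<dots> = (\<integral>\<^sup>+x. (\<integral>\<^sup>+y. f (R *v x - y) * g x \<partial>lborel) \<partial>lborel)"
    by (rule lborel_pair.Fubini') measurable
  also have "\<dots> = (\<integral>\<^sup>+x. (\<integral>\<^sup>+y. f y \<partial>lborel) * g x \<partial>lborel)"
    by (simp add: nn_integral_multc lborel_nn_integral_reflect)
  also have "\<dots> = (\<integral>\<^sup>+x. f x \<partial>lborel) * G"
    unfolding G_def by (simp add: nn_integral_cmult)
  finally have eq: "(\<integral>\<^sup>+x. f (R *v x) \<partial>lborel) * G = (\<integral>\<^sup>+x. f x \<partial>lborel) * G" .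
  have "G = emeasure lborel (ball 0 1 :: (real^'n) set)" by (simp add: G_def g_def)
  then have "G \<noteq> 0" "G \<noteq> \<infinity>"
    using emeasure_lborel_ball_finite[of "0 :: real^'n" 1] content_ball_pos[of 1 "0 :: real^'n"]
    by (auto simp: measure_def)
  then show ?thesis using eq by (simp add: mult.commute[of _ G] ennreal_mult_cancel_left)
qed

lemma matrix_vector_mult_measurable [measurable]:
  "(\<lambda>x. (R :: real^'n::finite^'n) *v x) \<in> borel_measurable borel"
  by (intro borel_measurable_continuous_onI matrix_vector_mult_linear_continuous_on)

lemma lborel_distr_orthogonal:
  fixes R :: "real^'n::finite^'n"
  assumes "orthogonal_matrix R"
  shows "distr lborel borel ((*v) R) = lborel"
proof (rule measure_eqI)
  fix A assume "A \<in> sets (distr lborel borel ((*v) R))"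
  then have [measurable]: "A \<in> sets borel" by simp
  have "emeasure (distr lborel borel ((*v) R)) A = (\<integral>\<^sup>+y. indicator A y \<partial>distr lborel borel ((*v) R))"
    by simp
  also have "\<dots> = (\<integral>\<^sup>+x. indicator A (R *v x) \<partial>lborel)"
    by (rule nn_integral_distr) measurable
  also have "\<dots> = (\<integral>\<^sup>+x. indicator A x \<partial>lborel)"
    by (rule lborel_nn_integral_orthogonal[OF assms]) measurable
  finally show "emeasure (distr lborel borel ((*v) R)) A = emeasure lborel A" by simp
qed simp

lemma lborel_integral_orthogonal:
  fixes R :: "real^'n::finite^'n" and g :: "real^'n \<Rightarrow> real"
  assumes R: "orthogonal_matrix R" and [measurable]: "g \<in> borel_measurable borel"
  shows "(LBINT x. g (R *v x)) = (LBINT x. g x)"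
    and "integrable lborel (\<lambda>x. g (R *v x)) \<longleftrightarrow> integrable lborel g"
proof -
  have "(LBINT x. g x) = (\<integral>x. g x \<partial>distr lborel borel ((*v) R))"
    by (simp add: lborel_distr_orthogonal[OF R])
  also have "\<dots> = (LBINT x. g (R *v x))"
    by (rule integral_distr) measurable
  finally show "(LBINT x. g (R *v x)) = (LBINT x. g x)" by simp
  have "integrable lborel g \<longleftrightarrow> integrable (distr lborel borel ((*v) R)) g"
    by (simp add: lborel_distr_orthogonal[OF R])
  also have "\<dots> \<longleftrightarrow> integrable lborel (\<lambda>x. g (R *v x))"
    by (rule integrable_distr_eq) measurable
  finally show "integrable lborel (\<lambda>x. g (R *v x)) \<longleftrightarrow> integrable lborel g" by simp
qed

subsection \<open>Weighted Lebesgue measures\<close>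

lemma integral_weighted:
  fixes s g :: "real^'n::finite \<Rightarrow> real"
  assumes "s \<in> smooth_functions" "\<And>x. s x > 0" "g \<in> borel_measurable borel"
  shows "(\<integral>x. g x \<partial>weighted s) = (LBINT x. s x * g x)"
    and "integrable (weighted s) g \<longleftrightarrow> integrable lborel (\<lambda>x. s x * g x)"
  using assms smooth_measurable[OF assms(1)]
  by (auto simp: integral_density integrable_density less_imp_le)

lemma L2_weighted_iff:
  fixes s u :: "real^'n::finite \<Rightarrow> real"
  assumes "s \<in> smooth_functions" "\<And>x. s x > 0"
  shows "u \<in> L2 (weighted s) \<longleftrightarrow>
    u \<in> borel_measurable borel \<and> integrable lborel (\<lambda>x. s x * (u x)\<^sup>2)"
  using integral_weighted(2)[OF assms] by (auto simp: L2_def)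

lemma AE_weighted:
  fixes s :: "real^'n::finite \<Rightarrow> real"
  assumes "s \<in> smooth_functions" "\<And>x. s x > 0"
  shows "(AE x in weighted s. P x) \<longleftrightarrow> (AE x in lborel. P x)"
  using assms(2) smooth_measurable[OF assms(1)] by (subst AE_density) auto

lemma test_L2_weighted:
  assumes "s \<in> smooth_functions" "\<And>x. s x > 0" "u \<in> test_functions"
  shows "u \<in> L2 (weighted s)"
proof -
  have "(\<lambda>x. s x * (u x * u x)) \<in> test_functions"
    using assms test_smooth by (intro test_mult_smooth)
  then show ?thesis
    unfolding L2_weighted_iff[OF assms(1,2)] power2_eq_square
    using smooth_measurable[OF test_smooth[OF assms(3)]] test_integrable by blast
qed

text \<open>If \<open>v\<close> is orthogonal to the test functions, then v s is locally integrable
  with vanishing test integrals; so the orthogonal complement is trivial.\<close>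

lemma test_dense_weighted:
  fixes s w :: "real^'n::finite \<Rightarrow> real"
  assumes s: "s \<in> smooth_functions" "\<And>x. s x > 0"
    and w: "w \<in> L2 (weighted s)" and e: "e > 0"
  obtains u where "u \<in> test_functions" "(\<integral>x. (w x - u x)\<^sup>2 \<partial>weighted s) < e"
proof (rule L2_dense[where X = test_functions and e = e, OF _ _ _ _ w e])
  show "test_functions \<subseteq> L2 (weighted s)"
    using test_L2_weighted[OF s] by blast
  show "(test_functions :: (real^'n \<Rightarrow> real) set) \<noteq> {}" using bump_test[of 1] by auto
  show "(\<lambda>x. u x + c * v x) \<in> test_functions" if "u \<in> test_functions" "v \<in> test_functions"
    for u v :: "real^'n \<Rightarrow> real" and c
    using that by (intro test_add test_mult_smooth smooth_const)
next
  fix v assume v: "v \<in> L2 (weighted s)"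
    and orth: "\<And>u. u \<in> test_functions \<Longrightarrow> (\<integral>x. v x * u x \<partial>weighted s) = 0"
  have [measurable]: "v \<in> borel_measurable borel" using v L2_weighted_iff[OF s] by blast
  have "AE x in lborel. v x * s x = 0"
  proof (rule AE_zero_if_test_integrals_zero)
    show "local_integrable (\<lambda>x. v x * s x)"
      by (intro local_integrable_times_smooth L2_density_local_integrable[OF v] s)
    fix \<phi> :: "real^'n \<Rightarrow> real" assume \<phi>: "\<phi> \<in> test_functions"
    have [measurable]: "\<phi> \<in> borel_measurable borel" using smooth_measurable[OF test_smooth[OF \<phi>]] .
    show "(LBINT x. v x * s x * \<phi> x) = 0"
      using orth[OF \<phi>] integral_weighted(1)[OF s, of "\<lambda>x. v x * \<phi> x"] by (simp add: mult_ac)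
  qed
  then show "AE x in weighted s. v x = 0"
    using s(2) by (simp add: AE_weighted[OF s] less_imp_neq[THEN not_sym])
qed (use that in blast)

lemma L2_sum:
  "(\<And>j. j \<in> J \<Longrightarrow> u j \<in> L2 M) \<Longrightarrow> (\<lambda>x. \<Sum>j\<in>J. u j x) \<in> L2 M"
  by (induction J rule: infinite_finite_induct) (auto intro: L2_add simp: L2_zero)

lemma L2_weighted_orthogonal:
  fixes R :: "real^'n::finite^'n"
  assumes s: "s \<in> smooth_functions" "\<And>x. s x > 0" and R: "orthogonal_matrix R"
    and sR: "\<And>x. s (R *v x) = s x" and u: "u \<in> L2 (weighted s)"
  shows "(\<lambda>x. u (R *v x)) \<in> L2 (weighted s)"
proof -
  have [measurable]: "u \<in> borel_measurable borel" "s \<in> borel_measurable borel"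
    using u L2_weighted_iff[OF s] smooth_measurable[OF s(1)] by auto
  have "integrable lborel (\<lambda>x. s x * (u x)\<^sup>2)" using u L2_weighted_iff[OF s] by blast
  then have "integrable lborel (\<lambda>x. s (R *v x) * (u (R *v x))\<^sup>2)"
    by (subst lborel_integral_orthogonal(2)[OF R]) auto
  then show ?thesis by (simp add: L2_weighted_iff[OF s] sR)
qed

lemma integral_weighted_orthogonal:
  fixes R :: "real^'n::finite^'n"
  assumes s: "s \<in> smooth_functions" "\<And>x. s x > 0" and R: "orthogonal_matrix R"
    and sR: "\<And>x. s (R *v x) = s x" and [measurable]: "(g :: real^'n \<Rightarrow> real) \<in> borel_measurable borel"
  shows "(\<integral>x. g (R *v x) \<partial>weighted s) = (\<integral>x. g x \<partial>weighted s)"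
proof -
  have [measurable]: "s \<in> borel_measurable borel" using smooth_measurable[OF s(1)] .
  have "(LBINT x. s (R *v x) * g (R *v x)) = (LBINT x. s x * g x)"
    by (rule lborel_integral_orthogonal(1)[OF R]) measurable
  then show ?thesis by (simp add: integral_weighted[OF s] sR)
qed

lemma integral_linear_combination:
  fixes g :: "'j \<Rightarrow> 'a \<Rightarrow> real"
  assumes "\<And>j. integrable M (g j)"
  shows "(\<integral>x. (\<Sum>j\<in>J. c j * g j x) \<partial>M) = (\<Sum>j\<in>J. c j * (\<integral>x. g j x \<partial>M))"
  using assms by (subst Bochner_Integration.integral_sum) auto

lemma adjoint_graph_D:
  "(w, z) \<in> adjoint_graph M G \<Longrightarrow> (u, v) \<in> G \<Longrightarrow> (\<integral>x. v x * w x \<partial>M) = (\<integral>x. u x * z x \<partial>M)"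
  unfolding adjoint_graph_def by auto

subsection \<open>The operator with a prescribed ground state\<close>

text \<open>Here \<open>\<sigma>\<close> is the density of the volume, \<open>a\<close> the
  coefficient of the flux in the divergence form operator \<open>lap\<close>, and \<open>f\<close>
  the prescribed ground state. The condition \<open>radial\<close> is the source of rotation
  invariance, and \<open>f_L2\<close> puts \<open>f\<close> into the Hilbert space.\<close>

locale ground_state_problem =
  fixes \<sigma> a f :: "real^'n::finite \<Rightarrow> real"
  assumes \<sigma>: "\<sigma> \<in> smooth_functions" "\<And>x. \<sigma> x > 0"
    and a: "a \<in> smooth_functions" "\<And>x. a x > 0"
    and f: "f \<in> smooth_functions" "\<And>x. f x > 0"
    and radial: "\<And>R x. orthogonal_matrix R \<Longrightarrow> \<sigma> (R *v x) = \<sigma> x \<and> a (R *v x) = a x \<and> f (R *v x) = f x"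
    and f_L2: "integrable lborel (\<lambda>x. \<sigma> x * (f x)\<^sup>2)"
begin

text \<open>The weight left by the substitution u = f h: the quadratic form of \<open>P\<close> at
  \<open>u\<close> is the integral of m |grad h|^2.\<close>

definition m :: "real^'n \<Rightarrow> real" where "m x = a x * (f x)\<^sup>2"

definition lap :: "(real^'n \<Rightarrow> real) \<Rightarrow> real^'n \<Rightarrow> real" where
  "lap u x = - (1 / \<sigma> x) * (\<Sum>i\<in>UNIV. pd i (\<lambda>y. a y * pd i u y) x)"

definition P :: "(real^'n \<Rightarrow> real) \<Rightarrow> real^'n \<Rightarrow> real" where
  "P u x = lap u x - lap f x / f x * u x"

abbreviation M :: "(real^'n) measure" where "M \<equiv> weighted \<sigma>"
abbreviation N :: "(real^'n) measure" where "N \<equiv> weighted m"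

text \<open>The index \<open>None\<close> carries the function, \<open>Some i\<close> the component
  with index \<open>i\<close> of the weak gradient of its quotient by \<open>f\<close>.\<close>

definition \<mu> :: "'n option \<Rightarrow> (real^'n) measure" where "\<mu> k = (case k of None \<Rightarrow> M | Some i \<Rightarrow> N)"

text \<open>Orthogonality of \<open>U\<close> to this family is the weak identity between the
  quotient of \<open>U None\<close> by \<open>f\<close> and its derivative
  \<open>U (Some i)\<close>, tested on \<open>\<eta>\<close>. The divisions by
  \<open>\<sigma>\<close> and \<open>m\<close> undo the weights, so that both pairings become
  Lebesgue integrals.\<close>

definition probe :: "'n \<Rightarrow> (real^'n \<Rightarrow> real) \<Rightarrow> 'n option \<Rightarrow> real^'n \<Rightarrow> real" where
  "probe i \<eta> k x = (case k of None \<Rightarrow> pd i \<eta> x * (1 / (f x * \<sigma> x)) | Some j \<Rightarrow> if j = i then \<eta> x * (1 / m x) else 0)"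

definition probes :: "('n option \<Rightarrow> real^'n \<Rightarrow> real) set" where
  "probes = {probe i \<eta> | i \<eta>. \<eta> \<in> test_functions}"

text \<open>The pairs of a function \<open>u\<close> and the weak gradient of \<open>u / f\<close>.\<close>

abbreviation S :: "('n option \<Rightarrow> real^'n \<Rightarrow> real) set" where "S \<equiv> orth_compl \<mu> probes"

definition G :: "(real^'n) op_graph" where "G = von_Neumann_graph \<mu> probes None"

lemma m: "m \<in> smooth_functions" "m x > 0"
  unfolding m_def[abs_def] power2_eq_square using a f by auto

lemma \<mu>_simps [simp]: "\<mu> None = M" "\<mu> (Some i) = N"
  by (simp_all add: \<mu>_def)

lemma ip_\<mu>: "ip \<mu> U V = (\<integral>x. U None x * V None x \<partial>M) + (\<Sum>i\<in>UNIV. \<integral>x. U (Some i) x * V (Some i) x \<partial>N)"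
  unfolding ip_def UNIV_option_conv by (simp add: sum.reindex)

lemma L2_family_\<mu>: "U \<in> L2_family \<mu> \<longleftrightarrow> U None \<in> L2 M \<and> (\<forall>i. U (Some i) \<in> L2 N)"
  unfolding L2_family_def mem_Collect_eq split_option_all by simp

lemma f\<sigma>: "(\<lambda>x. 1 / (f x * \<sigma> x)) \<in> smooth_functions"
  using f \<sigma> by (intro smooth_inverse smooth_mult) auto

lemma probes_L2: "probes \<subseteq> L2_family \<mu>"
proof -
  have "probe i \<eta> \<in> L2_family \<mu>" if \<eta>: "\<eta> \<in> test_functions" for i \<eta>
  proof -
    have "(\<lambda>x. pd i \<eta> x * (1 / (f x * \<sigma> x))) \<in> test_functions" "(\<lambda>x. \<eta> x * (1 / m x)) \<in> test_functions"
      using \<eta> f\<sigma> smooth_inverse[OF m] by (intro test_mult_smooth test_pd; simp)+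
    then have "probe i \<eta> None \<in> L2 M" "probe i \<eta> (Some j) \<in> L2 N" for j
    proof -
      assume t: "(\<lambda>x. pd i \<eta> x * (1 / (f x * \<sigma> x))) \<in> test_functions" "(\<lambda>x. \<eta> x * (1 / m x)) \<in> test_functions"
      show "probe i \<eta> None \<in> L2 M"
        using test_L2_weighted[OF \<sigma> t(1)] by (simp add: probe_def[abs_def])
      show "probe i \<eta> (Some j) \<in> L2 N"
        using test_L2_weighted[OF m t(2)] L2_zero by (cases "j = i") (auto simp: probe_def[abs_def])
    qed
    then show ?thesis by (simp add: L2_family_\<mu>)
  qed
  then show ?thesis by (auto simp: probes_def)
qed

lemma ip_probe:
  assumes U: "U \<in> L2_family \<mu>" and \<eta>: "\<eta> \<in> test_functions"
  shows "ip \<mu> U (probe i \<eta>) = (LBINT x. U None x * (1 / f x) * pd i \<eta> x) + (LBINT x. U (Some i) x * \<eta> x)"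
proof -
  have [measurable]: "U None \<in> borel_measurable borel" "\<And>j. U (Some j) \<in> borel_measurable borel"
    "\<eta> \<in> borel_measurable borel" "pd i \<eta> \<in> borel_measurable borel"
    "\<sigma> \<in> borel_measurable borel" "f \<in> borel_measurable borel" "m \<in> borel_measurable borel"
    using U L2_weighted_iff[OF \<sigma>] L2_weighted_iff[OF m] smooth_measurable[OF test_smooth[OF \<eta>]]
      smooth_measurable[OF test_smooth[OF test_pd[OF \<eta>]]]
      smooth_measurable[OF \<sigma>(1)] smooth_measurable[OF f(1)] smooth_measurable[OF m(1)]
    by (auto simp: L2_family_\<mu>)
  have "(\<integral>x. U None x * probe i \<eta> None x \<partial>M) = (LBINT x. U None x * (1 / f x) * pd i \<eta> x)"
  proof -
    have "\<sigma> x * (U None x * probe i \<eta> None x) = U None x * (1 / f x) * pd i \<eta> x" for x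
      using \<sigma>(2)[of x] by (simp add: probe_def)
    then show ?thesis by (subst integral_weighted[OF \<sigma>]) (simp_all add: probe_def)
  qed
  moreover have "(\<integral>x. U (Some j) x * probe i \<eta> (Some j) x \<partial>N) = (if j = i then \<integral>x. U (Some i) x * \<eta> x \<partial>lborel else 0)" for j
  proof -
    have "m x * (U (Some i) x * (\<eta> x * (1 / m x))) = U (Some i) x * \<eta> x" for x
      using m(2)[of x] by simp
    then show ?thesis using integral_weighted(1)[OF m, of "\<lambda>x. U (Some i) x * (\<eta> x * (1 / m x))"]
      by (auto simp: probe_def)
  qed
  ultimately show ?thesis by (simp add: ip_\<mu>)
qed

lemma S_iff:
  "U \<in> S \<longleftrightarrow> U \<in> L2_family \<mu> \<and> (\<forall>i. \<forall>\<eta>\<in>test_functions.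
     (LBINT x. U None x * (1 / f x) * pd i \<eta> x) = - (LBINT x. U (Some i) x * \<eta> x))"
proof -
  have "U \<in> S \<longleftrightarrow> U \<in> L2_family \<mu> \<and> (\<forall>i. \<forall>\<eta>\<in>test_functions. ip \<mu> U (probe i \<eta>) = 0)"
    unfolding orth_compl_def probes_def by blast
  also have "\<dots> \<longleftrightarrow> U \<in> L2_family \<mu> \<and> (\<forall>i. \<forall>\<eta>\<in>test_functions.
     (LBINT x. U None x * (1 / f x) * pd i \<eta> x) = - (LBINT x. U (Some i) x * \<eta> x))"
    by (auto simp: ip_probe add_eq_0_iff2)
  finally show ?thesis .
qed

text \<open>Once the product of the components at \<open>None\<close> is cancelled, the condition in
  \<open>von_Neumann_graph\<close> is the weak form of T^* T u = v.\<close>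

lemma G_I:
  assumes "U \<in> S" "v \<in> L2 M"
    and "\<And>W. W \<in> S \<Longrightarrow> (\<Sum>i\<in>UNIV. \<integral>x. U (Some i) x * W (Some i) x \<partial>N) = (\<integral>x. v x * W None x \<partial>M)"
  shows "(U None, v) \<in> G"
proof -
  have U: "U None \<in> L2 M" using assms(1) by (simp add: S_iff L2_family_\<mu>)
  have "ip \<mu> U W = (\<integral>x. (U None x + v x) * W None x \<partial>\<mu> None)" if W: "W \<in> S" for W
  proof -
    have "W None \<in> L2 M" using W by (simp add: S_iff L2_family_\<mu>)
    then show ?thesis
      using U assms(2) assms(3)[OF W] by (simp add: ip_\<mu> distrib_right L2_mult_integrable)
  qed
  then show ?thesis unfolding G_def von_Neumann_graph_def using assms(1,2) by auto
qed

lemma G_E: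
  assumes "(u, v) \<in> G"
  shows "\<exists>U\<in>S. U None = u \<and> u \<in> L2 M \<and> v \<in> L2 M \<and> (\<forall>W\<in>S.
    (\<Sum>i\<in>UNIV. \<integral>x. U (Some i) x * W (Some i) x \<partial>N) = (\<integral>x. v x * W None x \<partial>M))"
proof -
  obtain U where U: "U \<in> S" "U None = u" "v \<in> L2 M"
    "\<And>W. W \<in> S \<Longrightarrow> ip \<mu> U W = (\<integral>x. (u x + v x) * W None x \<partial>M)"
    using assms unfolding G_def von_Neumann_graph_def by auto
  have u: "u \<in> L2 M" using U(1,2) by (auto simp: S_iff L2_family_\<mu>)
  have "(\<Sum>i\<in>UNIV. \<integral>x. U (Some i) x * W (Some i) x \<partial>N) = (\<integral>x. v x * W None x \<partial>M)" if W: "W \<in> S" for W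
  proof -
    have "W None \<in> L2 M" using W by (simp add: S_iff L2_family_\<mu>)
    then show ?thesis
      using U(4)[OF W] U(2,3) u by (simp add: ip_\<mu> distrib_right L2_mult_integrable)
  qed
  then show ?thesis using U u by blast
qed

lemma lap_smooth [intro]: "u \<in> smooth_functions \<Longrightarrow> lap u \<in> smooth_functions"
  unfolding lap_def[abs_def] using smooth_inverse[OF \<sigma>] a by (intro smooth_mult smooth_minus smooth_sum smooth_pd) auto

lemma lap_f_quotient: "(\<lambda>x. lap f x / f x) \<in> smooth_functions"
  using smooth_mult[OF lap_smooth[OF f(1)] smooth_inverse[OF f]] by simp

lemma P_test:
  assumes w: "w \<in> test_functions" shows "P w \<in> test_functions"
proof -
  have 1: "lap w \<in> test_functions"
    unfolding lap_def[abs_def]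
    using w a smooth_inverse[OF \<sigma>] by (intro test_mult_smooth smooth_minus test_sum test_pd) auto
  have "(\<lambda>x. lap f x / f x * w x) \<in> test_functions"
    using w lap_f_quotient by (intro test_mult_smooth)
  from test_add[OF 1 test_mult_smooth(2)[OF this smooth_const[of "- 1"]]] show ?thesis by (simp add: P_def[abs_def])
qed

text \<open>Both sides come from \<open>\<partial>\<^sub>i (f \<cdot> a \<partial>\<^sub>i w - w \<cdot> a \<partial>\<^sub>i f)\<close>, in which the products of first derivatives cancel.\<close>

lemma P_divergence:
  assumes w: "w \<in> smooth_functions"
  shows "\<sigma> x * P w x = - (1 / f x) * (\<Sum>i\<in>UNIV. pd i (\<lambda>y. m y * pd i (\<lambda>z. w z * (1 / f z)) y) x)"
proof -
  define h where "h = (\<lambda>z. w z * (1 / f z))"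
  have h: "h \<in> smooth_functions" unfolding h_def by (intro smooth_mult smooth_inverse w f)
  have fx: "f x \<noteq> 0" "\<sigma> x \<noteq> 0" for x using f(2)[of x] \<sigma>(2)[of x] by auto
  have w_eq: "w = (\<lambda>z. h z * f z)" unfolding h_def using fx by auto
  have pw: "pd i w y = pd i h y * f y + h y * pd i f y" for i y
    unfolding w_eq using h f by (simp add: pd_mult)
  have flux: "m y * pd i h y = f y * (a y * pd i w y) - w y * (a y * pd i f y)" for i y
    unfolding pw m_def by (simp add: w_eq power2_eq_square algebra_simps)
  have "pd i (\<lambda>y. m y * pd i h y) x = f x * pd i (\<lambda>y. a y * pd i w y) x - w x * pd i (\<lambda>y. a y * pd i f y) x" for i
    unfolding flux using w f a
    by (simp add: pd_diff pd_mult[of f "\<lambda>y. a y * pd i w y"] pd_mult[of w "\<lambda>y. a y * pd i f y"])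
  then have flux_sum: "(\<Sum>i\<in>UNIV. pd i (\<lambda>y. m y * pd i h y) x)
      = f x * (\<Sum>i\<in>UNIV. pd i (\<lambda>y. a y * pd i w y) x) - w x * (\<Sum>i\<in>UNIV. pd i (\<lambda>y. a y * pd i f y) x)"
    by (simp add: sum_subtractf sum_distrib_left)
  have "s * (- (1 / s) * A - - (1 / s) * B / t * r) = - (1 / t) * (t * A - r * B)"
    if "s \<noteq> 0" "t \<noteq> 0" for s t r A B :: real
    using that by (simp add: field_simps)
  from this[OF fx(2) fx(1)] show ?thesis
    unfolding h_def[symmetric] flux_sum P_def lap_def .
qed

text \<open>For a test function \<open>w\<close> the flux m grad (w/f) is smooth with compact
  support. Its components can serve as test functions in the weak identities satisfied by
  \<open>W\<close>, so all derivatives fall on smooth functions.\<close>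

lemma P_in_G:
  assumes w: "w \<in> test_functions" shows "(w, P w) \<in> G"
proof -
  define h where "h = (\<lambda>z. w z * (1 / f z))"
  have h: "h \<in> test_functions" unfolding h_def using w smooth_inverse[OF f] by (intro test_mult_smooth)
  define U where "U k = (case k of None \<Rightarrow> w | Some i \<Rightarrow> pd i h)" for k
  have U: "U \<in> S"
    unfolding S_iff L2_family_\<mu>
  proof (intro conjI allI ballI)
    show "U None \<in> L2 M" "U (Some i) \<in> L2 N" for i
      using test_L2_weighted[OF \<sigma> w] test_L2_weighted[OF m test_pd[OF h]] by (simp_all add: U_def)
    fix i and \<eta> :: "real^'n \<Rightarrow> real" assume \<eta>: "\<eta> \<in> test_functions"
    show "(LBINT x. U None x * (1 / f x) * pd i \<eta> x) = - (LBINT x. U (Some i) x * \<eta> x)"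
      using integration_by_parts_test[OF test_smooth[OF h] \<eta>, of i] by (simp add: U_def h_def)
  qed
  have "(U None, P w) \<in> G"
  proof (rule G_I[OF U test_L2_weighted[OF \<sigma> P_test[OF w]]])
    fix W assume W: "W \<in> S"
    have [measurable]: "W None \<in> borel_measurable borel" "W (Some i) \<in> borel_measurable borel"
        "P w \<in> borel_measurable borel" "pd i h \<in> borel_measurable borel" for i
      using W L2_weighted_iff[OF \<sigma>] L2_weighted_iff[OF m] smooth_measurable[OF test_smooth[OF P_test[OF w]]]
        smooth_measurable[OF test_smooth[OF test_pd[OF h]]]
      by (auto simp: S_iff L2_family_\<mu>)
    \<comment> \<open>The flux of w/f; by \<open>P_divergence\<close> its divergence is - f \<sigma>
      P w.\<close>
    define \<eta> where "\<eta> i = (\<lambda>x. m x * pd i h x)" for i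
    have \<eta>: "\<eta> i \<in> test_functions" for i
      unfolding \<eta>_def using h m by (intro test_mult_smooth test_pd) auto
    have W0: "local_integrable (\<lambda>x. W None x * (1 / f x))"
      using W L2_density_local_integrable[OF _ \<sigma>] smooth_inverse[OF f]
      by (intro local_integrable_times_smooth) (auto simp: S_iff L2_family_\<mu>)
    have "(\<Sum>i\<in>UNIV. \<integral>x. U (Some i) x * W (Some i) x \<partial>N) = (\<Sum>i\<in>UNIV. \<integral>x. W (Some i) x * \<eta> i x \<partial>lborel)"
      by (rule sum.cong[OF refl], subst integral_weighted[OF m]) (auto simp: U_def \<eta>_def mult_ac)
    also have "\<dots> = (\<Sum>i\<in>UNIV. - (LBINT x. W None x * (1 / f x) * pd i (\<eta> i) x))"
      using W \<eta> unfolding S_iff by (intro sum.cong) auto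
    also have "\<dots> = - (LBINT x. (\<Sum>i\<in>UNIV. W None x * (1 / f x) * pd i (\<eta> i) x))"
      using local_integrable_times_test[OF W0 test_pd[OF \<eta>]]
      by (subst Bochner_Integration.integral_sum) (auto simp: sum_negf)
    also have "\<dots> = (LBINT x. - (\<Sum>i\<in>UNIV. W None x * (1 / f x) * pd i (\<eta> i) x))"
      by simp
    also have "\<dots> = (LBINT x. \<sigma> x * (P w x * W None x))"
    proof (rule Bochner_Integration.integral_cong[OF refl])
      fix x
      have "\<sigma> x * P w x * W None x = - (1 / f x) * (\<Sum>i\<in>UNIV. pd i (\<eta> i) x) * W None x"
        using P_divergence[OF test_smooth[OF w], of x] by (simp add: \<eta>_def h_def)
      then show "- (\<Sum>i\<in>UNIV. W None x * (1 / f x) * pd i (\<eta> i) x) = \<sigma> x * (P w x * W None x)"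
        by (simp add: sum_distrib_left sum_negf mult_ac)
    qed
    also have "\<dots> = (\<integral>x. P w x * W None x \<partial>M)"
      by (subst integral_weighted[OF \<sigma>]) auto
    finally show "(\<Sum>i\<in>UNIV. \<integral>x. U (Some i) x * W (Some i) x \<partial>N) = (\<integral>x. P w x * W None x \<partial>M)" .
  qed
  then show ?thesis by (simp add: U_def)
qed

lemma G_self_adjoint: "self_adjoint M G"
proof -
  have "dense_domain (\<mu> None) (von_Neumann_graph \<mu> probes None)"
    unfolding dense_domain_def \<mu>_simps
  proof (intro ballI allI impI)
    fix w :: "real^'n \<Rightarrow> real" and e :: real assume w: "w \<in> L2 M" and e: "e > 0"
    obtain u where u: "u \<in> test_functions" "(\<integral>x. (w x - u x)\<^sup>2 \<partial>M) < e"
      using test_dense_weighted[OF \<sigma> w e] by blast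
    then show "\<exists>u\<in>Domain (von_Neumann_graph \<mu> probes None). u \<in> L2 M \<and> (\<integral>x. (w x - u x)\<^sup>2 \<partial>M) < e"
      using P_in_G[OF u(1)] test_L2_weighted[OF \<sigma> u(1)] unfolding G_def by blast
  qed
  from von_Neumann_self_adjoint[OF probes_L2 this] show ?thesis by (simp add: G_def)
qed

text \<open>The quotient f/f is the constant 1 with weak gradient 0, as derivatives of test
  functions have integral 0. The maximal domain of \<open>T\<close> admits \<open>f\<close>
  directly, with no approximation by test functions.\<close>

lemma f_in_G: "(f, \<lambda>x. 0 * f x) \<in> G"
proof -
  define U where "U k = (case k of None \<Rightarrow> f | Some i \<Rightarrow> (\<lambda>x. 0))" for k :: "'n option"
  have fL: "f \<in> L2 M" using f_L2 L2_weighted_iff[OF \<sigma>] smooth_measurable[OF f(1)] by blast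
  have "U \<in> S"
    unfolding S_iff L2_family_\<mu>
  proof (intro conjI allI ballI)
    show "U None \<in> L2 M" "U (Some i) \<in> L2 N" for i
      using fL L2_zero by (simp_all add: U_def)
    fix i and \<eta> :: "real^'n \<Rightarrow> real" assume \<eta>: "\<eta> \<in> test_functions"
    have "(LBINT x. f x * (1 / f x) * pd i \<eta> x) = (LBINT x. pd i \<eta> x)"
      by (intro Bochner_Integration.integral_cong refl) (use f(2) in \<open>simp add: less_imp_neq[THEN not_sym]\<close>)
    then show "(LBINT x. U None x * (1 / f x) * pd i \<eta> x) = - (LBINT x. U (Some i) x * \<eta> x)"
      using integral_pd_test[OF \<eta>, of i] by (simp add: U_def)
  qed
  from G_I[OF this L2_cmult[OF fL, of 0]] show ?thesis by (simp add: U_def)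
qed

lemma not_AE_f_zero: "\<not> (AE x in M. f x = 0)"
proof -
  have "\<not> (AE x in lborel :: (real^'n) measure. False)"
    by (simp add: eventually_False ae_filter_eq_bot_iff)
  then show ?thesis using f(2) by (simp add: AE_weighted[OF \<sigma>] less_imp_neq[THEN not_sym])
qed

text \<open>The eigenvalue equation tested on the eigenfunction itself. The sign of the eigenvalues
  and the simplicity of the eigenvalue 0 both follow from this identity.\<close>

lemma energy:
  assumes "(u, \<lambda>x. l * u x) \<in> G"
  shows "\<exists>U\<in>S. U None = u \<and> u \<in> L2 M \<and>
    l * (\<integral>x. (u x)\<^sup>2 \<partial>M) = (\<Sum>i\<in>UNIV. \<integral>x. (U (Some i) x)\<^sup>2 \<partial>N)"
proof -
  obtain U where U: "U \<in> S" "U None = u" "u \<in> L2 M" and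
    E: "\<forall>W\<in>S. (\<Sum>i\<in>UNIV. \<integral>x. U (Some i) x * W (Some i) x \<partial>N) = (\<integral>x. l * u x * W None x \<partial>M)"
    using G_E[OF assms] by blast
  have "l * (\<integral>x. (u x)\<^sup>2 \<partial>M) = (\<integral>x. l * u x * U None x \<partial>M)"
    by (simp add: U(2) power2_eq_square mult.assoc)
  also have "\<dots> = (\<Sum>i\<in>UNIV. \<integral>x. (U (Some i) x)\<^sup>2 \<partial>N)"
    using E U(1) by (simp add: power2_eq_square)
  finally show ?thesis using U by blast
qed

lemma G_ground_state: "ground_state M G f 0"
  unfolding ground_state_def
proof (intro conjI allI impI)
  show "eigenfunction M G 0 f"
    unfolding eigenfunction_def using f_in_G not_AE_f_zero by simp
next
  fix l u assume e: "eigenfunction M G l u"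
  then have "(u, \<lambda>x. l * u x) \<in> G" by (simp add: eigenfunction_def)
  from energy[OF this] obtain U where "U \<in> S" and U: "u \<in> L2 M" "l * (\<integral>x. (u x)\<^sup>2 \<partial>M) = (\<Sum>i\<in>UNIV. \<integral>x. (U (Some i) x)\<^sup>2 \<partial>N)"
    by blast
  have "(\<integral>x. (u x)\<^sup>2 \<partial>M) \<noteq> 0"
    using L2_square_zero_AE[OF U(1)] e unfolding eigenfunction_def by blast
  moreover have "(\<integral>x. (u x)\<^sup>2 \<partial>M) \<ge> 0" by simp
  ultimately have "(\<integral>x. (u x)\<^sup>2 \<partial>M) > 0" by (rule le_neq_trans[OF _ not_sym, rotated])
  moreover have "l * (\<integral>x. (u x)\<^sup>2 \<partial>M) \<ge> 0"
    unfolding U(2) by (intro sum_nonneg) simp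
  ultimately show "0 \<le> l" by (simp add: zero_le_mult_iff)
next
  fix u assume e: "eigenfunction M G 0 u"
  then have "(u, \<lambda>x. 0 * u x) \<in> G" by (simp add: eigenfunction_def)
  then obtain U where U: "U \<in> S" "U None = u" "u \<in> L2 M" and
    E: "0 * (\<integral>x. (u x)\<^sup>2 \<partial>M) = (\<Sum>i\<in>UNIV. \<integral>x. (U (Some i) x)\<^sup>2 \<partial>N)"
    using energy by blast
  have UN: "U (Some i) \<in> L2 N" for i using U(1) by (simp add: S_iff L2_family_\<mu>)
  \<comment> \<open>At energy 0 a sum of nonnegative terms vanishes, so the weak gradient of u/f is
    zero and u/f is constant.\<close>
  have "(\<integral>x. (U (Some i) x)\<^sup>2 \<partial>N) = 0" for i
    using E sum_nonneg_eq_0_iff[of UNIV "\<lambda>i. \<integral>x. (U (Some i) x)\<^sup>2 \<partial>N"] by simp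
  then have zero: "AE x in lborel. U (Some i) x = 0" for i
    using L2_square_zero_AE[OF UN] AE_weighted[OF m] by blast
  have "local_integrable (\<lambda>x. u x * (1 / f x))"
    by (intro local_integrable_times_smooth smooth_inverse f L2_density_local_integrable[OF U(3) \<sigma>])
  then obtain c where "AE x in lborel. u x * (1 / f x) = c"
  proof (rule weak_gradient_zero_const)
    fix i and \<eta> :: "real^'n \<Rightarrow> real" assume \<eta>: "\<eta> \<in> test_functions"
    have "(LBINT x. U (Some i) x * \<eta> x) = 0"
      by (rule integral_eq_zero_AE) (use zero[of i] in eventually_elim, simp)
    then show "(LBINT x. u x * (1 / f x) * pd i \<eta> x) = 0"
      using U(1,2) \<eta> by (auto simp: S_iff)
  qed
  then have "AE x in lborel. u x = c * f x"
  proof eventually_elim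
    fix x assume "u x * (1 / f x) = c"
    then show "u x = c * f x" using f(2)[of x] by (simp add: field_simps)
  qed
  then show "\<exists>s. AE x in M. u x = s * f x" unfolding AE_weighted[OF \<sigma>] by blast
qed

section \<open>Rotation invariance of the realization\<close>

text \<open>The chain rule dictates the components: the gradient of h(R x) is the transpose of
  \<open>R\<close> applied to the gradient of \<open>h\<close> at R x.\<close>

definition rotate :: "real^'n^'n \<Rightarrow> ('n option \<Rightarrow> real^'n \<Rightarrow> real) \<Rightarrow> 'n option \<Rightarrow> real^'n \<Rightarrow> real" where
  "rotate R U k x = (case k of None \<Rightarrow> U None (R *v x)
     | Some i \<Rightarrow> \<Sum>j\<in>UNIV. R $ j $ i * U (Some j) (R *v x))"

lemma m_radial: "orthogonal_matrix R \<Longrightarrow> m (R *v x) = m x"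
  using radial by (simp add: m_def)

lemma S_D:
  assumes "U \<in> S"
  shows "U None \<in> L2 M" "U (Some i) \<in> L2 N"
    "U None \<in> borel_measurable borel" "U (Some i) \<in> borel_measurable borel"
    "\<eta> \<in> test_functions \<Longrightarrow> (LBINT x. U None x * (1 / f x) * pd i \<eta> x) = - (LBINT x. U (Some i) x * \<eta> x)"
    "local_integrable (\<lambda>x. U None x * (1 / f x))" "local_integrable (U (Some i))"
proof -
  show 1: "U None \<in> L2 M" "U (Some i) \<in> L2 N"
    and "\<eta> \<in> test_functions \<Longrightarrow> (LBINT x. U None x * (1 / f x) * pd i \<eta> x) = - (LBINT x. U (Some i) x * \<eta> x)"
    using assms by (simp_all add: S_iff L2_family_\<mu>)
  show "U None \<in> borel_measurable borel" "U (Some i) \<in> borel_measurable borel"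
    using 1 L2_weighted_iff[OF \<sigma>] L2_weighted_iff[OF m] by auto
  show "local_integrable (\<lambda>x. U None x * (1 / f x))"
    by (intro local_integrable_times_smooth smooth_inverse f L2_density_local_integrable[OF 1(1) \<sigma>])
  show "local_integrable (U (Some i))"
    by (rule L2_density_local_integrable[OF 1(2) m])
qed

lemma rotate_S:
  assumes R: "orthogonal_matrix R" and U: "U \<in> S" shows "rotate R U \<in> S"
  unfolding S_iff L2_family_\<mu>
proof (intro conjI allI ballI)
  note [measurable] = S_D(3,4)[OF U]
  have RR: "transpose R ** R = mat 1" "R ** transpose R = mat 1" "orthogonal_matrix (transpose R)"
    using R by (auto simp: orthogonal_matrix_def orthogonal_matrix_transpose)
  show "rotate R U None \<in> L2 M"
    using L2_weighted_orthogonal[OF \<sigma> R _ S_D(1)[OF U]] radial[OF R] by (simp add: rotate_def[abs_def])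
  show "rotate R U (Some i) \<in> L2 N" for i
    using L2_weighted_orthogonal[OF m R _ S_D(2)[OF U]] m_radial[OF R]
    by (simp add: rotate_def[abs_def] L2_sum L2_cmult)
  fix i and \<eta> :: "real^'n \<Rightarrow> real" assume \<eta>: "\<eta> \<in> test_functions"
  \<comment> \<open>The rotated test function, chosen such that \<open>\<eta>\<close> is
    \<open>\<theta>\<close> composed with \<open>R\<close>; the change of variables then leads back
    to the weak identity for \<open>U\<close>.\<close>
  define \<theta> where "\<theta> y = \<eta> (transpose R *v y)" for y
  have \<theta>: "\<theta> \<in> test_functions"
    unfolding \<theta>_def[abs_def] by (rule test_orthogonal[OF \<eta> RR(3)])
  have [measurable]: "\<theta> \<in> borel_measurable borel" "f \<in> borel_measurable borel" "\<And>j. pd j \<theta> \<in> borel_measurable borel"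
    using smooth_measurable[OF test_smooth[OF \<theta>]] smooth_measurable[OF f(1)]
      smooth_measurable[OF test_smooth[OF test_pd[OF \<theta>]]] by auto
  have "(\<lambda>x. \<theta> (R *v x + 0)) = \<eta>"
    by (rule ext) (unfold \<theta>_def matrix_vector_mul_assoc add_0_right RR(1), simp)
  then have pd: "pd i \<eta> x = (\<Sum>j\<in>UNIV. R $ j $ i * pd j \<theta> (R *v x))" and \<eta>\<theta>: "\<eta> x = \<theta> (R *v x)" for x
    using pd_affine[OF test_smooth[OF \<theta>], of i R 0] by (auto simp: fun_eq_iff)
  have "(LBINT x. rotate R U None x * (1 / f x) * pd i \<eta> x)
      = (LBINT x. (\<Sum>j\<in>UNIV. R $ j $ i * (U None (R *v x) * (1 / f (R *v x)) * pd j \<theta> (R *v x))))"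
    using radial[OF R] by (simp add: rotate_def pd sum_distrib_left mult_ac)
  also have "\<dots> = (LBINT x. (\<Sum>j\<in>UNIV. R $ j $ i * (U None x * (1 / f x) * pd j \<theta> x)))"
    by (rule lborel_integral_orthogonal(1)[OF R]) measurable
  also have "\<dots> = (\<Sum>j\<in>UNIV. R $ j $ i * (LBINT x. U None x * (1 / f x) * pd j \<theta> x))"
    by (rule integral_linear_combination) (rule local_integrable_times_test[OF S_D(6)[OF U] test_pd[OF \<theta>]])
  also have "\<dots> = - (\<Sum>j\<in>UNIV. R $ j $ i * (LBINT x. U (Some j) x * \<theta> x))"
    by (simp only: S_D(5)[OF U \<theta>] mult_minus_right sum_negf)
  also have "(\<Sum>j\<in>UNIV. R $ j $ i * (LBINT x. U (Some j) x * \<theta> x))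
      = (LBINT x. (\<Sum>j\<in>UNIV. R $ j $ i * (U (Some j) x * \<theta> x)))"
    by (rule integral_linear_combination[symmetric]) (rule local_integrable_times_test[OF S_D(7)[OF U] \<theta>])
  also have "\<dots> = (LBINT x. (\<Sum>j\<in>UNIV. R $ j $ i * (U (Some j) (R *v x) * \<theta> (R *v x))))"
    by (rule lborel_integral_orthogonal(1)[OF R, symmetric]) measurable
  also have "\<dots> = (LBINT x. rotate R U (Some i) x * \<eta> x)"
    by (simp add: rotate_def \<eta>\<theta> sum_distrib_right mult.assoc)
  finally show "(LBINT x. rotate R U None x * (1 / f x) * pd i \<eta> x) = - (LBINT x. rotate R U (Some i) x * \<eta> x)" .
qed

text \<open>The weight \<open>m\<close> is radial, so the substitution of R x for \<open>x\<close>
  preserves the measure \<open>N\<close>, while the matrix acting on the components moves to the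
  other factor as its transpose.\<close>

lemma rotate_adjoint:
  assumes R: "orthogonal_matrix R" and U: "U \<in> S" and W: "W \<in> S"
  shows "(\<Sum>i\<in>UNIV. \<integral>x. rotate R U (Some i) x * W (Some i) x \<partial>N)
    = (\<Sum>j\<in>UNIV. \<integral>x. U (Some j) x * rotate (transpose R) W (Some j) x \<partial>N)"
proof -
  note [measurable] = S_D(3,4)[OF U] S_D(3,4)[OF W]
  have RR: "transpose R ** R = mat 1" using R by (auto simp: orthogonal_matrix_def)
  have Q: "transpose R *v (R *v x) = x" for x unfolding matrix_vector_mul_assoc RR by simp
  have int: "integrable N (\<lambda>x. R $ j $ i * (U (Some j) (R *v x) * W (Some i) x))" for i j
    using L2_mult_integrable[OF L2_weighted_orthogonal[OF m R m_radial[OF R] S_D(2)[OF U]] S_D(2)[OF W]] by simp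
  have r: "(\<integral>x. U (Some j) x * rotate (transpose R) W (Some j) x \<partial>N)
      = (\<Sum>i\<in>UNIV. \<integral>x. R $ j $ i * (U (Some j) (R *v x) * W (Some i) x) \<partial>N)" for j
  proof -
    have "(\<integral>x. U (Some j) x * rotate (transpose R) W (Some j) x \<partial>N)
      = (\<integral>x. U (Some j) (R *v x) * rotate (transpose R) W (Some j) (R *v x) \<partial>N)"
    proof (rule integral_weighted_orthogonal[OF m R m_radial[OF R], symmetric])
      show "(\<lambda>x. U (Some j) x * rotate (transpose R) W (Some j) x) \<in> borel_measurable borel"
        unfolding rotate_def option.case by measurable
    qed
    also have "\<dots> = (\<integral>x. (\<Sum>i\<in>UNIV. R $ j $ i * (U (Some j) (R *v x) * W (Some i) x)) \<partial>N)"
      unfolding rotate_def option.case Q sum_distrib_left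
      by (intro Bochner_Integration.integral_cong sum.cong refl) (simp add: transpose_def)
    also have "\<dots> = (\<Sum>i\<in>UNIV. \<integral>x. R $ j $ i * (U (Some j) (R *v x) * W (Some i) x) \<partial>N)"
      using int by (rule Bochner_Integration.integral_sum)
    finally show ?thesis .
  qed
  have l: "(\<integral>x. rotate R U (Some i) x * W (Some i) x \<partial>N)
      = (\<Sum>j\<in>UNIV. \<integral>x. R $ j $ i * (U (Some j) (R *v x) * W (Some i) x) \<partial>N)" for i
    unfolding rotate_def option.case sum_distrib_right mult.assoc
    using int by (rule Bochner_Integration.integral_sum)
  show ?thesis unfolding l r by (rule sum.swap)
qed

text \<open>The rotation is moved from \<open>U\<close> to the test element \<open>W\<close>, where
  it becomes the inverse rotation. The rotated \<open>W\<close> stays in \<open>S\<close>, so the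
  equation for \<open>(u, v)\<close> applies to it.\<close>

lemma G_SO_invariant: "SO_invariant G"
  unfolding SO_invariant_def
proof (intro allI impI ballI, clarify)
  fix R :: "real^'n^'n" and u v
  assume rot: "rotation_matrix R" and uv: "(u, v) \<in> G"
  have R: "orthogonal_matrix R" using rot by (simp add: rotation_matrix_def)
  have RT: "orthogonal_matrix (transpose R)" using R by (simp add: orthogonal_matrix_transpose)
  have RR: "transpose R ** R = mat 1" using R by (auto simp: orthogonal_matrix_def)
  have Q: "transpose R *v (R *v x) = x" for x unfolding matrix_vector_mul_assoc RR by simp
  obtain U where U: "U \<in> S" "U None = u" "v \<in> L2 M" and
    E: "\<forall>W\<in>S. (\<Sum>i\<in>UNIV. \<integral>x. U (Some i) x * W (Some i) x \<partial>N) = (\<integral>x. v x * W None x \<partial>M)"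
    using G_E[OF uv] by blast
  have [measurable]: "v \<in> borel_measurable borel" using U(3) L2_weighted_iff[OF \<sigma>] by blast
  have "(rotate R U None, \<lambda>x. v (R *v x)) \<in> G"
  proof (rule G_I[OF rotate_S[OF R U(1)]])
    show "(\<lambda>x. v (R *v x)) \<in> L2 M"
      using L2_weighted_orthogonal[OF \<sigma> R _ U(3)] radial[OF R] by blast
    fix W assume W: "W \<in> S"
    note [measurable] = S_D(3)[OF W]
    have "(\<Sum>i\<in>UNIV. \<integral>x. rotate R U (Some i) x * W (Some i) x \<partial>N)
        = (\<integral>x. v x * rotate (transpose R) W None x \<partial>M)"
      using rotate_adjoint[OF R U(1) W] E rotate_S[OF RT W] by simp
    also have "\<dots> = (\<integral>x. v (R *v x) * rotate (transpose R) W None (R *v x) \<partial>M)"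
    proof (rule integral_weighted_orthogonal[OF \<sigma> R, symmetric])
      show "(\<lambda>x. v x * rotate (transpose R) W None x) \<in> borel_measurable borel"
        unfolding rotate_def option.case by measurable
    qed (use radial[OF R] in blast)
    also have "\<dots> = (\<integral>x. v (R *v x) * W None x \<partial>M)"
      unfolding rotate_def option.case Q ..
    finally show "(\<Sum>i\<in>UNIV. \<integral>x. rotate R U (Some i) x * W (Some i) x \<partial>N) = (\<integral>x. v (R *v x) * W None x \<partial>M)" .
  qed
  then show "(\<lambda>x. u (R *v x), \<lambda>x. v (R *v x)) \<in> G"
    by (simp add: rotate_def[abs_def] U(2))
qed

section \<open>Uniqueness of the lower order coefficients\<close>

text \<open>Compact support of either factor excludes boundary terms; later the other factor will be
  \<open>f\<close>, whose support is all of space.\<close>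

lemma lap_parts:
  assumes u: "u \<in> smooth_functions" and w: "w \<in> smooth_functions" and uw: "u \<in> test_functions \<or> w \<in> test_functions"
  shows "(LBINT x. \<sigma> x * (lap u x * w x)) = (\<Sum>i\<in>UNIV. \<integral>x. a x * pd i u x * pd i w x \<partial>lborel)"
proof -
  have int: "(\<lambda>x. pd i (\<lambda>y. a y * pd i u y) x * w x) \<in> test_functions"
    "(\<lambda>x. (a x * pd i u x) * w x) \<in> test_functions"
    "(\<lambda>x. (a x * pd i u x) * pd i w x) \<in> test_functions" for i
  proof -
    have s: "(\<lambda>y. a y * pd i u y) \<in> smooth_functions" using a u by auto
    have t: "(\<lambda>y. a y * pd i u y) \<in> test_functions \<or> w \<in> test_functions"
      using uw test_mult_smooth(2)[OF test_pd a(1)] by blast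
    show "(\<lambda>x. pd i (\<lambda>y. a y * pd i u y) x * w x) \<in> test_functions"
      using t test_mult_smooth(1)[OF test_pd w] test_mult_smooth(2)[OF _ smooth_pd[OF s]] by blast
    show "(\<lambda>x. (a x * pd i u x) * w x) \<in> test_functions"
      using t test_mult_smooth(1)[OF _ w] test_mult_smooth(2)[OF _ s] by blast
    show "(\<lambda>x. (a x * pd i u x) * pd i w x) \<in> test_functions"
      using t test_mult_smooth(1)[OF _ smooth_pd[OF w]] test_mult_smooth(2)[OF test_pd s] by blast
  qed
  have "\<sigma> x * (lap u x * w x) = (\<Sum>i\<in>UNIV. - (pd i (\<lambda>y. a y * pd i u y) x * w x))" for x
    using \<sigma>(2)[of x] by (simp add: lap_def sum_distrib_right sum_negf)
  then have "(LBINT x. \<sigma> x * (lap u x * w x)) = (\<Sum>i\<in>UNIV. - (LBINT x. pd i (\<lambda>y. a y * pd i u y) x * w x))"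
    using test_integrable[OF int(1)] by (simp add: Bochner_Integration.integral_sum sum_negf)
  also have "\<dots> = (\<Sum>i\<in>UNIV. \<integral>x. a x * pd i u x * pd i w x \<partial>lborel)"
    using a u w by (intro sum.cong refl) (subst integration_by_parts, use int in auto)
  finally show ?thesis .
qed

lemma lap_symmetric:
  assumes "u \<in> smooth_functions" "w \<in> test_functions"
  shows "(LBINT x. \<sigma> x * (lap u x * w x)) = (LBINT x. \<sigma> x * (u x * lap w x))"
proof -
  have "(LBINT x. \<sigma> x * (lap u x * w x)) = (LBINT x. \<sigma> x * (lap w x * u x))"
    using lap_parts[of u w] lap_parts[of w u] assms test_smooth[OF assms(2)]
    by (simp add: mult.assoc mult.commute[of "pd _ u _"])
  then show ?thesis by (simp add: mult.commute[of "lap w _"])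
qed

text \<open>For u = x_k \<phi> compare Q u paired with \<phi> and u paired with Q \<phi>, where Q is
  the operator in the hypothesis. The term with \<open>c\<close> cancels pointwise,
  \<open>lap\<close> contributes nothing by Green's identity, and the product rule leaves exactly
  b_k \<phi>^2 from the first order term.\<close>

lemma quadratic_first_order_integral_zero:
  assumes G': "self_adjoint M G'"
    and Q: "\<And>u. u \<in> test_functions \<Longrightarrow> (u, \<lambda>x. lap u x + (\<Sum>i\<in>UNIV. b i x * pd i u x) + c x * u x) \<in> G'"
    and b: "\<And>i. b i \<in> smooth_functions" and c: "c \<in> smooth_functions" and \<phi>: "\<phi> \<in> test_functions"
  shows "(LBINT x. \<sigma> x * b k x * (\<phi> x)\<^sup>2) = 0"
proof -
  define Qu where "Qu u x = lap u x + (\<Sum>i\<in>UNIV. b i x * pd i u x) + c x * u x" for u x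
  have Qs: "Qu u \<in> smooth_functions" if "u \<in> smooth_functions" for u
    unfolding Qu_def[abs_def] using that b c by (intro smooth_add smooth_sum smooth_mult lap_smooth smooth_pd)
  define u where "u x = \<phi> x * x $ k" for x
  have \<phi>s: "\<phi> \<in> smooth_functions" using \<phi> by (rule test_smooth)
  have u: "u \<in> test_functions" unfolding u_def[abs_def] using \<phi> by (intro test_mult_smooth smooth_nth)
  have us: "u \<in> smooth_functions" using u by (rule test_smooth)
  have pu: "pd i u x = pd i \<phi> x * x $ k + (if i = k then \<phi> x else 0)" for i x
    unfolding u_def[abs_def] by (simp add: pd_mult \<phi>s pd_nth)
  have meas: "(\<lambda>x. v x * w x) \<in> borel_measurable borel" if "v \<in> smooth_functions" "w \<in> smooth_functions" for v w
    using smooth_measurable[OF smooth_mult[OF that]] .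
  have "(\<integral>x. Qu u x * \<phi> x \<partial>M) = (\<integral>x. u x * Qu \<phi> x \<partial>M)"
  proof -
    \<comment> \<open>Since \<open>G'\<close> equals its adjoint, two of its elements may be paired
      with each other.\<close>
    have "(\<phi>, Qu \<phi>) \<in> adjoint_graph M G'" "(u, Qu u) \<in> G'"
      using G' Q[OF \<phi>] Q[OF u] unfolding self_adjoint_def Qu_def[abs_def] by simp_all
    then show ?thesis by (rule adjoint_graph_D)
  qed
  then have "(LBINT x. \<sigma> x * (Qu u x * \<phi> x)) = (LBINT x. \<sigma> x * (u x * Qu \<phi> x))"
    by (simp only: integral_weighted(1)[OF \<sigma> meas[OF Qs[OF us] \<phi>s]] integral_weighted(1)[OF \<sigma> meas[OF us Qs[OF \<phi>s]]])
  moreover have "\<sigma> x * (Qu u x * \<phi> x) - \<sigma> x * (u x * Qu \<phi> x)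
      = \<sigma> x * (lap u x * \<phi> x) - \<sigma> x * (u x * lap \<phi> x) + \<sigma> x * b k x * (\<phi> x)\<^sup>2" for x
  proof -
    have "(\<Sum>i\<in>UNIV. b i x * pd i u x) = x $ k * (\<Sum>i\<in>UNIV. b i x * pd i \<phi> x) + b k x * \<phi> x"
      unfolding pu distrib_left sum.distrib sum_distrib_left
      by (simp add: if_distrib[of "\<lambda>t. _ * t"] mult_ac cong: if_cong)
    then show ?thesis unfolding Qu_def u_def by (simp add: algebra_simps power2_eq_square)
  qed
  moreover have "integrable lborel (\<lambda>x. \<sigma> x * (Qu u x * \<phi> x))" "integrable lborel (\<lambda>x. \<sigma> x * (u x * Qu \<phi> x))"
    "integrable lborel (\<lambda>x. \<sigma> x * (lap u x * \<phi> x))" "integrable lborel (\<lambda>x. \<sigma> x * (u x * lap \<phi> x))"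
    "integrable lborel (\<lambda>x. \<sigma> x * b k x * (\<phi> x)\<^sup>2)"
  proof -
    have t: "(\<lambda>x. \<sigma> x * (v x * \<phi> x)) \<in> test_functions" if "v \<in> smooth_functions" for v
      by (intro test_mult_smooth(2) \<phi> that \<sigma>)
    have t': "(\<lambda>x. \<sigma> x * (u x * v x)) \<in> test_functions" if "v \<in> smooth_functions" for v
      by (rule test_mult_smooth(2)[OF test_mult_smooth(1)[OF u that] \<sigma>(1)])
    show "integrable lborel (\<lambda>x. \<sigma> x * (Qu u x * \<phi> x))" "integrable lborel (\<lambda>x. \<sigma> x * (lap u x * \<phi> x))"
      by (rule test_integrable[OF t]; intro Qs lap_smooth us)+
    show "integrable lborel (\<lambda>x. \<sigma> x * (u x * Qu \<phi> x))" "integrable lborel (\<lambda>x. \<sigma> x * (u x * lap \<phi> x))"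
      by (rule test_integrable[OF t']; intro Qs lap_smooth \<phi>s)+
    have "(\<lambda>x. \<sigma> x * ((b k x * \<phi> x) * \<phi> x)) \<in> test_functions"
      by (rule t) (intro smooth_mult b \<phi>s)
    then show "integrable lborel (\<lambda>x. \<sigma> x * b k x * (\<phi> x)\<^sup>2)"
      using test_integrable by (simp add: power2_eq_square mult.assoc)
  qed
  moreover note lap_symmetric[OF us \<phi>]
  ultimately show ?thesis
    using Bochner_Integration.integral_diff[of lborel "\<lambda>x. \<sigma> x * (Qu u x * \<phi> x)" "\<lambda>x. \<sigma> x * (u x * Qu \<phi> x)"]
    by simp
qed

text \<open>Once the first order coefficients are gone, pairing (f, 0) with test functions and
  moving \<open>lap\<close> onto \<open>f\<close> shows that lap f + c f vanishes against all of
  them, and by continuity at every point.\<close>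

lemma coefficients_unique:
  assumes G': "self_adjoint M G'"
    and Q: "\<And>u. u \<in> test_functions \<Longrightarrow> (u, \<lambda>x. lap u x + (\<Sum>i\<in>UNIV. b i x * pd i u x) + c x * u x) \<in> G'"
    and b: "\<And>i. b i \<in> smooth_functions" and c: "c \<in> smooth_functions"
    and fG: "(f, \<lambda>x. 0 * f x) \<in> G'"
  shows "b k x = 0" "c x = - (lap f x / f x)"
proof -
  have b0: "b k x = 0" for k x
  proof -
    have s: "(\<lambda>x. \<sigma> x * b k x) \<in> smooth_functions" using \<sigma> b by auto
    have "AE x in lborel. \<sigma> x * b k x = 0"
    proof (rule AE_zero_if_bump_integrals_zero[OF local_integrable_smooth[OF s]])
      fix p q :: "real^'n" and n
      \<comment> \<open>Doubling the parameter gives the square root of a bump, to which the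
        quadratic identity applies.\<close>
      have "bump (real (Suc n)) p q x = (bump (2 * real (Suc n)) p q x)\<^sup>2" for x
        by (subst bump_square) (simp_all del: of_nat_Suc)
      then show "(LBINT x. \<sigma> x * b k x * bump (real (Suc n)) p q x) = 0"
        using quadratic_first_order_integral_zero[OF G' Q b c bump_test[of "2 * real (Suc n)" p q], of k]
        by (simp del: of_nat_Suc)
    qed
    from continuous_AE_zero[OF smooth_continuous[OF s] this, of x] show ?thesis
      using \<sigma>(2)[of x] by simp
  qed
  show "b k x = 0" by (rule b0)
  define z where "z x = \<sigma> x * (lap f x + c x * f x)" for x
  have s: "z \<in> smooth_functions"
    unfolding z_def[abs_def] using \<sigma> f c by (intro smooth_mult smooth_add lap_smooth)
  have "AE x in lborel. z x = 0"
  proof (rule AE_zero_if_test_integrals_zero[OF local_integrable_smooth[OF s]])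
    fix u :: "real^'n \<Rightarrow> real" assume u: "u \<in> test_functions"
    have us: "u \<in> smooth_functions" using u by (rule test_smooth)
    have fadj: "(f, \<lambda>x. 0 * f x) \<in> adjoint_graph M G'"
      using fG G' by (simp add: self_adjoint_def)
    have "(u, \<lambda>x. lap u x + c x * u x) \<in> G'" using Q[OF u] by (simp add: b0)
    from adjoint_graph_D[OF fadj this]
    have "(\<integral>x. (lap u x + c x * u x) * f x \<partial>M) = (\<integral>x. u x * (0 * f x) \<partial>M)" .
    moreover have "(\<lambda>x. (lap u x + c x * u x) * f x) \<in> borel_measurable borel"
      using us f c by (intro smooth_measurable smooth_mult smooth_add lap_smooth)
    ultimately have "(LBINT x. \<sigma> x * ((lap u x + c x * u x) * f x)) = 0"
      by (simp add: integral_weighted(1)[OF \<sigma>])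
    moreover have "\<sigma> x * ((lap u x + c x * u x) * f x) = \<sigma> x * (f x * lap u x) + \<sigma> x * (c x * f x * u x)" for x
      by (simp add: algebra_simps)
    moreover have int: "integrable lborel (\<lambda>x. \<sigma> x * (f x * lap u x))" "integrable lborel (\<lambda>x. \<sigma> x * (lap f x * u x))"
      "integrable lborel (\<lambda>x. \<sigma> x * (c x * f x * u x))"
    proof -
      have "lap u \<in> test_functions"
        unfolding lap_def[abs_def]
        using u a smooth_inverse[OF \<sigma>] by (intro test_mult_smooth smooth_minus test_sum test_pd) auto
      then show "integrable lborel (\<lambda>x. \<sigma> x * (f x * lap u x))"
        by (intro test_integrable test_mult_smooth(2) f \<sigma>)
      show "integrable lborel (\<lambda>x. \<sigma> x * (lap f x * u x))" "integrable lborel (\<lambda>x. \<sigma> x * (c x * f x * u x))"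
        by (intro test_integrable test_mult_smooth(2)[OF test_mult_smooth(2)[OF u]] smooth_mult lap_smooth f \<sigma> c)+
    qed
    ultimately have "(LBINT x. \<sigma> x * (lap f x * u x)) + (LBINT x. \<sigma> x * (c x * f x * u x)) = 0"
      using lap_symmetric[OF f(1) u] by simp
    then have "(LBINT x. \<sigma> x * (lap f x * u x) + \<sigma> x * (c x * f x * u x)) = 0"
      using int by simp
    then show "(LBINT x. z x * u x) = 0"
      by (simp add: z_def algebra_simps)
  qed
  from continuous_AE_zero[OF smooth_continuous[OF s] this, of x]
  have "lap f x + c x * f x = 0" using \<sigma>(2)[of x] by (simp add: z_def)
  then show "c x = - (lap f x / f x)" using f(2)[of x] by (simp add: field_simps)
qed

end

subsection \<open>The round sphere\<close>

definition sph_density :: "real^'n::finite \<Rightarrow> real" where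
  "sph_density x = 2 ^ CARD('n) * (1 + (norm x)\<^sup>2) powr (- real CARD('n))"

text \<open>With \<lambda> = 2/(1 + r^2) the metric is \<lambda>^2 times the identity. The volume
  density is \<lambda>^d, and the density times the inverse metric is \<lambda>^(d-2), which is this
  function.\<close>

definition sph_conductivity :: "real^'n::finite \<Rightarrow> real" where
  "sph_conductivity x = 2 ^ CARD('n) / 4 * (1 + (norm x)\<^sup>2) powr (2 - real CARD('n))"

lemma one_plus_norm_sq_pos: "1 + (norm x)\<^sup>2 > (0::real)"
  by (simp add: add_pos_nonneg)

lemma smooth_one_plus_norm_sq_powr: "(\<lambda>x. (1 + (norm x)\<^sup>2) powr p) \<in> smooth_functions"
  by (intro smooth_powr smooth_add smooth_const smooth_norm_sq one_plus_norm_sq_pos)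

lemma pd_one_plus_norm_sq_powr:
  "pd i (\<lambda>x. (1 + (norm x)\<^sup>2) powr p) x = 2 * p * x $ i * (1 + (norm x)\<^sup>2) powr (p - 1)"
proof -
  have "((\<lambda>t. t powr p) has_real_derivative p * (1 + (norm x)\<^sup>2) powr (p - 1)) (at (1 + (norm x)\<^sup>2))"
    by (rule has_real_derivative_powr[OF one_plus_norm_sq_pos])
  moreover have "(\<lambda>x. 1 + (norm x)\<^sup>2) \<in> smooth_functions" by auto
  ultimately have "pd i (\<lambda>x. (1 + (norm x)\<^sup>2) powr p) x
      = p * (1 + (norm x)\<^sup>2) powr (p - 1) * pd i (\<lambda>x. 1 + (norm x)\<^sup>2) x"
    by (rule pd_compose[rotated])
  also have "pd i (\<lambda>x. 1 + (norm x)\<^sup>2) x = 2 * x $ i"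
    by (simp add: pd_add pd_norm_sq)
  finally show ?thesis by simp
qed

lemma sqrt_det_round_metric: "sqrt (det (round_metric x)) = sph_density x"
proof -
  let ?s = "1 + (norm x)\<^sup>2"
  have s: "?s > 0" by (rule one_plus_norm_sq_pos)
  have "det (round_metric x) = (4 / ?s\<^sup>2) ^ CARD('a)"
    by (subst det_diagonal) (auto simp: round_metric_def mat_def)
  also have "\<dots> = ((2 / ?s) ^ CARD('a))\<^sup>2"
  proof -
    have "4 / ?s\<^sup>2 = (2 / ?s)\<^sup>2" by (simp add: power_divide)
    then show ?thesis by (simp only: power_mult[symmetric] mult.commute)
  qed
  finally have "sqrt (det (round_metric x)) = (2 / ?s) ^ CARD('a)"
    using s by (simp add: real_sqrt_unique)
  then show ?thesis
    using s by (simp add: sph_density_def powr_minus powr_realpow power_divide divide_inverse power_inverse)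
qed

lemma matrix_inv_round_metric:
  "matrix_inv (round_metric x) $ i $ j = (if i = j then (1 + (norm x)\<^sup>2)\<^sup>2 / 4 else 0)"
proof -
  define c where "c = 4 / (1 + (norm x)\<^sup>2)\<^sup>2"
  have c: "c \<noteq> 0" using one_plus_norm_sq_pos[of x] by (simp add: c_def)
  have sm: "(c *\<^sub>R mat 1) ** B = c *\<^sub>R B" for c and B :: "real^'a^'a"

    by (simp add: vec_eq_iff matrix_matrix_mult_def mat_def mult.assoc if_distrib[of "\<lambda>t. t * _"]
        if_distrib[of "\<lambda>t. c * t"] cong: if_cong)
  let ?A = "round_metric x"
  have A: "?A = c *\<^sub>R mat 1" by (simp add: round_metric_def c_def)
  have "?A ** ((1 / c) *\<^sub>R mat 1) = mat 1 \<and> ((1 / c) *\<^sub>R mat 1) ** ?A = mat 1"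
    unfolding A sm using c by simp
  then have "?A ** matrix_inv ?A = mat 1"
    unfolding matrix_inv_def by (rule someI2) blast
  then have "c *\<^sub>R matrix_inv ?A = mat 1" unfolding A sm .
  then have "matrix_inv ?A = (1 / c) *\<^sub>R mat 1" using c
    by (metis divideR_right real_scaleR_def scaleR_scaleR divide_inverse mult.left_neutral scaleR_one left_inverse)
  then show ?thesis by (simp add: c_def mat_def)
qed

lemma sph_conductivity_eq: "sph_conductivity x = sph_density x * ((1 + (norm x)\<^sup>2)\<^sup>2 / 4)"
proof -
  have "(1 + (norm x)\<^sup>2) powr (2 - real CARD('a)) = (1 + (norm x)\<^sup>2) powr (- real CARD('a)) * (1 + (norm x)\<^sup>2) powr 2"
    using powr_add[of "1 + (norm x)\<^sup>2" "- real CARD('a)" 2] by simp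
  moreover have "(1 + (norm x)\<^sup>2) powr 2 = (1 + (norm x)\<^sup>2)\<^sup>2"
    using powr_realpow[OF one_plus_norm_sq_pos[of x], of 2] by simp
  ultimately show ?thesis by (simp add: sph_conductivity_def sph_density_def)
qed

lemma sphere_laplacian_eq:
  assumes "u \<in> smooth_functions"
  shows "sphere_laplacian u x = - (1 / sph_density x) * (\<Sum>i\<in>UNIV. pd i (\<lambda>y. sph_conductivity y * pd i u y) x)"
proof -
  have "sqrt (det (round_metric y)) * (\<Sum>j\<in>UNIV. matrix_inv (round_metric y) $ i $ j * pd j u y)
      = sph_conductivity y * pd i u y" for i y
    by (simp add: matrix_inv_round_metric sqrt_det_round_metric sph_conductivity_eq
        if_distrib[of "\<lambda>c. c * _"] cong: if_cong)
  then show ?thesis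
    using assms by (simp add: laplace_beltrami_def sqrt_det_round_metric)
qed

lemma inverse_one_plus_sq_integral_finite: "(\<integral>\<^sup>+t. ennreal (1 / (1 + t\<^sup>2)) \<partial>lborel) < \<infinity>"
proof -
  have half: "(\<integral>\<^sup>+t. ennreal (1 / (1 + t\<^sup>2)) * indicator {0..} t \<partial>lborel) = ennreal (pi / 2 - arctan 0)"
    by (rule nn_integral_FTC_atLeast) (auto intro!: derivative_eq_intros tendsto_arctan_at_top simp: add_nonneg_eq_0_iff field_simps)
  have "(\<integral>\<^sup>+t. ennreal (1 / (1 + t\<^sup>2)) \<partial>lborel)
      \<le> (\<integral>\<^sup>+t. ennreal (1 / (1 + t\<^sup>2)) * indicator {0..} t + ennreal (1 / (1 + (- t)\<^sup>2)) * indicator {0..} (- t) \<partial>lborel)"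
    by (intro nn_integral_mono) (auto simp: indicator_def)
  also have "\<dots> = (\<integral>\<^sup>+t. ennreal (1 / (1 + t\<^sup>2)) * indicator {0..} t \<partial>lborel)
      + (\<integral>\<^sup>+t. ennreal (1 / (1 + (- t)\<^sup>2)) * indicator {0..} (- t) \<partial>lborel)"
    by (rule nn_integral_add) auto
  also have "(\<integral>\<^sup>+t. ennreal (1 / (1 + (- t)\<^sup>2)) * indicator {0..} (- t) \<partial>lborel)
      = (\<integral>\<^sup>+t. ennreal (1 / (1 + t\<^sup>2)) * indicator {0..} t \<partial>distr lborel borel uminus)"
    by (subst nn_integral_distr) auto
  finally have "(\<integral>\<^sup>+t. ennreal (1 / (1 + t\<^sup>2)) \<partial>lborel) \<le> ennreal (pi / 2 - arctan 0) + ennreal (pi / 2 - arctan 0)"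
    unfolding lborel_distr_uminus half .
  then show ?thesis by (rule le_less_trans) simp
qed

text \<open>Each factor \<open>1 + x\<^sub>i\<^sup>2\<close> is at most \<open>1 + \<bar>x\<bar>\<^sup>2\<close>, so the integral is bounded by a product of
  one-dimensional ones.\<close>

lemma integrable_one_plus_norm_sq_powr:
  assumes "p \<le> - real CARD('n)"
  shows "integrable lborel (\<lambda>x::real^'n::finite. (1 + (norm x)\<^sup>2) powr p)"
proof (rule integrableI_nonneg)
  show "(\<lambda>x::real^'n. (1 + (norm x)\<^sup>2) powr p) \<in> borel_measurable lborel"
    using smooth_measurable[OF smooth_one_plus_norm_sq_powr] by simp
  have le: "(1 + (norm x)\<^sup>2) powr p \<le> (\<Prod>b\<in>Basis. 1 / (1 + (x \<bullet> b)\<^sup>2))" for x :: "real^'n"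
  proof -
    let ?s = "1 + (norm x)\<^sup>2"
    have s: "?s \<ge> 1" by simp
    have "?s powr p \<le> ?s powr (- real CARD('n))" using assms s by (intro powr_mono) auto
    also have "\<dots> = (\<Prod>b\<in>(Basis :: (real^'n) set). 1 / ?s)"
      using s by (simp add: powr_minus powr_realpow divide_inverse power_inverse add_pos_nonneg)
    also have "\<dots> \<le> (\<Prod>b\<in>Basis. 1 / (1 + (x \<bullet> b)\<^sup>2))"
    proof (rule prod_mono, intro conjI divide_left_mono)
      fix b :: "real^'n" assume "b \<in> Basis"
      then have "\<bar>x \<bullet> b\<bar> \<le> norm x" by (rule Basis_le_norm)
      then show "1 + (x \<bullet> b)\<^sup>2 \<le> ?s" using power_mono[of "\<bar>x \<bullet> b\<bar>" "norm x" 2] by simp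
    qed (auto intro!: mult_pos_pos add_pos_nonneg)
    finally show ?thesis .
  qed
  have "(\<integral>\<^sup>+x. ennreal ((1 + (norm (x :: real^'n))\<^sup>2) powr p) \<partial>lborel)
      \<le> (\<integral>\<^sup>+x. (\<Prod>b\<in>(Basis::(real^'n) set). ennreal (1 / (1 + (x \<bullet> b)\<^sup>2))) \<partial>lborel)"
  proof (rule nn_integral_mono)
    fix x :: "real^'n"
    show "ennreal ((1 + (norm x)\<^sup>2) powr p) \<le> (\<Prod>b\<in>Basis. ennreal (1 / (1 + (x \<bullet> b)\<^sup>2)))"
      by (subst prod_ennreal) (auto intro!: ennreal_leI le)
  qed
  also have "\<dots> = (\<Prod>b\<in>(Basis::(real^'n) set). \<integral>\<^sup>+t. ennreal (1 / (1 + t\<^sup>2)) \<partial>lborel)"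
    by (rule nn_integral_lborel_prod) auto
  also have "\<dots> < \<infinity>"
    using inverse_one_plus_sq_integral_finite by (simp add: power_less_top_ennreal)
  finally show "(\<integral>\<^sup>+x. ennreal ((1 + (norm (x :: real^'n))\<^sup>2) powr p) \<partial>lborel) < \<infinity>" .
qed simp

text \<open>The density times the square of the state decays with the exponent -d - 2k, which is at
  most -d for nonnegative \<open>k\<close>; this is the range covered by the integrability
  estimate.\<close>

lemma ground_state_problem_sphere:
  assumes k: "k \<ge> 0"
  shows "ground_state_problem (sph_density :: real^'n::finite \<Rightarrow> real) sph_conductivity (power_state k)"
proof
  show "(sph_density :: real^'n \<Rightarrow> real) \<in> smooth_functions"
    "(sph_conductivity :: real^'n \<Rightarrow> real) \<in> smooth_functions"
    "(power_state k :: real^'n \<Rightarrow> real) \<in> smooth_functions"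
    unfolding sph_density_def[abs_def] sph_conductivity_def[abs_def] power_state_def[abs_def]
    by (intro smooth_cmult smooth_one_plus_norm_sq_powr)+
  show "sph_density x > 0" "sph_conductivity x > 0" "power_state k x > 0" for x :: "real^'n"
    using one_plus_norm_sq_pos[of x] by (auto simp: sph_density_def sph_conductivity_def power_state_def)
  show "sph_density (R *v x) = sph_density x \<and> sph_conductivity (R *v x) = sph_conductivity x \<and>
      power_state k (R *v x) = power_state k x" if "orthogonal_matrix R" for R :: "real^'n^'n" and x
    by (simp add: sph_density_def sph_conductivity_def power_state_def norm_orthogonal_matrix[OF that])
  have "sph_density x * (power_state k x)\<^sup>2 = 2 ^ CARD('n) * (1 + (norm x)\<^sup>2) powr (- real CARD('n) - 2 * k)"
    for x :: "real^'n"
    unfolding sph_density_def power_state_def power2_eq_square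
    by (simp flip: powr_add)
  then show "integrable lborel (\<lambda>x::real^'n. sph_density x * (power_state k x)\<^sup>2)"
    using integrable_one_plus_norm_sq_powr[where 'n = 'n, of "- real CARD('n) - 2 * k"] k by simp
qed

lemma smooth_sph:
  "sph_density \<in> smooth_functions" "sph_conductivity \<in> smooth_functions" "sph_density x > 0"
proof -
  interpret ground_state_problem sph_density sph_conductivity "power_state 0"
    by (rule ground_state_problem_sphere) simp
  show "sph_density \<in> smooth_functions" "sph_conductivity \<in> smooth_functions" "sph_density x > 0"
    using \<sigma> a by auto
qed

text \<open>The first order term comes from differentiating the conductivity. It carries the factor
  d - 2 because the conductivity is constant in dimension 2, where the Laplacian is conformally
  covariant.\<close>

lemma sphere_laplacian_expand:
  fixes u :: "real^'n::finite \<Rightarrow> real"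
  assumes u: "u \<in> smooth_functions"
  shows "sphere_laplacian u x = - (1/4) * (1 + (norm x)\<^sup>2)\<^sup>2 * (\<Sum>i\<in>UNIV. pd i (pd i u) x)
    + (real CARD('n) - 2) / 2 * (1 + (norm x)\<^sup>2) * (\<Sum>i\<in>UNIV. x $ i * pd i u x)"
proof -
  let ?s = "1 + (norm x)\<^sup>2"
  have s: "?s > 0" by (rule one_plus_norm_sq_pos)
  have d: "sph_density x \<noteq> 0" using smooth_sph(3)[of x] by simp
  have pa: "pd i sph_conductivity x = sph_density x * ((2 - real CARD('n)) / 2 * ?s * x $ i)" for i
  proof -
    have "pd i sph_conductivity x = 2 ^ CARD('n) / 4 * (2 * (2 - real CARD('n)) * x $ i * ?s powr (2 - real CARD('n) - 1))"
      unfolding sph_conductivity_def[abs_def]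
      by (subst pd_cmult[OF smooth_one_plus_norm_sq_powr]) (simp only: pd_one_plus_norm_sq_powr)
    also have "?s powr (2 - real CARD('n) - 1) = ?s powr (- real CARD('n)) * ?s"
      using powr_add[of ?s "- real CARD('n)" 1] s by simp
    finally show ?thesis by (simp add: sph_density_def field_simps)
  qed
  have "pd i (\<lambda>y. sph_conductivity y * pd i u y) x
      = sph_density x * (?s\<^sup>2 / 4 * pd i (pd i u) x - (real CARD('n) - 2) / 2 * ?s * (x $ i * pd i u x))" for i
    by (subst pd_mult[OF smooth_sph(2) smooth_pd[OF u]]) (simp add: pa sph_conductivity_eq field_simps)
  then have "(\<Sum>i\<in>UNIV. pd i (\<lambda>y. sph_conductivity y * pd i u y) x) = sph_density x *
      (?s\<^sup>2 / 4 * (\<Sum>i\<in>UNIV. pd i (pd i u) x) - (real CARD('n) - 2) / 2 * ?s * (\<Sum>i\<in>UNIV. x $ i * pd i u x))"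
    by (simp add: sum_subtractf sum_distrib_left right_diff_distrib)
  then show ?thesis unfolding sphere_laplacian_eq[OF u] using d by simp
qed

lemma sum_coordinates_sq: "(\<Sum>i\<in>UNIV. x $ i * x $ i) = (norm (x :: real^'n::finite))\<^sup>2"
  by (simp add: power2_norm_eq_inner inner_vec_def)

lemma sphere_laplacian_power_state:
  fixes x :: "real^'n::finite"
  defines "d \<equiv> real CARD('n)"
  shows "sphere_laplacian (power_state k) x = (d * k / 2 - k * (k + (d - 2) / 2) * (norm x)\<^sup>2) * power_state k x"
proof -
  let ?s = "1 + (norm x)\<^sup>2"
  have s: "?s > 0" by (rule one_plus_norm_sq_pos)
  have f: "power_state k \<in> smooth_functions"
    unfolding power_state_def[abs_def] by (rule smooth_one_plus_norm_sq_powr)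
  have p1: "pd i (power_state k) = (\<lambda>y. (- 2 * k) * (y $ i * (1 + (norm y)\<^sup>2) powr (- k - 1)))" for i :: 'n
    unfolding power_state_def[abs_def] by (simp add: fun_eq_iff pd_one_plus_norm_sq_powr)
  have e1: "?s powr (- k - 1) = power_state k x / ?s"
    using s by (simp add: power_state_def powr_diff)
  have "?s powr (- k - 1 - 1) = ?s powr (- k - 1) / ?s powr 1" by (rule powr_diff)
  also have "\<dots> = power_state k x / ?s\<^sup>2"
    unfolding e1 using s by (simp add: power2_eq_square)
  finally have e2: "?s powr (- k - 1 - 1) = power_state k x / ?s\<^sup>2" .
  note e = e1 e2
  have p2: "pd i (pd i (power_state k)) x
      = (- 2 * k) * (power_state k x / ?s + 2 * (- k - 1) * (x $ i * x $ i) * (power_state k x / ?s\<^sup>2))" for i :: 'n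
    unfolding p1
    by (subst pd_cmult, intro smooth_mult smooth_nth smooth_one_plus_norm_sq_powr,
        subst pd_mult[OF smooth_nth smooth_one_plus_norm_sq_powr])
      (simp add: pd_nth pd_one_plus_norm_sq_powr e[symmetric])
  have S2: "(\<Sum>i\<in>UNIV. pd i (pd i (power_state k)) x)
      = (- 2 * k) * (d * (power_state k x / ?s) + 2 * (- k - 1) * (norm x)\<^sup>2 * (power_state k x / ?s\<^sup>2))"
    unfolding p2 sum_distrib_left[symmetric] sum.distrib sum_distrib_right[symmetric] sum_coordinates_sq d_def by simp
  have "x $ i * pd i (power_state k) x = (- 2 * k) * (power_state k x / ?s) * (x $ i * x $ i)" for i
    by (simp add: p1 e)
  then have S1: "(\<Sum>i\<in>UNIV. x $ i * pd i (power_state k) x) = (- 2 * k) * (power_state k x / ?s) * (norm x)\<^sup>2"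
    by (simp only: sum_distrib_left[symmetric] sum_coordinates_sq)
  have alg: "- (1/4) * s\<^sup>2 * ((- 2 * k) * (d * (F / s) + 2 * (- k - 1) * r * (F / s\<^sup>2)))
      + (d - 2) / 2 * s * ((- 2 * k) * (F / s) * r) = (d * k / 2 - k * (k + (d - 2) / 2) * r) * F"
    if sr: "s = 1 + r" and s0: "s > 0" for s r F :: real
  proof -
    \<comment> \<open>Writing \<open>F\<close> as h s^2 clears all denominators and leaves a
      polynomial identity in \<open>h\<close> and \<open>r\<close>.\<close>
    obtain h where h: "F = h * s\<^sup>2" using s0 by (metis divide_eq_eq less_irrefl zero_less_power)
    have q: "F / s = h * s" "F / s\<^sup>2 = h" using s0 by (simp_all add: h power2_eq_square)
    show ?thesis unfolding q unfolding h sr by (simp add: field_simps power2_eq_square)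
  qed
  show ?thesis
    unfolding sphere_laplacian_expand[OF f] S1 S2 d_def[symmetric] by (rule alg) (use s in auto)
qed

subsection \<open>Existence and uniqueness on the sphere\<close>

text \<open>The potential is the one forced by requiring that \<open>power_state k\<close> be
  annihilated pointwise.\<close>

definition ground_state_op :: "real \<Rightarrow> 'n::finite diffop" where
  "ground_state_op k = (\<lambda>u\<in>smooth_functions. \<lambda>x.
     sphere_laplacian u x - sphere_laplacian (power_state k) x / power_state k x * u x)"

text \<open>The matrix \<open>A\<close> does not depend on \<open>c\<close>, so one and the same
  matrix witnesses the second order part of the Laplacian and of its perturbations by
  potentials.\<close>

lemma diffop2_sphere_laplacian:
  fixes c :: "real^'n::finite \<Rightarrow> real"
  defines "A \<equiv> \<lambda>x::real^'n. (- (1/4) * (1 + (norm x)\<^sup>2)\<^sup>2) *\<^sub>R (mat 1 :: real^'n^'n)"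
  assumes c: "c \<in> smooth_functions"
  shows "second_order_part (\<lambda>u\<in>smooth_functions. \<lambda>x. sphere_laplacian u x + c x * u x) A"
proof -
  define B :: "real^'n \<Rightarrow> real^'n" where "B x = ((real CARD('n) - 2) / 2 * (1 + (norm x)\<^sup>2)) *\<^sub>R x" for x
  have A_entry: "A x $ i $ j = (if i = j then - (1/4) * (1 + (norm x)\<^sup>2)\<^sup>2 else 0)" for x i j
    by (simp add: A_def mat_def)
  have q: "(\<lambda>x::real^'n. - (1/4) * (1 + (norm x)\<^sup>2)\<^sup>2) \<in> smooth_functions"
    unfolding power2_eq_square[of "1 + _"] by (intro smooth_mult smooth_add smooth_const smooth_norm_sq)
  have A: "transpose (A x) = A x" for x by (auto simp: vec_eq_iff transpose_def A_entry)
  have As: "(\<lambda>x. A x $ i $ j) \<in> smooth_functions" for i j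
    unfolding A_entry using q smooth_const[of 0] by (cases "i = j"; simp only: if_True if_False simp_thms)
  have B: "(\<lambda>x. B x $ i) \<in> smooth_functions" for i
    unfolding B_def vector_scaleR_component real_scaleR_def by (intro smooth_mult smooth_add smooth_const smooth_norm_sq smooth_nth)
  have "(\<lambda>u\<in>smooth_functions. \<lambda>x. sphere_laplacian u x + c x * u x) = diffop2 A B c"
    unfolding diffop2_def
  proof (rule restrict_ext, rule ext)
    fix u and x :: "real^'n" assume u: "(u :: real^'n \<Rightarrow> real) \<in> smooth_functions"
    have "(\<Sum>i\<in>UNIV. \<Sum>j\<in>UNIV. A x $ i $ j * pd i (pd j u) x)
        = - (1/4) * (1 + (norm x)\<^sup>2)\<^sup>2 * (\<Sum>i\<in>UNIV. pd i (pd i u) x)"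
      by (simp add: A_entry if_distrib[of "\<lambda>t. t * _"] sum_distrib_left cong: if_cong)
    moreover have "(\<Sum>i\<in>UNIV. B x $ i * pd i u x)
        = (real CARD('n) - 2) / 2 * (1 + (norm x)\<^sup>2) * (\<Sum>i\<in>UNIV. x $ i * pd i u x)"
      by (simp add: B_def sum_distrib_left mult.assoc)
    ultimately show "sphere_laplacian u x + c x * u x = (\<Sum>i\<in>UNIV. \<Sum>j\<in>UNIV. A x $ i $ j * pd i (pd j u) x)
        + (\<Sum>i\<in>UNIV. B x $ i * pd i u x) + c x * u x"
      by (simp add: sphere_laplacian_expand[OF u])
  qed
  then show ?thesis unfolding second_order_part_def using A As B c by blast
qed

lemma sphere_laplacian_restrict:
  "(\<lambda>u\<in>smooth_functions. \<lambda>x. sphere_laplacian u x + 0 * u x) = sphere_laplacian"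
  by (simp add: laplace_beltrami_def restrict_def fun_eq_iff)

lemma sphere_volume_eq: "sphere_volume = weighted sph_density"
  by (simp add: riemannian_volume_def sqrt_det_round_metric)

text \<open>Existence comes from the explicit graph \<open>G\<close>, uniqueness from the
  determination of the coefficients. Leaving \<open>k\<close> free lets the statement serve for
  \<open>\<omega>\<close> as well as for the root \<open>ground_exponent\<close>.\<close>

lemma invariant_operator_iff:
  fixes Q :: "'n::finite diffop"
  assumes k: "k \<ge> 0"
  shows "invariant_operator_with_ground_state (power_state k) Q \<longleftrightarrow> Q = ground_state_op k"
proof -
  interpret ground_state_problem "sph_density :: real^'n \<Rightarrow> real" sph_conductivity "power_state k"
    by (rule ground_state_problem_sphere[OF k])
  have lap: "sphere_laplacian u = lap u" if "u \<in> smooth_functions" for u :: "real^'n \<Rightarrow> real"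
    using sphere_laplacian_eq[OF that] by (auto simp: lap_def)
  note lapf = lap[OF f(1)]
  have P: "ground_state_op k u = P u" if "u \<in> smooth_functions" for u :: "real^'n \<Rightarrow> real"
    using that by (simp add: ground_state_op_def P_def fun_eq_iff lap lapf)
  have cf: "(\<lambda>x::real^'n. - (lap (power_state k) x / power_state k x)) \<in> smooth_functions"
    using lap_f_quotient by (rule smooth_minus)
  have "invariant_operator_with_ground_state (power_state k) (ground_state_op k :: 'n diffop)"
    unfolding invariant_operator_with_ground_state_def
  proof
    have P_eq: "(ground_state_op k :: 'n diffop) = (\<lambda>u\<in>smooth_functions. \<lambda>x. sphere_laplacian u x
        + - (lap (power_state k) x / power_state k x) * u x)"
      unfolding ground_state_op_def lapf by (intro restrict_ext ext) simp
    show "same_second_order_part (ground_state_op k :: 'n diffop) sphere_laplacian"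
      unfolding same_second_order_part_def P_eq
      by (intro exI conjI)
        (rule diffop2_sphere_laplacian[OF cf], rule diffop2_sphere_laplacian[OF smooth_const[of 0], unfolded sphere_laplacian_restrict])
    show "\<exists>G. realization (ground_state_op k :: 'n diffop) G \<and> SO_invariant G \<and> ground_state sphere_volume G (power_state k) 0"
      unfolding realization_def sphere_volume_eq
    proof (intro exI[of _ G] conjI ballI G_self_adjoint G_SO_invariant G_ground_state)
      fix u :: "real^'n \<Rightarrow> real" assume "u \<in> test_functions"
      from P_in_G[OF this] show "(u, ground_state_op k u) \<in> G"
        unfolding P[OF test_smooth[OF \<open>u \<in> test_functions\<close>]] .
    qed
  qed
  moreover have "Q = ground_state_op k" if inv: "invariant_operator_with_ground_state (power_state k) Q"
  proof -
    obtain A b c b' c' where bc: "\<And>i. (\<lambda>x. b x $ i) \<in> smooth_functions" "c \<in> smooth_functions" "Q = diffop2 A b c"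
      "\<And>i. (\<lambda>x. b' x $ i) \<in> smooth_functions" "c' \<in> smooth_functions" "sphere_laplacian = diffop2 A b' c'"
      using inv unfolding invariant_operator_with_ground_state_def same_second_order_part_def second_order_part_def
      by blast
    obtain G' where "realization Q G'" "ground_state sphere_volume G' (power_state k) 0"
      using inv unfolding invariant_operator_with_ground_state_def by blast
    then have G': "self_adjoint M G'" "\<And>u. u \<in> test_functions \<Longrightarrow> (u, Q u) \<in> G'"
      and fG: "(power_state k, \<lambda>x. 0 * power_state k x) \<in> G'"
      unfolding realization_def ground_state_def eigenfunction_def sphere_volume_eq by blast+
    \<comment> \<open>Both operators have the second order matrix \<open>A\<close>, so only first
      and zeroth order terms remain in their difference.\<close>
    have Q: "Q u x = lap u x + (\<Sum>i\<in>UNIV. (b x $ i - b' x $ i) * pd i u x) + (c x - c' x) * u x"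
      if u: "u \<in> smooth_functions" for u x
    proof -
      have "Q u x - sphere_laplacian u x = (\<Sum>i\<in>UNIV. (b x $ i - b' x $ i) * pd i u x) + (c x - c' x) * u x"
        unfolding bc(3) bc(6) diffop2_def using u by (simp add: left_diff_distrib sum_subtractf)
      then show ?thesis using lap[OF u] by simp
    qed
    have Qt: "(u, \<lambda>x. lap u x + (\<Sum>i\<in>UNIV. (b x $ i - b' x $ i) * pd i u x) + (c x - c' x) * u x) \<in> G'"
      if u: "u \<in> test_functions" for u
    proof -
      have "Q u = (\<lambda>x. lap u x + (\<Sum>i\<in>UNIV. (b x $ i - b' x $ i) * pd i u x) + (c x - c' x) * u x)"
        by (rule ext) (rule Q[OF test_smooth[OF u]])
      then show ?thesis using G'(2)[OF u] by simp
    qed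
    have bs: "(\<lambda>x. b x $ i - b' x $ i) \<in> smooth_functions" for i by (intro smooth_diff bc)
    have cs: "(\<lambda>x. c x - c' x) \<in> smooth_functions" by (intro smooth_diff bc)
    have un: "b x $ i - b' x $ i = 0" "c x - c' x = - (lap (power_state k) x / power_state k x)" for x i
      using coefficients_unique[of G' "\<lambda>i x. b x $ i - b' x $ i" "\<lambda>x. c x - c' x", OF G'(1) Qt bs cs fG] by auto
    show "Q = ground_state_op k"
    proof
      fix u :: "real^'n \<Rightarrow> real"
      show "Q u = ground_state_op k u"
      \<comment> \<open>On the remaining functions both operators take the default value of
        \<open>restrict\<close>.\<close>
      proof (cases "u \<in> smooth_functions")
        case True
        have "Q u x = P u x" for x
          by (simp add: Q[OF True] P_def un del: diff_eq_eq right_minus_eq)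
        then show ?thesis using P[OF True] by (simp add: fun_eq_iff)
      next
        case False
        then show ?thesis unfolding bc(3) diffop2_def ground_state_op_def by simp
      qed
    qed
  qed
  ultimately show ?thesis by blast
qed

text \<open>With e = d - 2 and q the square root, k = (q - e)/4 and k + e/2 = (q + e)/4, so the
  product is the difference of squares (q^2 - e^2)/16.\<close>

lemma ground_exponent_props:
  assumes "\<omega> > 0" "d \<ge> 1"
  shows "ground_exponent d \<omega> > 0"
    and "ground_exponent d \<omega> * (ground_exponent d \<omega> + (real d - 2) / 2) = \<omega>\<^sup>2"
proof -
  define e where "e = real d - 2"
  define q where "q = sqrt (e\<^sup>2 + 16 * \<omega>\<^sup>2)"
  have q2: "q\<^sup>2 = e\<^sup>2 + 16 * \<omega>\<^sup>2" unfolding q_def by (simp add: add_nonneg_nonneg)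
  have "sqrt (e\<^sup>2) < q" unfolding q_def using assms(1) by (intro real_sqrt_less_mono) simp
  then have "e < q" by simp
  then show "ground_exponent d \<omega> > 0" by (simp add: ground_exponent_def q_def e_def)
  have "ground_exponent d \<omega> = (q - e) / 4" by (simp add: ground_exponent_def q_def e_def)
  then have "ground_exponent d \<omega> * (ground_exponent d \<omega> + e / 2) = (q - e) / 4 * ((q - e) / 4 + e / 2)"
    by (rule arg_cong)
  also have "\<dots> = (q\<^sup>2 - e\<^sup>2) / 16" by (simp add: power2_eq_square field_simps)
  finally have "ground_exponent d \<omega> * (ground_exponent d \<omega> + e / 2) = (q\<^sup>2 - e\<^sup>2) / 16" .
  then show "ground_exponent d \<omega> * (ground_exponent d \<omega> + (real d - 2) / 2) = \<omega>\<^sup>2"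
    using q2 by (simp add: e_def)
qed

text \<open>The equation for the root matches the potential, and the constant d k/2 from the
  Laplacian of the state is precisely the energy shift subtracted in \<open>L_op\<close>.\<close>

lemma L_op_eq_ground_state_op:
  assumes "\<omega> > 0"
  shows "(L_op \<omega> :: 'n::finite diffop) = ground_state_op (ground_exponent CARD('n) \<omega>)"
proof -
  let ?k = "ground_exponent CARD('n) \<omega>"
  have k: "?k * (?k + (real CARD('n) - 2) / 2) = \<omega>\<^sup>2"
    by (rule ground_exponent_props(2)[OF assms]) simp
  have quot: "sphere_laplacian (power_state ?k) x / power_state ?k x
      = real CARD('n) * ?k / 2 - \<omega>\<^sup>2 * (norm x)\<^sup>2" for x :: "real^'n"
    unfolding sphere_laplacian_power_state k
    using one_plus_norm_sq_pos[of x] by (simp add: power_state_def)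
  show ?thesis
    unfolding L_op_def ground_state_op_def quot
    by (intro restrict_ext ext) (simp add: ground_exponent_def algebra_simps)
qed

subsection \<open>Polar coordinates\<close>

text \<open>The radial projection to the sphere of radius \<open>r\<close> kills the component of
  \<open>h\<close> along \<open>y\<close> and scales the tangential part by r/|y|.\<close>

lemma has_derivative_projection:
  fixes y :: "real^'n::finite"
  assumes "y \<noteq> 0"
  shows "((\<lambda>y. r *\<^sub>R sgn y) has_derivative
    (\<lambda>h. (r / norm y) *\<^sub>R (h - ((y \<bullet> h) / (norm y)\<^sup>2) *\<^sub>R y))) (at y)"
proof -
  have n: "((\<lambda>y. inverse (norm y)) has_derivative (\<lambda>h. - (inverse (norm y) * (h \<bullet> sgn y) * inverse (norm y)))) (at y)"
    using assms by (intro Deriv.has_derivative_inverse has_derivative_norm) auto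
  have "((\<lambda>y. r *\<^sub>R (inverse (norm y) *\<^sub>R y)) has_derivative
      (\<lambda>h. r *\<^sub>R (inverse (norm y) *\<^sub>R h + (- (inverse (norm y) * (h \<bullet> sgn y) * inverse (norm y))) *\<^sub>R y))) (at y)"
    by (intro has_derivative_scaleR_right has_derivative_scaleR n has_derivative_ident)
  moreover have "r *\<^sub>R (inverse (norm y) *\<^sub>R h + (- (inverse (norm y) * (h \<bullet> sgn y) * inverse (norm y))) *\<^sub>R y)
      = (r / norm y) *\<^sub>R (h - ((y \<bullet> h) / (norm y)\<^sup>2) *\<^sub>R y)" for h
    by (simp add: sgn_div_norm algebra_simps divide_inverse power2_eq_square inner_commute)
  ultimately show ?thesis by (simp add: sgn_div_norm)
qed

lemma has_derivative_degree_0: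
  fixes y :: "real^'n::finite"
  assumes w: "w \<in> smooth_functions" and y: "y \<noteq> 0"
  shows "((\<lambda>y. w (r *\<^sub>R sgn y)) has_derivative
    (\<lambda>h. (r / norm y) * (\<Sum>j\<in>UNIV. (h $ j - (y \<bullet> h) / (norm y)\<^sup>2 * y $ j) * pd j w (r *\<^sub>R sgn y)))) (at y)"
  using has_derivative_compose[OF has_derivative_projection[OF y] smooth_has_derivative[OF w]]
  by (simp add: sum_distrib_left mult.assoc)

text \<open>The result is arranged as products of powers of \<open>inverse (norm y)\<close>,
  coordinates and degree 0 functions, each of which is easy to differentiate once more at a unit
  vector.\<close>

lemma pd_degree_0:
  fixes y :: "real^'n::finite"
  assumes w: "w \<in> smooth_functions" and y: "y \<noteq> 0"
  shows "pd i (\<lambda>y. w (r *\<^sub>R sgn y)) y = r * (inverse (norm y) * pd i w (r *\<^sub>R sgn y)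
    - inverse (norm y) ^ 3 * (y $ i * (\<Sum>j\<in>UNIV. y $ j * pd j w (r *\<^sub>R sgn y))))"
proof -
  have "pd i (\<lambda>y. w (r *\<^sub>R sgn y)) y = (r / norm y) *
      (\<Sum>j\<in>UNIV. (axis i 1 $ j - (y \<bullet> axis i 1) / (norm y)\<^sup>2 * y $ j) * pd j w (r *\<^sub>R sgn y))"
    by (rule pd_eqI[OF has_derivative_degree_0[OF w y]])
  also have "(\<Sum>j\<in>UNIV. (axis i 1 $ j - (y \<bullet> axis i 1) / (norm y)\<^sup>2 * y $ j) * pd j w (r *\<^sub>R sgn y))
      = pd i w (r *\<^sub>R sgn y) - y $ i / (norm y)\<^sup>2 * (\<Sum>j\<in>UNIV. y $ j * pd j w (r *\<^sub>R sgn y))"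
    by (simp add: left_diff_distrib sum_subtractf inner_axis sum_distrib_left mult.assoc)
  finally show ?thesis
    using y by (simp add: field_simps power2_eq_square power3_eq_cube)
qed

text \<open>This is the Euclidean Laplacian in polar coordinates, the second radial derivative plus
  (d-1)/r times the first plus the angular part over r^2, solved for the angular part.\<close>

lemma angular_laplacian_eq:
  fixes x :: "real^'n::finite"
  assumes u: "u \<in> smooth_functions" and x: "x \<noteq> 0"
  defines "s \<equiv> sgn x" and "r \<equiv> norm x"
  shows "angular_laplacian u x = r\<^sup>2 * ((\<Sum>i\<in>UNIV. pd i (pd i u) x) - (\<Sum>i\<in>UNIV. \<Sum>j\<in>UNIV. s $ i * s $ j * pd i (pd j u) x))
    - r * (real CARD('n) - 1) * (\<Sum>j\<in>UNIV. s $ j * pd j u x)"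
proof -
  have s1: "norm s = 1" and s0: "s \<noteq> 0" using x by (simp_all add: s_def norm_sgn sgn_zero_iff)
  have rs: "r *\<^sub>R s = x" using x by (simp add: r_def s_def sgn_div_norm)
  have ss: "sgn s = s" using s1 by (simp add: sgn_div_norm)
  define U where "U j y = pd j u (r *\<^sub>R sgn y)" for j and y :: "real^'n"
  have Us: "U j s = pd j u x" for j by (simp add: U_def ss rs)
  define H where "H k j = pd k (pd j u) x" for k j
  define Q where "Q = (\<Sum>j\<in>UNIV. s $ j * pd j u x)"
  define DU where "DU j h = r * (\<Sum>k\<in>UNIV. (h $ k - (s \<bullet> h) * s $ k) * H k j)" for j and h :: "real^'n"
  have dU: "((\<lambda>y. U j y) has_derivative DU j) (at s)" for j
    using has_derivative_degree_0[OF smooth_pd[OF u, of j] s0, where r = r]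
    by (simp add: U_def DU_def[abs_def] H_def s1 ss rs)
  have dN: "((\<lambda>y. inverse (norm y)) has_derivative (\<lambda>h. - (s \<bullet> h))) (at s)"
    using Deriv.has_derivative_inverse[OF _ has_derivative_norm[OF s0]] s1 ss by (simp add: inner_commute)
  have dc: "((\<lambda>y. y $ i) has_derivative (\<lambda>h. h $ i)) (at s)" for i :: 'n
    by (rule bounded_linear.has_derivative[OF bounded_linear_vec_nth has_derivative_ident])
  define DQ where "DQ h = (\<Sum>j\<in>UNIV. s $ j * DU j h + h $ j * U j s)" for h :: "real^'n"
  have dQ: "((\<lambda>y. \<Sum>j\<in>UNIV. y $ j * U j y) has_derivative DQ) (at s)"
    unfolding DQ_def[abs_def] by (intro has_derivative_sum has_derivative_mult dc dU)
  have dN3: "((\<lambda>y. inverse (norm y) ^ 3) has_derivative (\<lambda>h. - 3 * (s \<bullet> h))) (at s)"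
    using has_derivative_power[OF dN, of 3] s1 by simp
  have pd2: "pd i (pd i (\<lambda>y. u (r *\<^sub>R sgn y))) s
      = r * (DU i (axis i 1) - s $ i * U i s - (s $ i * (DQ (axis i 1)) + Q - 3 * (s $ i * s $ i) * Q))" for i
  proof -
    let ?D = "\<lambda>h. r * ((inverse (norm s) * DU i h + - (s \<bullet> h) * U i s) -
        (inverse (norm s) ^ 3 * (s $ i * DQ h + h $ i * (\<Sum>j\<in>UNIV. s $ j * U j s))
          + - 3 * (s \<bullet> h) * (s $ i * (\<Sum>j\<in>UNIV. s $ j * U j s))))"
    have "((\<lambda>y. r * (inverse (norm y) * U i y - inverse (norm y) ^ 3 * (y $ i * (\<Sum>j\<in>UNIV. y $ j * U j y)))) has_derivative ?D) (at s)"
      by (intro has_derivative_mult_right has_derivative_diff has_derivative_mult dN dU dN3 dc dQ)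
    \<comment> \<open>The first derivative has its closed form off the origin only, so the second
      one is taken within this open set.\<close>
    moreover have "open (- {0 :: real^'n})" "s \<in> - {0}" using s0 by auto
    moreover have "r * (inverse (norm y) * U i y - inverse (norm y) ^ 3 * (y $ i * (\<Sum>j\<in>UNIV. y $ j * U j y)))
        = pd i (\<lambda>y. u (r *\<^sub>R sgn y)) y" if "y \<in> - {0}" for y
      using pd_degree_0[OF u, where y = y and i = i and r = r] that by (simp add: U_def)
    ultimately have "(pd i (\<lambda>y. u (r *\<^sub>R sgn y)) has_derivative ?D) (at s)"
      by (rule has_derivative_transform_within_open)
    from pd_eqI[OF this, of i] show ?thesis
      by (simp add: s1 inner_axis Us Q_def[symmetric] algebra_simps)
  qed
  have n1: "(\<Sum>i\<in>UNIV. s $ i * s $ i) = 1" using sum_coordinates_sq[of s] s1 by simp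
  define J where "J = (\<Sum>i\<in>UNIV. \<Sum>j\<in>UNIV. s $ i * s $ j * H i j)"
  define T where "T j = (\<Sum>k\<in>UNIV. s $ k * H k j)" for j
  have DUe: "DU j (axis i 1) = r * (H i j - s $ i * T j)" for i j
    by (simp add: DU_def T_def left_diff_distrib sum_subtractf inner_axis sum_distrib_left mult.assoc)
  have sT: "(\<Sum>j\<in>UNIV. s $ j * T j) = J"
    unfolding J_def T_def sum_distrib_left by (subst sum.swap) (simp add: mult_ac)
  have DQe: "DQ (axis i 1) = r * ((\<Sum>j\<in>UNIV. s $ j * H i j) - s $ i * J) + pd i u x" for i
  proof -
    have "DQ (axis i 1) = (\<Sum>j\<in>UNIV. r * (s $ j * H i j - s $ i * (s $ j * T j))) + pd i u x"
      unfolding DQ_def DUe sum.distrib Us axis_sum by (simp add: algebra_simps)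
    then show ?thesis by (simp only: sum_distrib_left[symmetric] sum_subtractf sT)
  qed
  have "angular_laplacian u x = (\<Sum>i\<in>UNIV. pd i (pd i (\<lambda>y. u (r *\<^sub>R sgn y))) s)"
    by (simp add: angular_laplacian_def r_def s_def)
  also have "\<dots> = (\<Sum>i\<in>UNIV. r\<^sup>2 * H i i - r\<^sup>2 * (s $ i * T i) - 2 * r * (s $ i * pd i u x)
      - r\<^sup>2 * (\<Sum>j\<in>UNIV. s $ i * s $ j * H i j) + r\<^sup>2 * J * (s $ i * s $ i) - r * Q + 3 * r * Q * (s $ i * s $ i))"
    unfolding pd2 DUe DQe Us
    by (intro sum.cong refl) (simp add: algebra_simps power2_eq_square sum_distrib_left)
  \<comment> \<open>As \<open>s\<close> is a unit vector, the multiples of r^2 J add up to -1 and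
    those of r Q to 1 - d.\<close>
  also have "\<dots> = r\<^sup>2 * (\<Sum>i\<in>UNIV. H i i) - r\<^sup>2 * J - 2 * r * Q - r\<^sup>2 * J + r\<^sup>2 * J * 1 - real CARD('n) * (r * Q) + 3 * r * Q * 1"
    unfolding sum.distrib sum_subtractf sum_distrib_left[symmetric] sT n1 J_def[symmetric] Q_def[symmetric]
    by simp
  finally show ?thesis
    unfolding H_def[symmetric] J_def[symmetric] Q_def[symmetric] by (simp add: algebra_simps)
qed

lemma pd_sum:
  "(\<And>j. j \<in> J \<Longrightarrow> u j \<in> smooth_functions) \<Longrightarrow> pd i (\<lambda>x. \<Sum>j\<in>J. u j x) = (\<lambda>x. \<Sum>j\<in>J. pd i (u j) x)"
  by (induction J rule: infinite_finite_induct) (auto simp: pd_add smooth_sum)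

lemma deriv_along_ray:
  assumes w: "w \<in> smooth_functions"
  shows "deriv (\<lambda>t. w (t *\<^sub>R s)) = (\<lambda>t. \<Sum>i\<in>UNIV. s $ i * pd i w (t *\<^sub>R s))"
proof
  fix t
  have "((\<lambda>t. t *\<^sub>R s) has_derivative (\<lambda>h. h *\<^sub>R s)) (at t)"
    by (auto intro!: derivative_eq_intros)
  note D = has_derivative_compose[OF this smooth_has_derivative[OF w]]
  have "(\<lambda>h. \<Sum>i\<in>UNIV. (h *\<^sub>R s) $ i * pd i w (t *\<^sub>R s)) = (*) (\<Sum>i\<in>UNIV. s $ i * pd i w (t *\<^sub>R s))"
    by (simp add: fun_eq_iff sum_distrib_left mult_ac)
  with D have "((\<lambda>t. w (t *\<^sub>R s)) has_real_derivative (\<Sum>i\<in>UNIV. s $ i * pd i w (t *\<^sub>R s))) (at t)"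
    by (simp only: has_field_derivative_def)
  then show "deriv (\<lambda>t. w (t *\<^sub>R s)) t = (\<Sum>i\<in>UNIV. s $ i * pd i w (t *\<^sub>R s))"
    by (rule DERIV_imp_deriv)
qed

lemma radial_deriv_eq:
  fixes x :: "real^'n::finite"
  assumes u: "u \<in> smooth_functions" and x: "x \<noteq> 0"
  defines "s \<equiv> sgn x"
  shows "radial_deriv 1 u x = (\<Sum>i\<in>UNIV. s $ i * pd i u x)"
    and "radial_deriv 2 u x = (\<Sum>i\<in>UNIV. \<Sum>j\<in>UNIV. s $ i * s $ j * pd i (pd j u) x)"
proof -
  have rs: "norm x *\<^sub>R s = x" using x by (simp add: s_def sgn_div_norm)
  show "radial_deriv 1 u x = (\<Sum>i\<in>UNIV. s $ i * pd i u x)"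
    by (simp add: radial_deriv_def s_def[symmetric] deriv_along_ray[OF u] rs)
  have w: "(\<lambda>y. \<Sum>j\<in>UNIV. s $ j * pd j u y) \<in> smooth_functions"
    using u by (intro smooth_sum smooth_cmult smooth_pd)
  have "radial_deriv 2 u x = deriv (deriv (\<lambda>t. u (t *\<^sub>R s))) (norm x)"
    by (simp add: radial_deriv_def s_def numeral_2_eq_2)
  also have "\<dots> = (\<Sum>i\<in>UNIV. s $ i * pd i (\<lambda>y. \<Sum>j\<in>UNIV. s $ j * pd j u y) x)"
    unfolding deriv_along_ray[OF u] using deriv_along_ray[OF w, of s] by (simp add: rs)
  also have "\<dots> = (\<Sum>i\<in>UNIV. s $ i * (\<Sum>j\<in>UNIV. s $ j * pd i (pd j u) x))"
    using u by (simp add: pd_sum pd_cmult)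
  finally show "radial_deriv 2 u x = (\<Sum>i\<in>UNIV. \<Sum>j\<in>UNIV. s $ i * s $ j * pd i (pd j u) x)"
    by (simp add: sum_distrib_left mult.assoc)
qed

lemma L_op_eq_L_polar:
  fixes x :: "real^'n::finite"
  assumes u: "u \<in> smooth_functions" and x: "x \<noteq> 0"
  shows "L_op \<omega> u x = L_polar \<omega> u x"
proof -
  define d where "d = real CARD('n)"
  define r where "r = norm x"
  have r: "r > 0" using x by (simp add: r_def)
  define D where "D = (\<Sum>i\<in>UNIV. pd i (pd i u) x)"
  have xs: "x $ i = r * sgn x $ i" for i using x by (simp add: r_def sgn_div_norm)
  have "(\<Sum>i\<in>UNIV. x $ i * pd i u x) = r * radial_deriv 1 u x"
    unfolding radial_deriv_eq(1)[OF u x] sum_distrib_left by (simp add: xs mult.assoc)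
  then have L: "sphere_laplacian u x = - (1/4) * (1 + r\<^sup>2)\<^sup>2 * D + (d - 2) / 2 * (1 + r\<^sup>2) * (r * radial_deriv 1 u x)"
    unfolding sphere_laplacian_expand[OF u] D_def d_def r_def by simp
  have A: "angular_laplacian u x = r\<^sup>2 * (D - radial_deriv 2 u x) - r * (d - 1) * radial_deriv 1 u x"
    unfolding angular_laplacian_eq[OF u x] radial_deriv_eq[OF u x] D_def d_def r_def by simp
  \<comment> \<open>The factor 1 + (d - 2)(1 - r^2)/s equals (d - 1) - 2 (d - 2) r^2/s. Its first
    part cancels the first order term of the angular Laplacian, and the second is the first order
    term of the sphere Laplacian.\<close>
  have alg: "- (1/4) * s\<^sup>2 * (u2 + 1 / r * (1 + (d - 2) * ((1 - r\<^sup>2) / s)) * u1 + 1 / r\<^sup>2 * (r\<^sup>2 * (D - u2) - r * (d - 1) * u1))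
      = - (1/4) * s\<^sup>2 * D + (d - 2) / 2 * s * (r * u1)" if "s = 1 + r\<^sup>2" for s u1 u2
  proof -
    have s: "s > 0" using that by (simp add: add_pos_nonneg)
    have e1: "1 / r\<^sup>2 * (r\<^sup>2 * (D - u2) - r * (d - 1) * u1) = D - u2 - (d - 1) / r * u1"
      using r by (simp add: field_simps power2_eq_square)
    have e2: "(1 - r\<^sup>2) / s = 1 - 2 * (r * (r / s))"
      using s that by (simp add: field_simps power2_eq_square)
    have e3: "1 / r * (1 + (d - 2) * (1 - 2 * (r * q))) * u1 - (d - 1) / r * u1 = - 2 * (d - 2) * q * u1" for q
      using r by (simp add: field_simps)
    have "u2 + 1 / r * (1 + (d - 2) * ((1 - r\<^sup>2) / s)) * u1 + 1 / r\<^sup>2 * (r\<^sup>2 * (D - u2) - r * (d - 1) * u1)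
        = D + - 2 * (d - 2) * (r / s) * u1"
      unfolding e1 e2 using e3[of "r / s"] by linarith
    moreover have "- (1/4) * s\<^sup>2 * (D + - 2 * (d - 2) * (r / s) * u1) = - (1/4) * s\<^sup>2 * D + (d - 2) / 2 * s * (r * u1)"
      using s by (simp add: field_simps power2_eq_square)
    ultimately show ?thesis by (simp only:)
  qed
  show ?thesis
    using u unfolding L_op_def L_polar_def Let_def r_def[symmetric] d_def[symmetric] L A alg[OF refl]
    by (simp add: L d_def[symmetric] r_def[symmetric])
qed

text \<open>For positive \<open>\<omega>\<close> the equation k (k + (d - 2)/2) = \<omega>^2 has the
  root k = \<omega> exactly when d = 2, which is why two exponents occur.\<close>

theorem theorem2p2:
  fixes \<omega> :: real
  assumes "\<omega> > 0"
  shows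
    "(\<exists>!P :: 'n::finite diffop. invariant_operator_with_ground_state (power_state \<omega>) P) \<and>
     (CARD('n) = 2 \<longrightarrow>
        invariant_operator_with_ground_state (power_state \<omega>) (L_op \<omega> :: 'n diffop)) \<and>
     (\<exists>!P :: 'n diffop.
        invariant_operator_with_ground_state (power_state (ground_exponent CARD('n) \<omega>)) P) \<and>
     invariant_operator_with_ground_state
        (power_state (ground_exponent CARD('n) \<omega>)) (L_op \<omega> :: 'n diffop) \<and>
     (\<forall>u \<in> smooth_functions. \<forall>x :: real^'n. x \<noteq> 0 \<longrightarrow> L_op \<omega> u x = L_polar \<omega> u x)"
proof -
  have k: "ground_exponent CARD('n) \<omega> \<ge> 0"
    using ground_exponent_props(1)[OF assms, of "CARD('n)"] by (simp add: less_imp_le)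
  \<comment> \<open>For d = 2 the square root is that of 16 \<omega>^2, which is 4 \<omega> because
    \<open>\<omega>\<close> is positive.\<close>
  have "ground_exponent 2 \<omega> = \<omega>"
    using assms by (simp add: ground_exponent_def real_sqrt_mult)
  then have two: "CARD('n) = 2 \<longrightarrow> ground_exponent CARD('n) \<omega> = \<omega>" by simp
  have L: "invariant_operator_with_ground_state (power_state (ground_exponent CARD('n) \<omega>)) (L_op \<omega> :: 'n diffop)"
    by (simp add: invariant_operator_iff[OF k] L_op_eq_ground_state_op[OF assms])
  show ?thesis
  proof (intro conjI)
    show "\<exists>!P :: 'n diffop. invariant_operator_with_ground_state (power_state \<omega>) P"
      using assms by (simp add: invariant_operator_iff)
    show "\<exists>!P :: 'n diffop. invariant_operator_with_ground_state (power_state (ground_exponent CARD('n) \<omega>)) P"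
      by (simp add: invariant_operator_iff[OF k])
    show "CARD('n) = 2 \<longrightarrow> invariant_operator_with_ground_state (power_state \<omega>) (L_op \<omega> :: 'n diffop)"
      using L two by metis
  qed (use L L_op_eq_L_polar in blast)+
qed

end
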